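(* Let $R$ be a ring with unity, let $\mathcal{X}$ be a semibrick of left $R$-modules and let $Y$ be a left $R$-module. For a short exact sequence $$0\to Y\xrightarrow{\alpha}M\xrightarrow{\beta}\bigoplus_{X\in\mathcal{X}}X^{(I_X)}\to0$$ (with index sets $I_X$, $X\in\mathcal{X}$) the following statements are equivalent: (i) The sequence is $\mathcal{X}$-universal. (ii) For every $X'\in\mathcal{X}$, the connecting homomorphism $\delta:\mathrm{Hom}(X',\bigoplus_{X\in\mathcal{X}}X^{(I_X)})\to\mathrm{Ext}^1(X',Y)$ is an isomorphism.
   Context: A brick is a finitely presented left $R$-module whose endomorphism ring is a division ring. A semibrick is a class $\mathcal{X}$ of pairwise non-isomorphic bricks with $\mathrm{Hom}(X,X')=0$ for distinct $X,X'\in\mathcal{X}$. $\mathcal{X}$-universal sequences: for each $X\in\mathcal{X}$, $\mathrm{Ext}^1(X,Y)$ is a left $\mathrm{End}(X)$-module (endomorphisms act by pull-back; compositions are written from left to right). Choose a basis $(0\to Y\to M_{X,i}\to X\to 0)_{i\in I_X}$ of it over the division ring $\mathrm{End}(X)$. The $\mathcal{X}$-universal short exact sequence starting from $Y$ for this choice of bases is the push-out $0\to Y\to M\to\bigoplus_{X\in\mathcal{X}}X^{(I_X)}\to 0$ of the direct sum sequence $0\to\bigoplus_{X}Y^{(I_X)}\to\bigoplus_{X,i}M_{X,i}\to\bigoplus_{X}X^{(I_X)}\to 0$ along the summation map $\bigoplus_X Y^{(I_X)}\to Y$. A short exact sequence $0\to Y\to M\to\bigoplus_{X\in\mathcal{X}}X^{(I_X)}\to0$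 is $\mathcal{X}$-universal if it is (equivalent to) the sequence obtained in this way from some choice of bases indexed by the sets $I_X$. *)

theory Defs
  imports "HOL-Algebra.Module" "HOL-Algebra.AbelCoset"
begin

section \<open>Left modules over a not necessarily commutative ring\<close>

text \<open>The library locale \<open>module\<close> demands a commutative ring, so only its record type is
  reused. The fields \<open>mult\<close> and \<open>one\<close>, which that record inherits from rings, play no role.\<close>

locale left_module = R?: ring R + M?: abelian_group M
  for R :: "('a, 'c) ring_scheme" (structure) and M :: "('a, 'b, 'd) module_scheme" (structure) +
  assumes smult_closed [simp, intro]:
      "\<lbrakk>a \<in> carrier R; x \<in> carrier M\<rbrakk> \<Longrightarrow> a \<odot>\<^bsub>M\<^esub> x \<in> carrier M"
    and smult_l_distr:
      "\<lbrakk>a \<in> carrier R; b \<in> carrier R; x \<in> carrier M\<rbrakk>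
        \<Longrightarrow> (a \<oplus>\<^bsub>R\<^esub> b) \<odot>\<^bsub>M\<^esub> x = a \<odot>\<^bsub>M\<^esub> x \<oplus>\<^bsub>M\<^esub> b \<odot>\<^bsub>M\<^esub> x"
    and smult_r_distr:
      "\<lbrakk>a \<in> carrier R; x \<in> carrier M; y \<in> carrier M\<rbrakk>
        \<Longrightarrow> a \<odot>\<^bsub>M\<^esub> (x \<oplus>\<^bsub>M\<^esub> y) = a \<odot>\<^bsub>M\<^esub> x \<oplus>\<^bsub>M\<^esub> a \<odot>\<^bsub>M\<^esub> y"
    and smult_assoc:
      "\<lbrakk>a \<in> carrier R; b \<in> carrier R; x \<in> carrier M\<rbrakk>
        \<Longrightarrow> (a \<otimes>\<^bsub>R\<^esub> b) \<odot>\<^bsub>M\<^esub> x = a \<odot>\<^bsub>M\<^esub> (b \<odot>\<^bsub>M\<^esub> x)"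
    and smult_one [simp]:
      "x \<in> carrier M \<Longrightarrow> \<one>\<^bsub>R\<^esub> \<odot>\<^bsub>M\<^esub> x = x"

definition mk_module ::
  "'b set \<Rightarrow> 'b \<Rightarrow> ('b \<Rightarrow> 'b \<Rightarrow> 'b) \<Rightarrow> ('a \<Rightarrow> 'b \<Rightarrow> 'b) \<Rightarrow> ('a, 'b) module"
  where "mk_module S z p s =
    \<lparr>carrier = S, mult = undefined, one = undefined, zero = z, add = p, smult = s\<rparr>"

definition module_hom ::
  "('a, 'c) ring_scheme \<Rightarrow> ('a, 'b) module \<Rightarrow> ('a, 'd) module \<Rightarrow> ('b \<Rightarrow> 'd) set"
  where "module_hom R M N =
    {f \<in> carrier M \<rightarrow> carrier N.
       (\<forall>x\<in>carrier M. \<forall>y\<in>carrier M. f (x \<oplus>\<^bsub>M\<^esub> y) = f x \<oplus>\<^bsub>N\<^esub> f y) \<and>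
       (\<forall>r\<in>carrier R. \<forall>x\<in>carrier M. f (r \<odot>\<^bsub>M\<^esub> x) = r \<odot>\<^bsub>N\<^esub> f x)}"

definition module_iso ::
  "('a, 'c) ring_scheme \<Rightarrow> ('a, 'b) module \<Rightarrow> ('a, 'd) module \<Rightarrow> ('b \<Rightarrow> 'd) set"
  where "module_iso R M N = {f \<in> module_hom R M N. bij_betw f (carrier M) (carrier N)}"

definition module_ker :: "('a, 'b) module \<Rightarrow> ('a, 'd) module \<Rightarrow> ('b \<Rightarrow> 'd) \<Rightarrow> 'b set"
  where "module_ker M N f = {x \<in> carrier M. f x = \<zero>\<^bsub>N\<^esub>}"

definition regular_module :: "('a, 'c) ring_scheme \<Rightarrow> ('a, 'a) module"
  where "regular_module R = mk_module (carrier R) \<zero>\<^bsub>R\<^esub> (add R) (mult R)"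

definition prod_module :: "('a, 'b) module \<Rightarrow> ('a, 'd) module \<Rightarrow> ('a, 'b \<times> 'd) module"
  where "prod_module M N =
    mk_module (carrier M \<times> carrier N) (\<zero>\<^bsub>M\<^esub>, \<zero>\<^bsub>N\<^esub>)
      (\<lambda>(m, n) (m', n'). (m \<oplus>\<^bsub>M\<^esub> m', n \<oplus>\<^bsub>N\<^esub> n'))
      (\<lambda>r (m, n). (r \<odot>\<^bsub>M\<^esub> m, r \<odot>\<^bsub>N\<^esub> n))"

definition direct_sum :: "'k set \<Rightarrow> ('k \<Rightarrow> ('a, 'b) module) \<Rightarrow> ('a, 'k \<Rightarrow> 'b) module"
  where "direct_sum K M =
    mk_module {f \<in> (\<Pi>\<^sub>E k\<in>K. carrier (M k)). finite {k \<in> K. f k \<noteq> \<zero>\<^bsub>M k\<^esub>}}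
      (\<lambda>k\<in>K. \<zero>\<^bsub>M k\<^esub>)
      (\<lambda>f g. \<lambda>k\<in>K. f k \<oplus>\<^bsub>M k\<^esub> g k)
      (\<lambda>r f. \<lambda>k\<in>K. r \<odot>\<^bsub>M k\<^esub> f k)"

definition submodule_of :: "('a, 'b) module \<Rightarrow> 'b set \<Rightarrow> ('a, 'b) module"
  where "submodule_of M S = mk_module S \<zero>\<^bsub>M\<^esub> (add M) (smult M)"

definition quotient_module :: "('a, 'b) module \<Rightarrow> 'b set \<Rightarrow> ('a, 'b set) module"
  where "quotient_module M S =
    mk_module (a_rcosets\<^bsub>M\<^esub> S) S (\<lambda>C D. C <+>\<^bsub>M\<^esub> D)
      (\<lambda>r C. \<Union>c\<in>C. S +>\<^bsub>M\<^esub> (r \<odot>\<^bsub>M\<^esub> c))"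

definition finitely_presented :: "('a, 'c) ring_scheme \<Rightarrow> ('a, 'b) module \<Rightarrow> bool"
  where "finitely_presented R M \<longleftrightarrow>
    (\<exists>(m::nat) (n::nat).
      \<exists>f \<in> module_hom R (direct_sum {..<m} (\<lambda>_. regular_module R))
                        (direct_sum {..<n} (\<lambda>_. regular_module R)).
      \<exists>g \<in> module_hom R (direct_sum {..<n} (\<lambda>_. regular_module R)) M.
        f ` carrier (direct_sum {..<m} (\<lambda>_. regular_module R))
          = module_ker (direct_sum {..<n} (\<lambda>_. regular_module R)) M g \<and>
        g ` carrier (direct_sum {..<n} (\<lambda>_. regular_module R)) = carrier M)"


section \<open>Homomorphism groups and semibricks\<close>

text \<open>The elements of Hom and End are made extensional, so that equality of functions is
  equality of homomorphisms. The field \<open>mult\<close> of the endomorphism ring follows the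
  left-to-right convention: a product \<open>f g\<close> applies \<open>f\<close> first. Under this convention, \<open>Hom X N\<close>
  and \<open>Ext X Y\<close> are left modules over the endomorphism ring of \<open>X\<close>.\<close>

definition End_ring :: "('a, 'c) ring_scheme \<Rightarrow> ('a, 'b) module \<Rightarrow> ('b \<Rightarrow> 'b) ring"
  where "End_ring R X =
    \<lparr>carrier = module_hom R X X \<inter> extensional (carrier X),
     mult = (\<lambda>f g. compose (carrier X) g f),
     one = (\<lambda>x\<in>carrier X. x),
     zero = (\<lambda>x\<in>carrier X. \<zero>\<^bsub>X\<^esub>),
     add = (\<lambda>f g. \<lambda>x\<in>carrier X. f x \<oplus>\<^bsub>X\<^esub> g x)\<rparr>"

definition Hom ::
  "('a, 'c) ring_scheme \<Rightarrow> ('a, 'b) module \<Rightarrow> ('a, 'd) module \<Rightarrow> ('b \<Rightarrow> 'b, 'b \<Rightarrow> 'd) module"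
  where "Hom R X N =
    mk_module (module_hom R X N \<inter> extensional (carrier X))
      (\<lambda>x\<in>carrier X. \<zero>\<^bsub>N\<^esub>)
      (\<lambda>f g. \<lambda>x\<in>carrier X. f x \<oplus>\<^bsub>N\<^esub> g x)
      (\<lambda>h f. compose (carrier X) f h)"

definition division_ring :: "('a, 'c) ring_scheme \<Rightarrow> bool"
  where "division_ring D \<longleftrightarrow> ring D \<and> Units D = carrier D - {\<zero>\<^bsub>D\<^esub>}"

definition brick :: "('a, 'c) ring_scheme \<Rightarrow> ('a, 'b) module \<Rightarrow> bool"
  where "brick R X \<longleftrightarrow>
    left_module R X \<and> finitely_presented R X \<and> division_ring (End_ring R X)"

definition semibrick :: "('a, 'c) ring_scheme \<Rightarrow> ('a, 'b) module set \<Rightarrow> bool"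
  where "semibrick R \<X> \<longleftrightarrow>
    (\<forall>X\<in>\<X>. brick R X) \<and>
    (\<forall>X\<in>\<X>. \<forall>X'\<in>\<X>. X \<noteq> X' \<longrightarrow>
       module_iso R X X' = {} \<and> carrier (Hom R X X') = {\<zero>\<^bsub>Hom R X X'\<^esub>})"


section \<open>Short exact sequences\<close>

text \<open>A triple \<open>(\<alpha>, M, \<beta>)\<close> stands for a sequence \<open>0 \<rightarrow> Y \<rightarrow> M \<rightarrow> X \<rightarrow> 0\<close>; its end terms are
  passed separately.\<close>

type_synonym ('a, 'y, 'm, 'x) seq = "('y \<Rightarrow> 'm) \<times> ('a, 'm) module \<times> ('m \<Rightarrow> 'x)"

definition short_exact ::
  "('a, 'c) ring_scheme \<Rightarrow> ('a, 'y) module \<Rightarrow> ('a, 'y, 'm, 'x) seq \<Rightarrow> ('a, 'x) module \<Rightarrow> bool"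
  where "short_exact R Y E X \<longleftrightarrow> (case E of (\<alpha>, M, \<beta>) \<Rightarrow>
    left_module R Y \<and> left_module R M \<and> left_module R X \<and>
    \<alpha> \<in> module_hom R Y M \<and> \<beta> \<in> module_hom R M X \<and>
    inj_on \<alpha> (carrier Y) \<and>
    \<alpha> ` carrier Y = module_ker M X \<beta> \<and>
    \<beta> ` carrier M = carrier X)"

definition seq_equiv ::
  "('a, 'c) ring_scheme \<Rightarrow> ('a, 'y) module \<Rightarrow> ('a, 'y, 'm, 'x) seq \<Rightarrow> ('a, 'y, 'n, 'x) seq \<Rightarrow> bool"
  where "seq_equiv R Y E E' \<longleftrightarrow> (case E of (\<alpha>, M, \<beta>) \<Rightarrow> case E' of (\<alpha>', M', \<beta>') \<Rightarrow>
    \<exists>\<phi>\<in>module_iso R M M'.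
      (\<forall>y\<in>carrier Y. \<phi> (\<alpha> y) = \<alpha>' y) \<and> (\<forall>m\<in>carrier M. \<beta>' (\<phi> m) = \<beta> m))"

text \<open>Pull-back of a sequence ending in some module along \<open>f\<close> from \<open>X'\<close> to that module.\<close>

definition pullback_seq ::
  "('a, 'y, 'm, 'x) seq \<Rightarrow> ('a, 'w) module \<Rightarrow> ('w \<Rightarrow> 'x) \<Rightarrow> ('a, 'y, 'm \<times> 'w, 'w) seq"
  where "pullback_seq E X' f = (case E of (\<alpha>, M, \<beta>) \<Rightarrow>
    (\<lambda>y. (\<alpha> y, \<zero>\<^bsub>X'\<^esub>),
     submodule_of (prod_module M X') {(m, x). m \<in> carrier M \<and> x \<in> carrier X' \<and> \<beta> m = f x},
     snd))"

text \<open>Push-out of a sequence starting in \<open>A\<close> along \<open>s\<close> from \<open>A\<close> to \<open>Y\<close>. On each coset in the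
  middle term the map to the right-hand end is constant, so \<open>the_elem\<close> yields its value.\<close>

definition pushout_seq ::
  "('a, 'z) module \<Rightarrow> ('z \<Rightarrow> 'y) \<Rightarrow> ('a, 'y) module \<Rightarrow> ('a, 'z, 'm, 'x) seq
    \<Rightarrow> ('a, 'y, ('y \<times> 'm) set, 'x) seq"
  where "pushout_seq A s Y E = (case E of (\<alpha>, M, \<beta>) \<Rightarrow>
    let P = prod_module Y M;
        S = (\<lambda>a. (s a, \<ominus>\<^bsub>M\<^esub> \<alpha> a)) ` carrier A
    in (\<lambda>y. S +>\<^bsub>P\<^esub> (y, \<zero>\<^bsub>M\<^esub>), quotient_module P S, \<lambda>C. the_elem ((\<lambda>(y, m). \<beta> m) ` C)))"

definition prod_seq ::
  "('a, 'y, 'm, 'x) seq \<Rightarrow> ('a, 'z, 'n, 'w) seq \<Rightarrow> ('a, 'y \<times> 'z, 'm \<times> 'n, 'x \<times> 'w) seq"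
  where "prod_seq E E' = (case E of (\<alpha>, M, \<beta>) \<Rightarrow> case E' of (\<alpha>', M', \<beta>') \<Rightarrow>
    (map_prod \<alpha> \<alpha>', prod_module M M', map_prod \<beta> \<beta>'))"

definition direct_sum_seq ::
  "'k set \<Rightarrow> ('k \<Rightarrow> ('a, 'y, 'm, 'x) seq) \<Rightarrow> ('a, 'k \<Rightarrow> 'y, 'k \<Rightarrow> 'm, 'k \<Rightarrow> 'x) seq"
  where "direct_sum_seq K E =
    (\<lambda>f. \<lambda>k\<in>K. fst (E k) (f k),
     direct_sum K (\<lambda>k. fst (snd (E k))),
     \<lambda>g. \<lambda>k\<in>K. snd (snd (E k)) (g k))"


section \<open>The first extension group\<close>

text \<open>The middle term of an extension of \<open>X\<close> by \<open>Y\<close> is in bijection with \<open>Y \<times> X\<close>. Hence every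
  extension, whatever the type of its middle term, is equivalent to one whose middle term lives
  on the type \<open>'y \<times> 'x\<close>, and its class can be taken among these.\<close>

type_synonym ('a, 'y, 'x) ext_seq = "('a, 'y, 'y \<times> 'x, 'x) seq"

definition ext_class ::
  "('a, 'c) ring_scheme \<Rightarrow> ('a, 'x) module \<Rightarrow> ('a, 'y) module \<Rightarrow> ('a, 'y, 'm, 'x) seq
    \<Rightarrow> ('a, 'y, 'x) ext_seq set"
  where "ext_class R X Y E = {E'. short_exact R Y E' X \<and> seq_equiv R Y E E'}"

definition baer_sum ::
  "('a, 'x) module \<Rightarrow> ('a, 'y) module \<Rightarrow> ('a, 'y, 'm, 'x) seq \<Rightarrow> ('a, 'y, 'n, 'x) seq
    \<Rightarrow> ('a, 'y, ('y \<times> ('m \<times> 'n) \<times> 'x) set, 'x) seq"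
  where "baer_sum X Y E E' =
    pushout_seq (prod_module Y Y) (\<lambda>(y, y'). y \<oplus>\<^bsub>Y\<^esub> y') Y
      (pullback_seq (prod_seq E E') X (\<lambda>x. (x, x)))"

text \<open>Operations on classes are unions over representatives; all members of such a union agree.
  An endomorphism acts by pull-back.\<close>

definition Ext ::
  "('a, 'c) ring_scheme \<Rightarrow> ('a, 'x) module \<Rightarrow> ('a, 'y) module
    \<Rightarrow> ('x \<Rightarrow> 'x, ('a, 'y, 'x) ext_seq set) module"
  where "Ext R X Y =
    mk_module {ext_class R X Y E | E :: ('a, 'y, 'x) ext_seq. short_exact R Y E X}
      (ext_class R X Y (\<lambda>y. (y, \<zero>\<^bsub>X\<^esub>), prod_module Y X, snd))
      (\<lambda>C D. \<Union>E\<in>C. \<Union>E'\<in>D. ext_class R X Y (baer_sum X Y E E'))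
      (\<lambda>f C. \<Union>E\<in>C. ext_class R X Y (pullback_seq E X f))"

definition connecting_hom ::
  "('a, 'c) ring_scheme \<Rightarrow> ('a, 'y) module \<Rightarrow> ('a, 'y, 'm, 'n) seq \<Rightarrow> ('a, 'x) module
    \<Rightarrow> ('x \<Rightarrow> 'n) \<Rightarrow> ('a, 'y, 'x) ext_seq set"
  where "connecting_hom R Y E X = (\<lambda>f. ext_class R X Y (pullback_seq E X f))"


section \<open>Universal sequences\<close>

definition is_basis ::
  "('d, 'c) ring_scheme \<Rightarrow> ('d, 'v) module \<Rightarrow> 'i set \<Rightarrow> ('i \<Rightarrow> 'v) \<Rightarrow> bool"
  where "is_basis D V I c \<longleftrightarrow>
    c \<in> I \<rightarrow> carrier V \<and>
    (\<forall>F a. finite F \<and> F \<subseteq> I \<and> a \<in> F \<rightarrow> carrier D \<and>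
       (\<Oplus>\<^bsub>V\<^esub>i\<in>F. a i \<odot>\<^bsub>V\<^esub> c i) = \<zero>\<^bsub>V\<^esub> \<longrightarrow> (\<forall>i\<in>F. a i = \<zero>\<^bsub>D\<^esub>)) \<and>
    (\<forall>v\<in>carrier V. \<exists>F a. finite F \<and> F \<subseteq> I \<and> a \<in> F \<rightarrow> carrier D \<and>
       v = (\<Oplus>\<^bsub>V\<^esub>i\<in>F. a i \<odot>\<^bsub>V\<^esub> c i))"

definition summation_map :: "'k set \<Rightarrow> ('a, 'y) module \<Rightarrow> ('k \<Rightarrow> 'y) \<Rightarrow> 'y"
  where "summation_map K Y f = (\<Oplus>\<^bsub>Y\<^esub>k\<in>{k \<in> K. f k \<noteq> \<zero>\<^bsub>Y\<^esub>}. f k)"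

text \<open>The iterated direct sum of \<open>I X\<close> copies of \<open>X\<close> for each \<open>X \<in> \<X>\<close> is flattened: it has
  one summand \<open>X\<close> for each pair \<open>(X, i)\<close> with \<open>i \<in> I X\<close>.\<close>

definition copower_sum ::
  "('a, 'x) module set \<Rightarrow> (('a, 'x) module \<Rightarrow> 'i set) \<Rightarrow> ('a, ('a, 'x) module \<times> 'i \<Rightarrow> 'x) module"
  where "copower_sum \<X> I = direct_sum (SIGMA X:\<X>. I X) (\<lambda>(X, i). X)"

definition universal_seq_of ::
  "('a, 'x) module set \<Rightarrow> (('a, 'x) module \<Rightarrow> 'i set) \<Rightarrow> ('a, 'y) module
    \<Rightarrow> (('a, 'x) module \<Rightarrow> 'i \<Rightarrow> ('a, 'y, 'm, 'x) seq)
    \<Rightarrow> ('a, 'y, ('y \<times> (('a, 'x) module \<times> 'i \<Rightarrow> 'm)) set, ('a, 'x) module \<times> 'i \<Rightarrow> 'x) seq"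
  where "universal_seq_of \<X> I Y B =
    (let K = (SIGMA X:\<X>. I X) in
      pushout_seq (direct_sum K (\<lambda>_. Y)) (summation_map K Y) Y
        (direct_sum_seq K (\<lambda>(X, i). B X i)))"

definition universal_seq ::
  "('a, 'c) ring_scheme \<Rightarrow> ('a, 'x) module set \<Rightarrow> (('a, 'x) module \<Rightarrow> 'i set) \<Rightarrow> ('a, 'y) module
    \<Rightarrow> ('a, 'y, 'm, ('a, 'x) module \<times> 'i \<Rightarrow> 'x) seq \<Rightarrow> bool"
  where "universal_seq R \<X> I Y E \<longleftrightarrow>
    (\<exists>B :: ('a, 'x) module \<Rightarrow> 'i \<Rightarrow> ('a, 'y, 'x) ext_seq.
      (\<forall>X\<in>\<X>. (\<forall>i\<in>I X. short_exact R Y (B X i) X) \<and>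
              is_basis (End_ring R X) (Ext R X Y) (I X) (\<lambda>i. ext_class R X Y (B X i))) \<and>
      seq_equiv R Y E (universal_seq_of \<X> I Y B))"

end

theory Submission
  imports Defs
begin

text \<open>Write \<open>N\<close> for the right-hand term and \<open>\<iota> X i\<close> for the inclusion of the summand with index
  \<open>(X, i)\<close>. Since every \<open>X \<in> \<X>\<close> is finitely generated and there are no nonzero maps
  from \<open>X\<close> to the other members of \<open>\<X>\<close>, the maps \<open>\<iota> X i\<close> form a basis of \<open>Hom(X, N)\<close> over
  \<open>End(X)\<close>. The connecting homomorphism \<open>\<delta>\<close> is \<open>End(X)\<close>-linear, so it is bijective iff the
  classes \<open>\<delta>(\<iota> X i)\<close> form a basis of \<open>Ext(X, Y)\<close>. Finally, a sequence ending in \<open>N\<close> is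
  determined up to equivalence by its pull-backs along all \<open>\<iota> X i\<close>, and the sequence built from
  chosen extensions has exactly these as its pull-backs; hence the sequence is universal iff
  its own pull-backs, whose classes are \<open>\<delta>(\<iota> X i)\<close>, form bases.\<close>

subsection \<open>Modules, submodules and quotients\<close>

text \<open>A class in \<open>Ext\<close> is a set of sequences, so an identity in
  \<open>Ext\<close> amounts to an isomorphism between middle terms that are iterated subquotients.
  Such isomorphisms are not written down. A morphism with identities at both ends is enough, since
  the five lemma makes it an equivalence, and these morphisms come from the universal properties of
  pull-back (maps into it) and push-out (maps out of it). Thus \<delta>(f) is recognised as the
  class of any sequence that maps to the given one by the identity on \<open>Y\<close> and by
  \<open>f\<close> on the right. A second obstacle is typing: the members of a class have middle
  terms on the product of the types of \<open>Y\<close> and \<open>X\<close>, whereas pull-backs,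
  push-outs and Baer sums change the type. Each class gets a representative of the right type by
  transport of structure along an injection. Finally, a map into an infinite direct sum has finite
  support at each element, but the support may grow with the element. Finitely many generators bound
  it, and this makes the map a finite combination of inclusions.\<close>

lemma mk_module_simps [simp]:
  "carrier (mk_module S z p s) = S"
  "zero (mk_module S z p s) = z"
  "add (mk_module S z p s) = p"
  "smult (mk_module S z p s) = s"
  by (simp_all add: mk_module_def)

lemma left_module_abelian_group: "left_module R M \<Longrightarrow> abelian_group M"
  by (simp add: left_module_def)

lemma left_module_ring: "left_module R M \<Longrightarrow> ring R"
  by (simp add: left_module_def)

lemma left_moduleI:
  assumes "ring R"
    and "\<zero>\<^bsub>M\<^esub> \<in> carrier M"
    and "\<And>x y. \<lbrakk>x \<in> carrier M; y \<in> carrier M\<rbrakk> \<Longrightarrow> x \<oplus>\<^bsub>M\<^esub> y \<in> carrier M"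
    and "\<And>x y z. \<lbrakk>x \<in> carrier M; y \<in> carrier M; z \<in> carrier M\<rbrakk>
      \<Longrightarrow> (x \<oplus>\<^bsub>M\<^esub> y) \<oplus>\<^bsub>M\<^esub> z = x \<oplus>\<^bsub>M\<^esub> (y \<oplus>\<^bsub>M\<^esub> z)"
    and "\<And>x y. \<lbrakk>x \<in> carrier M; y \<in> carrier M\<rbrakk> \<Longrightarrow> x \<oplus>\<^bsub>M\<^esub> y = y \<oplus>\<^bsub>M\<^esub> x"
    and "\<And>x. x \<in> carrier M \<Longrightarrow> \<zero>\<^bsub>M\<^esub> \<oplus>\<^bsub>M\<^esub> x = x"
    and "\<And>x. x \<in> carrier M \<Longrightarrow> \<exists>y\<in>carrier M. y \<oplus>\<^bsub>M\<^esub> x = \<zero>\<^bsub>M\<^esub>"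
    and "\<And>a x. \<lbrakk>a \<in> carrier R; x \<in> carrier M\<rbrakk> \<Longrightarrow> a \<odot>\<^bsub>M\<^esub> x \<in> carrier M"
    and "\<And>a b x. \<lbrakk>a \<in> carrier R; b \<in> carrier R; x \<in> carrier M\<rbrakk>
      \<Longrightarrow> (a \<oplus>\<^bsub>R\<^esub> b) \<odot>\<^bsub>M\<^esub> x = a \<odot>\<^bsub>M\<^esub> x \<oplus>\<^bsub>M\<^esub> b \<odot>\<^bsub>M\<^esub> x"
    and "\<And>a x y. \<lbrakk>a \<in> carrier R; x \<in> carrier M; y \<in> carrier M\<rbrakk>
      \<Longrightarrow> a \<odot>\<^bsub>M\<^esub> (x \<oplus>\<^bsub>M\<^esub> y) = a \<odot>\<^bsub>M\<^esub> x \<oplus>\<^bsub>M\<^esub> a \<odot>\<^bsub>M\<^esub> y"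
    and "\<And>a b x. \<lbrakk>a \<in> carrier R; b \<in> carrier R; x \<in> carrier M\<rbrakk>
      \<Longrightarrow> (a \<otimes>\<^bsub>R\<^esub> b) \<odot>\<^bsub>M\<^esub> x = a \<odot>\<^bsub>M\<^esub> (b \<odot>\<^bsub>M\<^esub> x)"
    and "\<And>x. x \<in> carrier M \<Longrightarrow> \<one>\<^bsub>R\<^esub> \<odot>\<^bsub>M\<^esub> x = x"
  shows "left_module R M"
  using assms by (auto intro!: left_module.intro left_module_axioms.intro abelian_groupI)

lemma left_module_smult_r_zero:
  assumes "left_module R M" "r \<in> carrier R"
  shows "r \<odot>\<^bsub>M\<^esub> \<zero>\<^bsub>M\<^esub> = \<zero>\<^bsub>M\<^esub>"
proof -
  interpret M: abelian_group M using assms(1) by (rule left_module_abelian_group)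
  have "r \<odot>\<^bsub>M\<^esub> \<zero>\<^bsub>M\<^esub> \<oplus>\<^bsub>M\<^esub> r \<odot>\<^bsub>M\<^esub> \<zero>\<^bsub>M\<^esub> = r \<odot>\<^bsub>M\<^esub> \<zero>\<^bsub>M\<^esub>"
    using assms left_module.smult_r_distr[OF assms(1), of r "\<zero>\<^bsub>M\<^esub>" "\<zero>\<^bsub>M\<^esub>"] by simp
  then show ?thesis
    using left_module.smult_closed[OF assms(1,2)] by simp
qed

lemma left_module_smult_l_zero:
  assumes "left_module R M" "x \<in> carrier M"
  shows "\<zero>\<^bsub>R\<^esub> \<odot>\<^bsub>M\<^esub> x = \<zero>\<^bsub>M\<^esub>"
proof -
  interpret M: abelian_group M using assms(1) by (rule left_module_abelian_group)
  interpret R: ring R using assms(1) by (rule left_module_ring)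
  have "\<zero>\<^bsub>R\<^esub> \<odot>\<^bsub>M\<^esub> x \<oplus>\<^bsub>M\<^esub> \<zero>\<^bsub>R\<^esub> \<odot>\<^bsub>M\<^esub> x = \<zero>\<^bsub>R\<^esub> \<odot>\<^bsub>M\<^esub> x"
    using assms left_module.smult_l_distr[OF assms(1), of "\<zero>\<^bsub>R\<^esub>" "\<zero>\<^bsub>R\<^esub>" x] by simp
  then show ?thesis
    using left_module.smult_closed[OF assms(1)] assms(2) by simp
qed

lemma left_module_smult_r_minus:
  assumes "left_module R M" "r \<in> carrier R" "x \<in> carrier M"
  shows "r \<odot>\<^bsub>M\<^esub> (\<ominus>\<^bsub>M\<^esub> x) = \<ominus>\<^bsub>M\<^esub> (r \<odot>\<^bsub>M\<^esub> x)"
proof -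
  interpret M: abelian_group M using assms(1) by (rule left_module_abelian_group)
  have "r \<odot>\<^bsub>M\<^esub> (\<ominus>\<^bsub>M\<^esub> x) \<oplus>\<^bsub>M\<^esub> r \<odot>\<^bsub>M\<^esub> x = \<zero>\<^bsub>M\<^esub>"
    using assms left_module.smult_r_distr[OF assms(1), of r "\<ominus>\<^bsub>M\<^esub> x" x]
      left_module_smult_r_zero[OF assms(1,2)] by (simp add: M.l_neg)
  then show ?thesis
    using left_module.smult_closed[OF assms(1,2)] assms(3) by (simp add: M.minus_equality)
qed

lemma left_module_smult_minus_one:
  assumes "left_module R M" "x \<in> carrier M"
  shows "(\<ominus>\<^bsub>R\<^esub> \<one>\<^bsub>R\<^esub>) \<odot>\<^bsub>M\<^esub> x = \<ominus>\<^bsub>M\<^esub> x"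
proof -
  interpret M: abelian_group M using assms(1) by (rule left_module_abelian_group)
  interpret R: ring R using assms(1) by (rule left_module_ring)
  have "(\<ominus>\<^bsub>R\<^esub> \<one>\<^bsub>R\<^esub>) \<odot>\<^bsub>M\<^esub> x \<oplus>\<^bsub>M\<^esub> x = \<zero>\<^bsub>M\<^esub>"
    using assms left_module.smult_l_distr[OF assms(1), of "\<ominus>\<^bsub>R\<^esub> \<one>\<^bsub>R\<^esub>" "\<one>\<^bsub>R\<^esub>" x]
      left_module_smult_l_zero[OF assms] left_module.smult_one[OF assms]
    by (simp add: R.l_neg)
  then show ?thesis
    using left_module.smult_closed[OF assms(1)] assms(2) by (simp add: M.minus_equality)
qed

lemma module_homI:
  assumes "\<And>x. x \<in> carrier M \<Longrightarrow> f x \<in> carrier N"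
    and "\<And>x y. \<lbrakk>x \<in> carrier M; y \<in> carrier M\<rbrakk> \<Longrightarrow> f (x \<oplus>\<^bsub>M\<^esub> y) = f x \<oplus>\<^bsub>N\<^esub> f y"
    and "\<And>r x. \<lbrakk>r \<in> carrier R; x \<in> carrier M\<rbrakk> \<Longrightarrow> f (r \<odot>\<^bsub>M\<^esub> x) = r \<odot>\<^bsub>N\<^esub> f x"
  shows "f \<in> module_hom R M N"
  using assms by (simp add: module_hom_def)

lemma module_hom_closed: "\<lbrakk>f \<in> module_hom R M N; x \<in> carrier M\<rbrakk> \<Longrightarrow> f x \<in> carrier N"
  by (auto simp: module_hom_def)

lemma module_hom_add:
  "\<lbrakk>f \<in> module_hom R M N; x \<in> carrier M; y \<in> carrier M\<rbrakk> \<Longrightarrow> f (x \<oplus>\<^bsub>M\<^esub> y) = f x \<oplus>\<^bsub>N\<^esub> f y"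
  by (auto simp: module_hom_def)

lemma module_hom_smult:
  "\<lbrakk>f \<in> module_hom R M N; r \<in> carrier R; x \<in> carrier M\<rbrakk> \<Longrightarrow> f (r \<odot>\<^bsub>M\<^esub> x) = r \<odot>\<^bsub>N\<^esub> f x"
  by (auto simp: module_hom_def)

lemma module_hom_compose:
  "\<lbrakk>f \<in> module_hom R M N; g \<in> module_hom R N P\<rbrakk> \<Longrightarrow> (\<lambda>x. g (f x)) \<in> module_hom R M P"
  by (auto simp: module_hom_def Pi_iff)

lemma module_hom_ident: "(\<lambda>x. x) \<in> module_hom R M M"
  by (auto simp: module_hom_def)

text \<open>Homomorphisms are plain functions constrained only on the carrier, which is closed under
  the operations, so values off it may be changed. This is how a homomorphism is replaced by its
  extensional restriction, as membership in \<open>Hom\<close> and \<open>End_ring\<close>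
  requires.\<close>

lemma module_hom_cong:
  assumes "f \<in> module_hom R M N" "left_module R M" "\<And>x. x \<in> carrier M \<Longrightarrow> g x = f x"
  shows "g \<in> module_hom R M N"
proof -
  interpret M: abelian_group M using assms(2) by (rule left_module_abelian_group)
  show ?thesis
    using assms left_module.smult_closed[OF assms(2)] by (auto simp: module_hom_def Pi_iff)
qed

lemma module_hom_zero:
  assumes "f \<in> module_hom R M N" "left_module R M" "left_module R N"
  shows "f \<zero>\<^bsub>M\<^esub> = \<zero>\<^bsub>N\<^esub>"
proof -
  interpret M: abelian_group M using assms(2) by (rule left_module_abelian_group)
  interpret N: abelian_group N using assms(3) by (rule left_module_abelian_group)
  have "f \<zero>\<^bsub>M\<^esub> \<oplus>\<^bsub>N\<^esub> f \<zero>\<^bsub>M\<^esub> = f \<zero>\<^bsub>M\<^esub>"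
    using module_hom_add[OF assms(1), of "\<zero>\<^bsub>M\<^esub>" "\<zero>\<^bsub>M\<^esub>"] by simp
  then show ?thesis
    using module_hom_closed[OF assms(1)] by simp
qed

lemma module_hom_minus:
  assumes "f \<in> module_hom R M N" "left_module R M" "left_module R N" "x \<in> carrier M"
  shows "f (\<ominus>\<^bsub>M\<^esub> x) = \<ominus>\<^bsub>N\<^esub> f x"
proof -
  interpret M: abelian_group M using assms(2) by (rule left_module_abelian_group)
  interpret N: abelian_group N using assms(3) by (rule left_module_abelian_group)
  have "f (\<ominus>\<^bsub>M\<^esub> x) \<oplus>\<^bsub>N\<^esub> f x = \<zero>\<^bsub>N\<^esub>"
    using module_hom_add[OF assms(1), of "\<ominus>\<^bsub>M\<^esub> x" x] module_hom_zero[OF assms(1-3)] assms(4)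
    by (simp add: M.l_neg)
  then show ?thesis
    using module_hom_closed[OF assms(1)] assms(4) by (simp add: N.minus_equality)
qed

lemma module_hom_diff:
  assumes "f \<in> module_hom R M N" "left_module R M" "left_module R N" "x \<in> carrier M" "y \<in> carrier M"
  shows "f (x \<ominus>\<^bsub>M\<^esub> y) = f x \<ominus>\<^bsub>N\<^esub> f y"
proof -
  interpret M: abelian_group M using assms(2) by (rule left_module_abelian_group)
  show ?thesis
    using assms by (simp add: a_minus_def module_hom_add[OF assms(1)] module_hom_minus)
qed

text \<open>Most maps out of products below are sums of two maps that each depend on one coordinate;
  this lemma yields their linearity.\<close>

lemma module_hom_pointwise_add:
  assumes "f \<in> module_hom R M N" "g \<in> module_hom R M N" "left_module R N"
  shows "(\<lambda>x. f x \<oplus>\<^bsub>N\<^esub> g x) \<in> module_hom R M N"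
proof -
  interpret N: left_module R N by fact
  interpret N: abelian_group N using assms(3) by (rule left_module_abelian_group)
  show ?thesis
  proof (rule module_homI)
    fix x y assume "x \<in> carrier M" "y \<in> carrier M"
    moreover have "a \<oplus>\<^bsub>N\<^esub> b \<oplus>\<^bsub>N\<^esub> (c \<oplus>\<^bsub>N\<^esub> d) = a \<oplus>\<^bsub>N\<^esub> c \<oplus>\<^bsub>N\<^esub> (b \<oplus>\<^bsub>N\<^esub> d)"
      if "a \<in> carrier N" "b \<in> carrier N" "c \<in> carrier N" "d \<in> carrier N" for a b c d
      using that by (simp add: N.M.a_ac)
    ultimately show "f (x \<oplus>\<^bsub>M\<^esub> y) \<oplus>\<^bsub>N\<^esub> g (x \<oplus>\<^bsub>M\<^esub> y)
        = f x \<oplus>\<^bsub>N\<^esub> g x \<oplus>\<^bsub>N\<^esub> (f y \<oplus>\<^bsub>N\<^esub> g y)"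
      using assms(1,2) by (simp add: module_hom_add module_hom_closed)
  next
    fix r x assume "r \<in> carrier R" "x \<in> carrier M"
    then show "f (r \<odot>\<^bsub>M\<^esub> x) \<oplus>\<^bsub>N\<^esub> g (r \<odot>\<^bsub>M\<^esub> x) = r \<odot>\<^bsub>N\<^esub> (f x \<oplus>\<^bsub>N\<^esub> g x)"
      using assms(1,2) by (simp add: module_hom_smult module_hom_closed N.smult_r_distr)
  qed (use assms(1,2) in \<open>auto simp: module_hom_closed\<close>)
qed

lemma module_hom_const_zero:
  assumes "left_module R N"
  shows "(\<lambda>x. \<zero>\<^bsub>N\<^esub>) \<in> module_hom R M N"
proof -
  interpret N: abelian_group N using assms by (rule left_module_abelian_group)
  show ?thesis
    using assms by (auto intro!: module_homI simp: left_module_smult_r_zero)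
qed

lemma prod_module_simps [simp]:
  "carrier (prod_module M N) = carrier M \<times> carrier N"
  "\<zero>\<^bsub>prod_module M N\<^esub> = (\<zero>\<^bsub>M\<^esub>, \<zero>\<^bsub>N\<^esub>)"
  "(m, n) \<oplus>\<^bsub>prod_module M N\<^esub> (m', n') = (m \<oplus>\<^bsub>M\<^esub> m', n \<oplus>\<^bsub>N\<^esub> n')"
  "r \<odot>\<^bsub>prod_module M N\<^esub> (m, n) = (r \<odot>\<^bsub>M\<^esub> m, r \<odot>\<^bsub>N\<^esub> n)"
  by (simp_all add: prod_module_def)

lemma left_module_prod:
  assumes "left_module R M" "left_module R N"
  shows "left_module R (prod_module M N)"
proof -
  interpret M: left_module R M by fact
  interpret N: left_module R N by fact
  show ?thesis
  proof (rule left_moduleI)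
    fix x assume "x \<in> carrier (prod_module M N)"
    then show "\<exists>y\<in>carrier (prod_module M N). y \<oplus>\<^bsub>prod_module M N\<^esub> x = \<zero>\<^bsub>prod_module M N\<^esub>"
      by (intro bexI[of _ "(\<ominus>\<^bsub>M\<^esub> fst x, \<ominus>\<^bsub>N\<^esub> snd x)"]) (auto simp: M.M.l_neg N.M.l_neg)
  qed (auto simp: M.R.ring_axioms M.M.a_ac N.M.a_ac
      M.smult_l_distr N.smult_l_distr M.smult_r_distr N.smult_r_distr M.smult_assoc N.smult_assoc)
qed

lemma prod_module_minus:
  assumes "left_module R M" "left_module R N" "m \<in> carrier M" "n \<in> carrier N"
  shows "\<ominus>\<^bsub>prod_module M N\<^esub> (m, n) = (\<ominus>\<^bsub>M\<^esub> m, \<ominus>\<^bsub>N\<^esub> n)"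
proof -
  interpret M: left_module R M by fact
  interpret N: left_module R N by fact
  have "abelian_group (prod_module M N)"
    using left_module_prod[OF assms(1,2)] by (rule left_module_abelian_group)
  then show ?thesis
    by (rule abelian_group.minus_equality) (simp_all add: assms M.M.l_neg N.M.l_neg)
qed

section \<open>Submodules and quotient modules\<close>

lemma submodule_of_simps [simp]:
  "carrier (submodule_of M S) = S"
  "\<zero>\<^bsub>submodule_of M S\<^esub> = \<zero>\<^bsub>M\<^esub>"
  "x \<oplus>\<^bsub>submodule_of M S\<^esub> y = x \<oplus>\<^bsub>M\<^esub> y"
  "r \<odot>\<^bsub>submodule_of M S\<^esub> x = r \<odot>\<^bsub>M\<^esub> x"
  by (simp_all add: submodule_of_def)

definition is_submodule :: "('a, 'c) ring_scheme \<Rightarrow> ('a, 'b) module \<Rightarrow> 'b set \<Rightarrow> bool"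
  where "is_submodule R M S \<longleftrightarrow> S \<subseteq> carrier M \<and> \<zero>\<^bsub>M\<^esub> \<in> S \<and>
    (\<forall>x\<in>S. \<forall>y\<in>S. x \<oplus>\<^bsub>M\<^esub> y \<in> S) \<and> (\<forall>r\<in>carrier R. \<forall>x\<in>S. r \<odot>\<^bsub>M\<^esub> x \<in> S)"

text \<open>Negation is the action of the scalar -1, so closure under scalars covers it.\<close>

lemma is_submodule_minus:
  assumes "left_module R M" "is_submodule R M S" "x \<in> S"
  shows "\<ominus>\<^bsub>M\<^esub> x \<in> S"
proof -
  interpret M: left_module R M by fact
  have "(\<ominus>\<^bsub>R\<^esub> \<one>\<^bsub>R\<^esub>) \<odot>\<^bsub>M\<^esub> x \<in> S"
    using assms(2,3) by (simp add: is_submodule_def)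
  then show ?thesis
    using assms(2,3) by (subst (asm) left_module_smult_minus_one[OF assms(1)])
      (auto simp: is_submodule_def)
qed

lemma left_module_submodule_of:
  assumes "left_module R M" "is_submodule R M S"
  shows "left_module R (submodule_of M S)"
proof -
  interpret M: left_module R M by fact
  have S: "x \<in> carrier M" if "x \<in> S" for x
    using assms(2) that by (auto simp: is_submodule_def)
  show ?thesis
  proof (rule left_moduleI)
    fix x assume "x \<in> carrier (submodule_of M S)"
    then show "\<exists>y\<in>carrier (submodule_of M S). y \<oplus>\<^bsub>submodule_of M S\<^esub> x = \<zero>\<^bsub>submodule_of M S\<^esub>"
      using is_submodule_minus[OF assms] S
      by (intro bexI[of _ "\<ominus>\<^bsub>M\<^esub> x"]) (auto simp: M.M.l_neg)
  qed (use assms(2) in \<open>auto simp: is_submodule_def S M.R.ring_axioms M.M.a_ac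
      M.smult_l_distr M.smult_r_distr M.smult_assoc\<close>)
qed

lemma is_submodule_image:
  assumes "left_module R A" "left_module R M" "f \<in> module_hom R A M"
  shows "is_submodule R M (f ` carrier A)"
proof -
  interpret A: left_module R A by fact
  show ?thesis
    unfolding is_submodule_def
    using module_hom_closed[OF assms(3)] module_hom_zero[OF assms(3,1,2)]
    by (auto simp: module_hom_add[OF assms(3), symmetric] module_hom_smult[OF assms(3), symmetric]
        intro!: rev_image_eqI[of "\<zero>\<^bsub>A\<^esub>"])
qed

text \<open>Gives access to the coset calculus of abelian groups, on which the quotient
  rests.\<close>

lemma is_submodule_abelian_subgroup:
  assumes "left_module R M" "is_submodule R M S"
  shows "abelian_subgroup S M"
proof (rule abelian_subgroupI3)
  interpret M: left_module R M by fact
  show "abelian_group M" using assms(1) by (rule left_module_abelian_group)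
  show "additive_subgroup S M"
  proof (rule additive_subgroupI, rule M.M.add.subgroupI)
    fix a assume "a \<in> S"
    then show "\<ominus>\<^bsub>M\<^esub> a \<in> S"
      by (rule is_submodule_minus[OF assms])
  qed (use assms(2) in \<open>auto simp: is_submodule_def\<close>)
qed

lemma quotient_module_coset_eq_iff:
  assumes "left_module R M" "is_submodule R M S" "x \<in> carrier M" "y \<in> carrier M"
  shows "S +>\<^bsub>M\<^esub> x = S +>\<^bsub>M\<^esub> y \<longleftrightarrow> x \<ominus>\<^bsub>M\<^esub> y \<in> S"
proof -
  interpret S: abelian_subgroup S M by (rule is_submodule_abelian_subgroup) fact+
  show ?thesis
  proof
    assume "S +>\<^bsub>M\<^esub> x = S +>\<^bsub>M\<^esub> y"
    then show "x \<ominus>\<^bsub>M\<^esub> y \<in> S"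
      using assms(3,4) S.a_coset_add_inv2[of S x y] S.a_coset_join1[of S "x \<ominus>\<^bsub>M\<^esub> y"]
      by (simp add: a_minus_def S.a_subset S.a_subgroup)
  next
    assume "x \<ominus>\<^bsub>M\<^esub> y \<in> S"
    then show "S +>\<^bsub>M\<^esub> x = S +>\<^bsub>M\<^esub> y"
      using assms(3,4) S.a_coset_add_inv1[of S x y] S.a_coset_join2[of "x \<ominus>\<^bsub>M\<^esub> y" S]
      by (simp add: a_minus_def S.a_subset S.a_subgroup)
  qed
qed

lemma quotient_module_carrier:
  "carrier (quotient_module M S) = {S +>\<^bsub>M\<^esub> x | x. x \<in> carrier M}"
  by (auto simp: quotient_module_def A_RCOSETS_def RCOSETS_def a_r_coset_def)

lemma quotient_module_zero:
  assumes "left_module R M" "is_submodule R M S"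
  shows "\<zero>\<^bsub>quotient_module M S\<^esub> = S +>\<^bsub>M\<^esub> \<zero>\<^bsub>M\<^esub>"
proof -
  interpret S: abelian_subgroup S M by (rule is_submodule_abelian_subgroup) fact+
  show ?thesis by (simp add: quotient_module_def S.a_subset)
qed

lemma quotient_module_add:
  assumes "left_module R M" "is_submodule R M S" "x \<in> carrier M" "y \<in> carrier M"
  shows "(S +>\<^bsub>M\<^esub> x) \<oplus>\<^bsub>quotient_module M S\<^esub> (S +>\<^bsub>M\<^esub> y) = S +>\<^bsub>M\<^esub> (x \<oplus>\<^bsub>M\<^esub> y)"
proof -
  interpret S: abelian_subgroup S M by (rule is_submodule_abelian_subgroup) fact+
  show ?thesis by (simp add: quotient_module_def S.a_rcos_sum assms)
qed

lemma mem_coset_iff: "c \<in> S +>\<^bsub>M\<^esub> x \<longleftrightarrow> (\<exists>s\<in>S. c = s \<oplus>\<^bsub>M\<^esub> x)"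
  by (auto simp: a_r_coset_def r_coset_def)

text \<open>The scalar action is a union over all members \<open>c\<close> of the coset. Since
  \<open>r c - r x\<close> is a scalar multiple of an element of \<open>S\<close>, all members of
  the union are one and the same coset, and the union is not empty because \<open>x\<close> lies in
  its own coset.\<close>

lemma quotient_module_smult:
  assumes "left_module R M" "is_submodule R M S" "r \<in> carrier R" "x \<in> carrier M"
  shows "r \<odot>\<^bsub>quotient_module M S\<^esub> (S +>\<^bsub>M\<^esub> x) = S +>\<^bsub>M\<^esub> (r \<odot>\<^bsub>M\<^esub> x)"
proof -
  interpret M: left_module R M by fact
  interpret S: abelian_subgroup S M by (rule is_submodule_abelian_subgroup) fact+
  have "S +>\<^bsub>M\<^esub> (r \<odot>\<^bsub>M\<^esub> c) = S +>\<^bsub>M\<^esub> (r \<odot>\<^bsub>M\<^esub> x)" if c: "c \<in> S +>\<^bsub>M\<^esub> x" for c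
  proof -
    obtain s where s: "s \<in> S" "c = s \<oplus>\<^bsub>M\<^esub> x"
      using c by (auto simp: mem_coset_iff)
    have sM: "s \<in> carrier M" using s(1) S.a_subset by auto
    have "r \<odot>\<^bsub>M\<^esub> s \<in> S" using s(1) assms(2,3) by (auto simp: is_submodule_def)
    moreover have "r \<odot>\<^bsub>M\<^esub> c \<ominus>\<^bsub>M\<^esub> r \<odot>\<^bsub>M\<^esub> x = r \<odot>\<^bsub>M\<^esub> s"
      using sM assms(3,4) s(2)
      by (simp add: M.smult_r_distr a_minus_def M.M.a_assoc M.M.r_neg)
    ultimately show ?thesis
      using quotient_module_coset_eq_iff[OF assms(1,2), of "r \<odot>\<^bsub>M\<^esub> c" "r \<odot>\<^bsub>M\<^esub> x"] sM s(2) assms(3,4)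
      by simp
  qed
  moreover have "S +>\<^bsub>M\<^esub> x \<noteq> {}" using S.a_rcos_self[OF assms(4)] by blast
  ultimately have "(\<Union>c\<in>S +>\<^bsub>M\<^esub> x. S +>\<^bsub>M\<^esub> (r \<odot>\<^bsub>M\<^esub> c)) = S +>\<^bsub>M\<^esub> (r \<odot>\<^bsub>M\<^esub> x)"
    by (intro SUP_eq_const)
  then show ?thesis
    by (simp add: quotient_module_def)
qed

lemma left_module_quotient:
  assumes "left_module R M" "is_submodule R M S"
  shows "left_module R (quotient_module M S)"
proof -
  interpret M: left_module R M by fact
  note simps = quotient_module_carrier quotient_module_zero[OF assms]
    quotient_module_add[OF assms] quotient_module_smult[OF assms]
  show ?thesis
  proof (rule left_moduleI)
    fix x assume "x \<in> carrier (quotient_module M S)"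
    then obtain m where m: "m \<in> carrier M" "x = S +>\<^bsub>M\<^esub> m" by (auto simp: simps)
    then show "\<exists>y\<in>carrier (quotient_module M S).
        y \<oplus>\<^bsub>quotient_module M S\<^esub> x = \<zero>\<^bsub>quotient_module M S\<^esub>"
      by (intro bexI[of _ "S +>\<^bsub>M\<^esub> (\<ominus>\<^bsub>M\<^esub> m)"]) (auto simp: simps M.M.l_neg)
  qed (auto simp: simps M.R.ring_axioms M.M.a_ac M.smult_l_distr M.smult_r_distr M.smult_assoc)
qed

text \<open>A map that kills \<open>S\<close> is constant on each coset, so its image of a coset is
  a singleton and \<open>the_elem\<close> returns the induced value. Both maps out of a push-out
  used below are obtained in this way.\<close>

lemma quotient_module_desc:
  assumes "left_module R M" "is_submodule R M S" "left_module R Z" "\<phi> \<in> module_hom R M Z"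
    and "\<And>s. s \<in> S \<Longrightarrow> \<phi> s = \<zero>\<^bsub>Z\<^esub>"
  shows "x \<in> carrier M \<Longrightarrow> the_elem (\<phi> ` (S +>\<^bsub>M\<^esub> x)) = \<phi> x"
    and "(\<lambda>C. the_elem (\<phi> ` C)) \<in> module_hom R (quotient_module M S) Z"
proof -
  interpret M: left_module R M by fact
  interpret Z: left_module R Z by fact
  interpret S: abelian_subgroup S M by (rule is_submodule_abelian_subgroup) fact+
  have SM: "s \<in> carrier M" if "s \<in> S" for s
    using S.a_subset that by auto
  have val: "the_elem (\<phi> ` (S +>\<^bsub>M\<^esub> x)) = \<phi> x" if x: "x \<in> carrier M" for x
  proof -
    have "\<phi> (s \<oplus>\<^bsub>M\<^esub> x) = \<phi> x" if "s \<in> S" for s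
      using that x SM assms(4,5) by (simp add: module_hom_add[OF assms(4)] module_hom_closed[OF assms(4)])
    moreover have "x \<in> S +>\<^bsub>M\<^esub> x" using x by (rule S.a_rcos_self)
    ultimately have "\<phi> ` (S +>\<^bsub>M\<^esub> x) = {\<phi> x}"
      using mem_coset_iff[where S = S and M = M and x = x] by auto
    then show ?thesis by simp
  qed
  then show "x \<in> carrier M \<Longrightarrow> the_elem (\<phi> ` (S +>\<^bsub>M\<^esub> x)) = \<phi> x" .
  show "(\<lambda>C. the_elem (\<phi> ` C)) \<in> module_hom R (quotient_module M S) Z"
    by (rule module_homI)
      (auto simp: quotient_module_carrier quotient_module_add[OF assms(1,2)]
        quotient_module_smult[OF assms(1,2)] val module_hom_closed[OF assms(4)]
        module_hom_add[OF assms(4)] module_hom_smult[OF assms(4)])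
qed

lemma left_module_minus_zero:
  assumes "left_module R M"
  shows "\<ominus>\<^bsub>M\<^esub> \<zero>\<^bsub>M\<^esub> = \<zero>\<^bsub>M\<^esub>"
proof -
  interpret M: left_module R M by fact
  show ?thesis by (rule M.M.minus_equality) simp_all
qed

lemma diff_eq_zero_iff:
  assumes "left_module R M" "x \<in> carrier M" "y \<in> carrier M"
  shows "x \<ominus>\<^bsub>M\<^esub> y = \<zero>\<^bsub>M\<^esub> \<longleftrightarrow> x = y"
proof -
  interpret M: left_module R M by fact
  have "x = x \<ominus>\<^bsub>M\<^esub> y \<oplus>\<^bsub>M\<^esub> y"
    using assms(2,3) by (simp add: a_minus_def M.M.a_assoc M.M.l_neg)
  then show ?thesis
    using assms(2,3) by (auto simp: a_minus_def M.M.r_neg)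
qed

subsection \<open>Short exact sequences and their morphisms\<close>

lemma short_exact_iff:
  "short_exact R Y (\<alpha>, M, \<beta>) X \<longleftrightarrow>
    left_module R Y \<and> left_module R M \<and> left_module R X \<and>
    \<alpha> \<in> module_hom R Y M \<and> \<beta> \<in> module_hom R M X \<and>
    inj_on \<alpha> (carrier Y) \<and> \<alpha> ` carrier Y = module_ker M X \<beta> \<and> \<beta> ` carrier M = carrier X"
  by (simp add: short_exact_def)

lemma short_exactD:
  assumes "short_exact R Y (\<alpha>, M, \<beta>) X"
  shows "left_module R Y" "left_module R M" "left_module R X"
    "\<alpha> \<in> module_hom R Y M" "\<beta> \<in> module_hom R M X" "inj_on \<alpha> (carrier Y)"
    "\<And>y. y \<in> carrier Y \<Longrightarrow> \<beta> (\<alpha> y) = \<zero>\<^bsub>X\<^esub>"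
    "\<And>m. \<lbrakk>m \<in> carrier M; \<beta> m = \<zero>\<^bsub>X\<^esub>\<rbrakk> \<Longrightarrow> \<exists>y\<in>carrier Y. m = \<alpha> y"
    "\<And>x. x \<in> carrier X \<Longrightarrow> \<exists>m\<in>carrier M. \<beta> m = x"
proof -
  have ker: "\<alpha> ` carrier Y = {m \<in> carrier M. \<beta> m = \<zero>\<^bsub>X\<^esub>}" and im: "\<beta> ` carrier M = carrier X"
    using assms by (simp_all add: short_exact_iff module_ker_def)
  show "\<beta> (\<alpha> y) = \<zero>\<^bsub>X\<^esub>" if "y \<in> carrier Y" for y
    using ker that by blast
  show "\<exists>y\<in>carrier Y. m = \<alpha> y" if "m \<in> carrier M" "\<beta> m = \<zero>\<^bsub>X\<^esub>" for m
    using ker that by blast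
  show "\<exists>m\<in>carrier M. \<beta> m = x" if "x \<in> carrier X" for x
    using that unfolding im[symmetric] by blast
qed (use assms in \<open>simp_all add: short_exact_iff\<close>)

text \<open>Injectivity on the left is asked for as a trivial kernel, which is the form that the
  constructions below provide.\<close>

lemma short_exactI:
  assumes "left_module R Y" "left_module R M" "left_module R X"
    "\<alpha> \<in> module_hom R Y M" "\<beta> \<in> module_hom R M X"
    "\<And>y. \<lbrakk>y \<in> carrier Y; \<alpha> y = \<zero>\<^bsub>M\<^esub>\<rbrakk> \<Longrightarrow> y = \<zero>\<^bsub>Y\<^esub>"
    "\<And>y. y \<in> carrier Y \<Longrightarrow> \<beta> (\<alpha> y) = \<zero>\<^bsub>X\<^esub>"
    "\<And>m. \<lbrakk>m \<in> carrier M; \<beta> m = \<zero>\<^bsub>X\<^esub>\<rbrakk> \<Longrightarrow> \<exists>y\<in>carrier Y. m = \<alpha> y"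
    "\<And>x. x \<in> carrier X \<Longrightarrow> \<exists>m\<in>carrier M. \<beta> m = x"
  shows "short_exact R Y (\<alpha>, M, \<beta>) X"
proof -
  interpret Y: left_module R Y by fact
  interpret M: left_module R M by fact
  have "inj_on \<alpha> (carrier Y)"
  proof (rule inj_onI)
    fix y y' assume y: "y \<in> carrier Y" "y' \<in> carrier Y" "\<alpha> y = \<alpha> y'"
    then have "\<alpha> (y \<ominus>\<^bsub>Y\<^esub> y') = \<zero>\<^bsub>M\<^esub>"
      using module_hom_diff[OF assms(4,1,2)] module_hom_closed[OF assms(4)]
      by (simp add: a_minus_def M.M.r_neg)
    then have "y \<ominus>\<^bsub>Y\<^esub> y' = \<zero>\<^bsub>Y\<^esub>"
      using assms(6) y by simp
    then show "y = y'" using y diff_eq_zero_iff[OF assms(1)] by simp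
  qed
  moreover have "\<alpha> ` carrier Y = module_ker M X \<beta>"
    using assms(7,8) module_hom_closed[OF assms(4)] by (auto simp: module_ker_def)
  moreover have "\<beta> ` carrier M = carrier X"
    using assms(9) module_hom_closed[OF assms(5)] by (auto simp: image_iff)
  ultimately show ?thesis
    using assms by (simp add: short_exact_iff)
qed

text \<open>A morphism of short exact sequences with outer components \<open>s\<close> and \<open>f\<close>; \<open>A\<close> is the left
  end of \<open>E\<close>. The middle component is left existential, since equivalence, pull-back and
  push-out can all be characterised without naming it.\<close>

definition seq_map ::
  "('a, 'c) ring_scheme \<Rightarrow> ('a, 'y) module \<Rightarrow> ('a, 'y, 'm, 'x) seq \<Rightarrow> ('a, 'z, 'n, 'w) seq
    \<Rightarrow> ('y \<Rightarrow> 'z) \<Rightarrow> ('x \<Rightarrow> 'w) \<Rightarrow> bool"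
  where "seq_map R A E E' s f \<longleftrightarrow> (case E of (\<alpha>, M, \<beta>) \<Rightarrow> case E' of (\<alpha>', M', \<beta>') \<Rightarrow>
    \<exists>g\<in>module_hom R M M'.
      (\<forall>a\<in>carrier A. g (\<alpha> a) = \<alpha>' (s a)) \<and> (\<forall>m\<in>carrier M. \<beta>' (g m) = f (\<beta> m)))"

lemma seq_mapI:
  assumes "g \<in> module_hom R M M'"
    and "\<And>a. a \<in> carrier A \<Longrightarrow> g (\<alpha> a) = \<alpha>' (s a)"
    and "\<And>m. m \<in> carrier M \<Longrightarrow> \<beta>' (g m) = f (\<beta> m)"
  shows "seq_map R A (\<alpha>, M, \<beta>) (\<alpha>', M', \<beta>') s f"
  using assms by (auto simp: seq_map_def)

lemma seq_mapE:
  assumes "seq_map R A (\<alpha>, M, \<beta>) (\<alpha>', M', \<beta>') s f"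
  obtains g where "g \<in> module_hom R M M'" "\<forall>a\<in>carrier A. g (\<alpha> a) = \<alpha>' (s a)"
  "\<forall>m\<in>carrier M. \<beta>' (g m) = f (\<beta> m)"
  using assms unfolding seq_map_def prod.case by blast

text \<open>Only values on the carriers matter: exactness of \<open>E\<close> keeps the values of
  \<beta> inside the carrier of \<open>X\<close>, where \<open>f\<close> and \<open>f'\<close>
  agree. The lemma rewrites the composite outer maps left by \<open>seq_map_comp\<close>.\<close>

lemma seq_map_cong:
  assumes "short_exact R A E X" "seq_map R A E E' s f"
    and "\<And>a. a \<in> carrier A \<Longrightarrow> s' a = s a" "\<And>x. x \<in> carrier X \<Longrightarrow> f' x = f x"
  shows "seq_map R A E E' s' f'"
proof -
  obtain \<alpha> M \<beta> where E: "E = (\<alpha>, M, \<beta>)" by (cases E)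
  obtain \<alpha>' M' \<beta>' where E': "E' = (\<alpha>', M', \<beta>')" by (cases E')
  show ?thesis
    using assms module_hom_closed[OF short_exactD(5)[OF assms(1)[unfolded E]]]
    by (auto simp: E E' seq_map_def)
qed

lemma seq_map_comp:
  assumes "seq_map R A E E' s f" "seq_map R B E' E'' s' f'"
    and "\<And>a. a \<in> carrier A \<Longrightarrow> s a \<in> carrier B"
  shows "seq_map R A E E'' (\<lambda>a. s' (s a)) (\<lambda>x. f' (f x))"
proof -
  obtain \<alpha> M \<beta> where E: "E = (\<alpha>, M, \<beta>)" by (cases E)
  obtain \<alpha>' M' \<beta>' where E': "E' = (\<alpha>', M', \<beta>')" by (cases E')
  obtain \<alpha>'' M'' \<beta>'' where E'': "E'' = (\<alpha>'', M'', \<beta>'')" by (cases E'')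
  obtain g where g: "g \<in> module_hom R M M'" "\<forall>a\<in>carrier A. g (\<alpha> a) = \<alpha>' (s a)"
    "\<forall>m\<in>carrier M. \<beta>' (g m) = f (\<beta> m)"
    using assms(1) unfolding E E' by (rule seq_mapE)
  note g = g(1) g(2,3)[rule_format]
  obtain h where h: "h \<in> module_hom R M' M''" "\<forall>a\<in>carrier B. h (\<alpha>' a) = \<alpha>'' (s' a)"
    "\<forall>m\<in>carrier M'. \<beta>'' (h m) = f' (\<beta>' m)"
    using assms(2) unfolding E' E'' by (rule seq_mapE)
  note h = h(1) h(2,3)[rule_format]
  show ?thesis unfolding E E''
    by (rule seq_mapI[OF module_hom_compose[OF g(1) h(1)]])
      (simp_all add: g(2,3) h(2,3) assms(3) module_hom_closed[OF g(1)])
qed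

lemma seq_map_ident: "seq_map R A E E (\<lambda>a. a) (\<lambda>x. x)"
  by (cases E) (auto intro: seq_mapI[OF module_hom_ident])

section \<open>The five lemma and equivalence of sequences\<close>

lemma short_five:
  assumes E: "short_exact R Y (\<alpha>, M, \<beta>) X" and E': "short_exact R Y (\<alpha>', M', \<beta>') X"
    and g: "g \<in> module_hom R M M'" "\<And>y. y \<in> carrier Y \<Longrightarrow> g (\<alpha> y) = \<alpha>' y"
      "\<And>m. m \<in> carrier M \<Longrightarrow> \<beta>' (g m) = \<beta> m"
  shows "g \<in> module_iso R M M'"
proof -
  note D = short_exactD[OF E] and D' = short_exactD[OF E']
  interpret Y: left_module R Y by (rule D(1))
  interpret M: left_module R M by (rule D(2))
  interpret M': left_module R M' by (rule D'(2))
  interpret X: left_module R X by (rule D(3))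
  note cl = module_hom_closed[OF g(1)] module_hom_closed[OF D(4)] module_hom_closed[OF D(5)]
    module_hom_closed[OF D'(4)] module_hom_closed[OF D'(5)]
  have "inj_on g (carrier M)"
  proof (rule inj_onI)
    fix m n assume mn: "m \<in> carrier M" "n \<in> carrier M" "g m = g n"
    \<comment> \<open>The difference dies under \<open>g\<close>, hence under \<beta>, so it comes
      from some \<open>y\<close> in \<open>Y\<close>; injectivity of \<alpha>' then forces
      \<open>y\<close> to be zero.\<close>
    have 0: "g (m \<ominus>\<^bsub>M\<^esub> n) = \<zero>\<^bsub>M'\<^esub>"
      using module_hom_diff[OF g(1) D(2) D'(2)] mn cl by (simp add: a_minus_def M'.M.r_neg)
    then have "\<beta> (m \<ominus>\<^bsub>M\<^esub> n) = \<zero>\<^bsub>X\<^esub>"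
      using g(3)[of "m \<ominus>\<^bsub>M\<^esub> n"] mn module_hom_zero[OF D'(5) D'(2) D'(3)] by simp
    then obtain y where y: "y \<in> carrier Y" "m \<ominus>\<^bsub>M\<^esub> n = \<alpha> y"
      using D(8)[of "m \<ominus>\<^bsub>M\<^esub> n"] mn by auto
    have "\<alpha>' y = \<alpha>' \<zero>\<^bsub>Y\<^esub>"
      using g(2)[OF y(1)] y 0 module_hom_zero[OF D'(4) D'(1) D'(2)] by simp
    then have "y = \<zero>\<^bsub>Y\<^esub>"
      using inj_onD[OF D'(6)] y(1) by auto
    then have "m \<ominus>\<^bsub>M\<^esub> n = \<zero>\<^bsub>M\<^esub>"
      using y module_hom_zero[OF D(4) D(1) D(2)] by simp
    then show "m = n" using mn diff_eq_zero_iff[OF D(2)] by simp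
  qed
  moreover have "\<exists>m\<in>carrier M. g m = m'" if m': "m' \<in> carrier M'" for m'
  proof -
    \<comment> \<open>A lift \<open>m\<close> of the right-hand image is correct up to an error
      killed by \<beta>', so the error comes from \<open>Y\<close> and is repaired by adding
      \<alpha> y to \<open>m\<close>.\<close>
    obtain m where m: "m \<in> carrier M" "\<beta> m = \<beta>' m'"
      using D(9)[of "\<beta>' m'"] cl m' by auto
    have "\<beta>' (m' \<ominus>\<^bsub>M'\<^esub> g m) = \<zero>\<^bsub>X\<^esub>"
      using module_hom_diff[OF D'(5) D'(2) D'(3)] m m' g(3) cl by (simp add: a_minus_def X.M.r_neg)
    then obtain y where y: "y \<in> carrier Y" "m' \<ominus>\<^bsub>M'\<^esub> g m = \<alpha>' y"
      using D'(8)[of "m' \<ominus>\<^bsub>M'\<^esub> g m"] m m' cl by auto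
    have "g (\<alpha> y \<oplus>\<^bsub>M\<^esub> m) = m' \<ominus>\<^bsub>M'\<^esub> g m \<oplus>\<^bsub>M'\<^esub> g m"
      using module_hom_add[OF g(1)] g(2) y m cl by simp
    also have "\<dots> = m'"
      using m m' cl by (simp add: a_minus_def M'.M.a_assoc M'.M.l_neg)
    finally show ?thesis
      using y m cl by (intro bexI[of _ "\<alpha> y \<oplus>\<^bsub>M\<^esub> m"]) auto
  qed
  ultimately show ?thesis
    using g(1) cl by (auto simp: module_iso_def bij_betw_def image_iff)
qed

lemma seq_equiv_imp_seq_map: "seq_equiv R Y E E' \<Longrightarrow> seq_map R Y E E' (\<lambda>y. y) (\<lambda>x. x)"
  by (cases E; cases E') (auto simp: seq_equiv_def seq_map_def module_iso_def)

text \<open>From here on it is enough to construct a morphism with identities at both ends; its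
  bijectivity is automatic.\<close>

lemma seq_map_imp_seq_equiv:
  assumes "short_exact R Y E X" "short_exact R Y E' X" "seq_map R Y E E' (\<lambda>y. y) (\<lambda>x. x)"
  shows "seq_equiv R Y E E'"
proof -
  obtain \<alpha> M \<beta> where E: "E = (\<alpha>, M, \<beta>)" by (cases E)
  obtain \<alpha>' M' \<beta>' where E': "E' = (\<alpha>', M', \<beta>')" by (cases E')
  obtain g where g: "g \<in> module_hom R M M'" "\<forall>a\<in>carrier Y. g (\<alpha> a) = \<alpha>' a"
    "\<forall>m\<in>carrier M. \<beta>' (g m) = \<beta> m"
    using assms(3) unfolding E E' by (rule seq_mapE)
  note g = g(1) g(2,3)[rule_format]
  show ?thesis
    using short_five[OF assms(1,2)[unfolded E E'] g] g(2,3) by (auto simp: E E' seq_equiv_def)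
qed

lemma module_iso_inverse:
  assumes "\<phi> \<in> module_iso R M N" "left_module R M"
  shows "inv_into (carrier M) \<phi> \<in> module_hom R N M"
proof -
  interpret M: left_module R M by fact
  have bij: "bij_betw \<phi> (carrier M) (carrier N)" and hom: "\<phi> \<in> module_hom R M N"
    using assms(1) by (auto simp: module_iso_def)
  let ?\<psi> = "inv_into (carrier M) \<phi>"
  have 1: "?\<psi> n \<in> carrier M" "\<phi> (?\<psi> n) = n" if "n \<in> carrier N" for n
    using that bij by (auto simp: bij_betw_def inv_into_into f_inv_into_f)
  have 2: "?\<psi> n = m" if "m \<in> carrier M" "\<phi> m = n" for m n
    using that bij by (auto simp: bij_betw_def)
  show ?thesis
    by (rule module_homI) (auto intro!: 2 simp: 1 module_hom_add[OF hom] module_hom_smult[OF hom])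
qed

lemma seq_equiv_sym:
  assumes "short_exact R Y E X" "seq_equiv R Y E E'"
  shows "seq_equiv R Y E' E"
proof -
  obtain \<alpha> M \<beta> where E: "E = (\<alpha>, M, \<beta>)" by (cases E)
  obtain \<alpha>' M' \<beta>' where E': "E' = (\<alpha>', M', \<beta>')" by (cases E')
  note D = short_exactD[OF assms(1)[unfolded E]]
  obtain \<phi> where \<phi>: "\<phi> \<in> module_iso R M M'" "\<forall>y\<in>carrier Y. \<phi> (\<alpha> y) = \<alpha>' y"
    "\<forall>m\<in>carrier M. \<beta>' (\<phi> m) = \<beta> m"
    using assms(2) unfolding E E' seq_equiv_def prod.case by blast
  note \<phi> = \<phi>(1) \<phi>(2,3)[rule_format]
  let ?\<psi> = "inv_into (carrier M) \<phi>"
  have bij: "bij_betw \<phi> (carrier M) (carrier M')"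
    using \<phi>(1) by (auto simp: module_iso_def)
  have 1: "?\<psi> n \<in> carrier M" "\<phi> (?\<psi> n) = n" if "n \<in> carrier M'" for n
    using that bij by (auto simp: bij_betw_def inv_into_into f_inv_into_f)
  have "?\<psi> \<in> module_iso R M' M"
    using module_iso_inverse[OF \<phi>(1) D(2)] bij_betw_inv_into[OF bij] by (simp add: module_iso_def)
  moreover have "?\<psi> (\<alpha>' y) = \<alpha> y" if "y \<in> carrier Y" for y
    using that \<phi>(2)[OF that, symmetric] bij module_hom_closed[OF D(4)] by (simp add: bij_betw_def)
  moreover have "\<beta> (?\<psi> m) = \<beta>' m" if "m \<in> carrier M'" for m
    using \<phi>(3)[OF 1(1)] 1 that by simp
  ultimately show ?thesis
    by (auto simp: E E' seq_equiv_def)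
qed

lemma seq_equiv_trans:
  assumes "short_exact R Y E X" "short_exact R Y E'' X" "seq_equiv R Y E E'" "seq_equiv R Y E' E''"
  shows "seq_equiv R Y E E''"
  using seq_map_comp[OF assms(3,4)[THEN seq_equiv_imp_seq_map]] assms(1,2)
  by (auto intro: seq_map_imp_seq_equiv)

section \<open>Pull-back sequences and their universal property\<close>

lemma pullback_seq_is_submodule:
  assumes "short_exact R Y (\<alpha>, M, \<beta>) X" "left_module R X'" "f \<in> module_hom R X' X"
  shows "is_submodule R (prod_module M X')
    {(m, x). m \<in> carrier M \<and> x \<in> carrier X' \<and> \<beta> m = f x}"
proof -
  note D = short_exactD[OF assms(1)]
  interpret M: left_module R M by (rule D(2))
  interpret X': left_module R X' by fact
  show ?thesis
    using module_hom_zero[OF D(5,2,3)] module_hom_zero[OF assms(3,2) D(3)]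
      module_hom_add[OF D(5)] module_hom_add[OF assms(3)]
      module_hom_smult[OF D(5)] module_hom_smult[OF assms(3)]
    by (auto simp: is_submodule_def)
qed

text \<open>An element of the kernel of \<open>snd\<close> is a pair \<open>(m, 0)\<close> with
  \<beta> m = f 0 = 0, so \<open>m\<close> comes from \<open>Y\<close>. Surjectivity holds because
  \<open>f x\<close> lifts along \<beta>.\<close>

lemma short_exact_pullback:
  assumes "short_exact R Y E X" "left_module R X'" "f \<in> module_hom R X' X"
  shows "short_exact R Y (pullback_seq E X' f) X'"
proof -
  obtain \<alpha> M \<beta> where E: "E = (\<alpha>, M, \<beta>)" by (cases E)
  note D = short_exactD[OF assms(1)[unfolded E]]
  interpret M: left_module R M by (rule D(2))
  interpret Y: left_module R Y by (rule D(1))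
  interpret X': left_module R X' by fact
  show ?thesis
    unfolding E pullback_seq_def prod.case
  proof (rule short_exactI)
    show "left_module R (submodule_of (prod_module M X')
        {(m, x). m \<in> carrier M \<and> x \<in> carrier X' \<and> \<beta> m = f x})"
      by (rule left_module_submodule_of[OF left_module_prod[OF D(2) assms(2)]])
        (rule pullback_seq_is_submodule[OF assms(1)[unfolded E] assms(2,3)])
  next
    fix y assume y: "y \<in> carrier Y" "(\<alpha> y, \<zero>\<^bsub>X'\<^esub>) = \<zero>\<^bsub>submodule_of (prod_module M X')
        {(m, x). m \<in> carrier M \<and> x \<in> carrier X' \<and> \<beta> m = f x}\<^esub>"
    then have "\<alpha> y = \<alpha> \<zero>\<^bsub>Y\<^esub>" using module_hom_zero[OF D(4,1,2)] by simp
    then show "y = \<zero>\<^bsub>Y\<^esub>" using inj_onD[OF D(6)] y by simp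
  next
    fix x assume "x \<in> carrier X'"
    then show "\<exists>m\<in>carrier (submodule_of (prod_module M X')
        {(m, x). m \<in> carrier M \<and> x \<in> carrier X' \<and> \<beta> m = f x}). snd m = x"
      using D(9)[OF module_hom_closed[OF assms(3)]] by auto
  qed (use D(1,7,8) assms(2) module_hom_closed[OF D(4)] module_hom_zero[OF assms(3,2) D(3)]
      in \<open>auto intro!: module_homI simp: module_hom_add[OF D(4)] module_hom_smult[OF D(4)]
        left_module_smult_r_zero[OF assms(2)]\<close>)
qed

lemma seq_map_pullback: "seq_map R Y (pullback_seq E X' f) E (\<lambda>y. y) f"
  unfolding pullback_seq_def
  by (cases E) (auto intro!: seq_mapI[where g = fst] module_homI)

text \<open>The universal property: \<open>m\<close> goes to the pair of \<open>g m\<close> and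
  \<beta>' m, which lies in the fibre product because the right-hand square commutes. The left-hand
  end \<open>A\<close> and the map \<open>s\<close> stay arbitrary, since fibre products of
  sequences with other kernels are treated in the same way.\<close>

lemma seq_map_to_pullback:
  assumes "short_exact R A E' X'" "seq_map R A E' E s f"
  shows "seq_map R A E' (pullback_seq E X' f) s (\<lambda>x. x)"
proof -
  obtain \<alpha> M \<beta> where E: "E = (\<alpha>, M, \<beta>)" by (cases E)
  obtain \<alpha>' M' \<beta>' where E': "E' = (\<alpha>', M', \<beta>')" by (cases E')
  note D = short_exactD[OF assms(1)[unfolded E']]
  obtain g where g: "g \<in> module_hom R M' M" "\<forall>a\<in>carrier A. g (\<alpha>' a) = \<alpha> (s a)"
    "\<forall>m\<in>carrier M'. \<beta> (g m) = f (\<beta>' m)"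
    using assms(2) unfolding E E' by (rule seq_mapE)
  note g = g(1) g(2,3)[rule_format]
  show ?thesis
    unfolding E E' pullback_seq_def prod.case
    by (rule seq_mapI[where g = "\<lambda>m. (g m, \<beta>' m)"])
      (auto intro!: module_homI simp: g(2,3) D(7) module_hom_closed[OF D(5)] module_hom_closed[OF g(1)]
        module_hom_add[OF g(1)] module_hom_add[OF D(5)] module_hom_smult[OF g(1)] module_hom_smult[OF D(5)])
qed

text \<open>Recognises a pull-back: a morphism to \<open>E\<close> over \<open>f\<close> that is the
  identity on \<open>Y\<close> factors through the pull-back, and the factor has identities at both
  ends.\<close>

lemma seq_equiv_pullbackI:
  assumes "short_exact R Y E X" "f \<in> module_hom R X' X" "short_exact R Y E' X'"
    and "seq_map R Y E' E (\<lambda>y. y) f"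
  shows "seq_equiv R Y E' (pullback_seq E X' f)"
proof (rule seq_map_imp_seq_equiv[OF assms(3)])
  have "left_module R X'" using assms(3) by (cases E') (auto simp: short_exact_iff)
  then show "short_exact R Y (pullback_seq E X' f) X'"
    using assms(1,2) by (blast intro: short_exact_pullback)
  show "seq_map R Y E' (pullback_seq E X' f) (\<lambda>y. y) (\<lambda>x. x)"
    using assms(3,4) by (rule seq_map_to_pullback)
qed

section \<open>Push-out sequences and their universal property\<close>

lemma prod_module_diff:
  assumes "left_module R M" "left_module R N"
    "m \<in> carrier M" "n \<in> carrier N" "m' \<in> carrier M" "n' \<in> carrier N"
  shows "(m, n) \<ominus>\<^bsub>prod_module M N\<^esub> (m', n') = (m \<ominus>\<^bsub>M\<^esub> m', n \<ominus>\<^bsub>N\<^esub> n')"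
  using prod_module_minus[OF assms(1,2,5,6)] by (simp add: a_minus_def)

text \<open>The three facts share one computation, \<open>Peq\<close>: two cosets agree iff the
  pairs differ by some \<open>(s a, - \<alpha> a)\<close>. Injectivity on the left follows since
  \<alpha> a = 0 forces \<open>a = 0\<close> and hence \<open>s a = 0\<close>. The last fact is the
  universal property, with an arbitrary right-hand component \<open>f\<close>, so that a push-out
  can also be mapped to a sequence with a different right-hand end.\<close>

lemma pushout_seq_facts:
  fixes Y :: "('a, 'y) module"
  assumes "short_exact R A E X" "left_module R Y" "s \<in> module_hom R A Y"
  shows short_exact_pushout: "short_exact R Y (pushout_seq A s Y E) X"
    and seq_map_pushout: "seq_map R A E (pushout_seq A s Y E) s (\<lambda>x. x)"
    and seq_map_from_pushout: "\<lbrakk>short_exact R Y E' X'; seq_map R A E E' s f\<rbrakk>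
      \<Longrightarrow> seq_map R Y (pushout_seq A s Y E) E' (\<lambda>y. y) f"
proof -
  obtain \<alpha> M \<beta> where E: "E = (\<alpha>, M, \<beta>)" by (cases E)
  note D = short_exactD[OF assms(1)[unfolded E]]
  interpret A: left_module R A by (rule D(1))
  interpret M: left_module R M by (rule D(2))
  interpret X: left_module R X by (rule D(3))
  interpret Y: left_module R Y by fact
  define P where "P = prod_module Y M"
  define S where "S = (\<lambda>a. (s a, \<ominus>\<^bsub>M\<^esub> \<alpha> a)) ` carrier A"
  define q where "q = (\<lambda>C. the_elem ((\<lambda>(y :: 'y, m). \<beta> m) ` C))"
  have po: "pushout_seq A s Y E = (\<lambda>y. S +>\<^bsub>P\<^esub> (y, \<zero>\<^bsub>M\<^esub>), quotient_module P S, q)"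
    by (simp add: pushout_seq_def E P_def S_def Let_def q_def)
  have P: "left_module R P" unfolding P_def by (rule left_module_prod[OF assms(2) D(2)])
  note cl = module_hom_closed[OF assms(3)] module_hom_closed[OF D(4)] module_hom_closed[OF D(5)]
  have "(\<lambda>a. (s a, \<ominus>\<^bsub>M\<^esub> \<alpha> a)) \<in> module_hom R A P"
    unfolding P_def
    by (rule module_homI)
      (auto simp: cl module_hom_add[OF assms(3)] module_hom_add[OF D(4)] M.M.minus_add
        module_hom_smult[OF assms(3)] module_hom_smult[OF D(4)] left_module_smult_r_minus[OF D(2)])
  then have S: "is_submodule R P S"
    unfolding S_def by (rule is_submodule_image[OF D(1) P])
  have Pc: "carrier P = carrier Y \<times> carrier M" by (simp add: P_def)
  have Padd: "(y, m) \<oplus>\<^bsub>P\<^esub> (y', m') = (y \<oplus>\<^bsub>Y\<^esub> y', m \<oplus>\<^bsub>M\<^esub> m')" for y y' m m'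
    by (simp add: P_def)
  have Psm: "r \<odot>\<^bsub>P\<^esub> (y, m) = (r \<odot>\<^bsub>Y\<^esub> y, r \<odot>\<^bsub>M\<^esub> m)" for r y m
    by (simp add: P_def)
  have Pz: "\<zero>\<^bsub>P\<^esub> = (\<zero>\<^bsub>Y\<^esub>, \<zero>\<^bsub>M\<^esub>)" by (simp add: P_def)
  have Peq: "S +>\<^bsub>P\<^esub> (y, m) = S +>\<^bsub>P\<^esub> (y', m') \<longleftrightarrow>
      (\<exists>a\<in>carrier A. y \<ominus>\<^bsub>Y\<^esub> y' = s a \<and> m \<ominus>\<^bsub>M\<^esub> m' = \<ominus>\<^bsub>M\<^esub> \<alpha> a)"
    if "y \<in> carrier Y" "m \<in> carrier M" "y' \<in> carrier Y" "m' \<in> carrier M" for y m y' m'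
    using quotient_module_coset_eq_iff[OF P S, of "(y, m)" "(y', m')"] that
    by (auto simp: Pc P_def prod_module_diff[OF assms(2) D(2)] S_def)
  note Q = left_module_quotient[OF P S]
  note Qs = quotient_module_carrier quotient_module_zero[OF P S]
    quotient_module_add[OF P S] quotient_module_smult[OF P S]
  have \<phi>: "(\<lambda>(y :: 'y, m). \<beta> m) \<in> module_hom R P X"
    by (rule module_homI) (auto simp: Pc Padd Psm cl module_hom_add[OF D(5)] module_hom_smult[OF D(5)])
  have \<phi>0: "(\<lambda>(y :: 'y, m). \<beta> m) c = \<zero>\<^bsub>X\<^esub>" if "c \<in> S" for c
    using that D(7) cl by (auto simp: S_def module_hom_minus[OF D(5,2,3)])
  have qv: "q (S +>\<^bsub>P\<^esub> (y, m)) = \<beta> m" if "y \<in> carrier Y" "m \<in> carrier M" for y m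
    using quotient_module_desc(1)[OF P S D(3) \<phi> \<phi>0, of "(y, m)"] that by (simp add: q_def Pc)
  have qh: "q \<in> module_hom R (quotient_module P S) X"
    unfolding q_def by (rule quotient_module_desc(2)[OF P S D(3) \<phi> \<phi>0])
  show "short_exact R Y (pushout_seq A s Y E) X"
    unfolding po
  proof (rule short_exactI[OF assms(2) Q D(3) _ qh])
    show "(\<lambda>y. S +>\<^bsub>P\<^esub> (y, \<zero>\<^bsub>M\<^esub>)) \<in> module_hom R Y (quotient_module P S)"
      by (rule module_homI) (auto simp: Qs Pc Padd Psm left_module_smult_r_zero[OF D(2)])
  next
    fix y assume y: "y \<in> carrier Y" "S +>\<^bsub>P\<^esub> (y, \<zero>\<^bsub>M\<^esub>) = \<zero>\<^bsub>quotient_module P S\<^esub>"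
    then obtain a where a: "a \<in> carrier A" "y \<ominus>\<^bsub>Y\<^esub> \<zero>\<^bsub>Y\<^esub> = s a" "\<zero>\<^bsub>M\<^esub> \<ominus>\<^bsub>M\<^esub> \<zero>\<^bsub>M\<^esub> = \<ominus>\<^bsub>M\<^esub> \<alpha> a"
      using Peq by (auto simp: Qs Pz)
    have "\<ominus>\<^bsub>M\<^esub> \<alpha> a = \<zero>\<^bsub>M\<^esub>"
      using a(3) by (simp add: a_minus_def M.M.r_neg)
    then have "\<alpha> a = \<zero>\<^bsub>M\<^esub>"
      using M.M.r_neg[OF cl(2)[OF a(1)]] cl(2)[OF a(1)] by simp
    then have "\<alpha> a = \<alpha> \<zero>\<^bsub>A\<^esub>" using module_hom_zero[OF D(4,1,2)] by simp
    then have "a = \<zero>\<^bsub>A\<^esub>" using inj_onD[OF D(6)] a(1) by simp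
    then show "y = \<zero>\<^bsub>Y\<^esub>"
      using a(2) y(1) module_hom_zero[OF assms(3) D(1) assms(2)] diff_eq_zero_iff[OF assms(2)] by simp
  next
    fix y assume "y \<in> carrier Y"
    then show "q (S +>\<^bsub>P\<^esub> (y, \<zero>\<^bsub>M\<^esub>)) = \<zero>\<^bsub>X\<^esub>"
      by (simp add: qv module_hom_zero[OF D(5,2,3)])
  next
    fix C assume C: "C \<in> carrier (quotient_module P S)" "q C = \<zero>\<^bsub>X\<^esub>"
    then obtain y m where ym: "y \<in> carrier Y" "m \<in> carrier M" "C = S +>\<^bsub>P\<^esub> (y, m)"
      by (auto simp: Qs Pc)
    then obtain a where a: "a \<in> carrier A" "m = \<alpha> a"
      using D(8)[of m] C(2) qv by auto
    \<comment> \<open>Inside the quotient \<open>(y, \<alpha> a)\<close> can be traded for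
      \<open>(y + s a, 0)\<close>; the two differ by the element of \<open>S\<close> that belongs to
      \<open>-a\<close>.\<close>
    have "C = S +>\<^bsub>P\<^esub> (y \<oplus>\<^bsub>Y\<^esub> s a, \<zero>\<^bsub>M\<^esub>)"
      unfolding ym(3)
    proof (subst Peq)
      show "\<exists>b\<in>carrier A. y \<ominus>\<^bsub>Y\<^esub> (y \<oplus>\<^bsub>Y\<^esub> s a) = s b \<and> m \<ominus>\<^bsub>M\<^esub> \<zero>\<^bsub>M\<^esub> = \<ominus>\<^bsub>M\<^esub> \<alpha> b"
      proof (intro bexI[of _ "\<ominus>\<^bsub>A\<^esub> a"] conjI)
        have "y \<ominus>\<^bsub>Y\<^esub> (y \<oplus>\<^bsub>Y\<^esub> s a) = y \<oplus>\<^bsub>Y\<^esub> (\<ominus>\<^bsub>Y\<^esub> y \<oplus>\<^bsub>Y\<^esub> \<ominus>\<^bsub>Y\<^esub> s a)"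
          using ym(1) a cl by (simp add: a_minus_def Y.M.minus_add)
        also have "\<dots> = \<ominus>\<^bsub>Y\<^esub> s a"
          using ym(1) a cl by (simp add: Y.M.a_assoc[symmetric] Y.M.r_neg)
        finally show "y \<ominus>\<^bsub>Y\<^esub> (y \<oplus>\<^bsub>Y\<^esub> s a) = s (\<ominus>\<^bsub>A\<^esub> a)"
          using a by (simp add: module_hom_minus[OF assms(3) D(1) assms(2)])
        show "m \<ominus>\<^bsub>M\<^esub> \<zero>\<^bsub>M\<^esub> = \<ominus>\<^bsub>M\<^esub> \<alpha> (\<ominus>\<^bsub>A\<^esub> a)"
          using a cl by (simp add: module_hom_minus[OF D(4,1,2)] a_minus_def left_module_minus_zero[OF D(2)])
      qed (use a in simp)
    qed (use ym a cl in auto)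
    then show "\<exists>y\<in>carrier Y. C = S +>\<^bsub>P\<^esub> (y, \<zero>\<^bsub>M\<^esub>)"
      using ym a cl by (intro bexI[of _ "y \<oplus>\<^bsub>Y\<^esub> s a"]) auto
  next
    fix x assume "x \<in> carrier X"
    then obtain m where "m \<in> carrier M" "\<beta> m = x" using D(9) by blast
    then show "\<exists>C\<in>carrier (quotient_module P S). q C = x"
      using qv[of "\<zero>\<^bsub>Y\<^esub>" m] by (intro bexI[of _ "S +>\<^bsub>P\<^esub> (\<zero>\<^bsub>Y\<^esub>, m)"]) (auto simp: Qs Pc)
  qed
  show "seq_map R A E (pushout_seq A s Y E) s (\<lambda>x. x)"
    unfolding po unfolding E
  proof (rule seq_mapI)
    show "(\<lambda>m. S +>\<^bsub>P\<^esub> (\<zero>\<^bsub>Y\<^esub>, m)) \<in> module_hom R M (quotient_module P S)"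
      by (rule module_homI) (auto simp: Qs Pc Padd Psm left_module_smult_r_zero[OF assms(2)])
  next
    fix a assume a: "a \<in> carrier A"
    show "S +>\<^bsub>P\<^esub> (\<zero>\<^bsub>Y\<^esub>, \<alpha> a) = S +>\<^bsub>P\<^esub> (s a, \<zero>\<^bsub>M\<^esub>)"
    proof (subst Peq)
      show "\<exists>b\<in>carrier A. \<zero>\<^bsub>Y\<^esub> \<ominus>\<^bsub>Y\<^esub> s a = s b \<and> \<alpha> a \<ominus>\<^bsub>M\<^esub> \<zero>\<^bsub>M\<^esub> = \<ominus>\<^bsub>M\<^esub> \<alpha> b"
        using a cl
        by (intro bexI[of _ "\<ominus>\<^bsub>A\<^esub> a"])
          (simp_all add: module_hom_minus[OF D(4,1,2)] module_hom_minus[OF assms(3) D(1) assms(2)] a_minus_def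
            left_module_minus_zero[OF D(2)])
    qed (use a cl in auto)
  qed (simp add: qv)
  show "seq_map R Y (pushout_seq A s Y E) E' (\<lambda>y. y) f"
    if E'x: "short_exact R Y E' X'" and mp: "seq_map R A E E' s f"
  proof -
    obtain \<alpha>' M' \<beta>' where E': "E' = (\<alpha>', M', \<beta>')" by (cases E')
    note D' = short_exactD[OF E'x[unfolded E']]
    interpret M': left_module R M' by (rule D'(2))
    interpret X': left_module R X' by (rule D'(3))
    obtain g where g: "g \<in> module_hom R M M'" "\<forall>a\<in>carrier A. g (\<alpha> a) = \<alpha>' (s a)"
      "\<forall>m\<in>carrier M. \<beta>' (g m) = f (\<beta> m)"
      using mp unfolding E E' by (rule seq_mapE)
    note g = g(1) g(2,3)[rule_format]
    note cl' = cl module_hom_closed[OF D'(4)] module_hom_closed[OF D'(5)] module_hom_closed[OF g(1)]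
    \<comment> \<open>The only map compatible with both components. It kills \<open>S\<close>
      because \<open>g (\<alpha> a) = \<alpha>' (s a)\<close>, so it descends to the
      quotient.\<close>
    define \<psi> where "\<psi> = (\<lambda>(y, m). \<alpha>' y \<oplus>\<^bsub>M'\<^esub> g m)"
    have "(\<lambda>p. \<alpha>' (fst p) \<oplus>\<^bsub>M'\<^esub> g (snd p)) \<in> module_hom R P M'"
      by (rule module_hom_pointwise_add)
        (auto intro!: module_homI simp: Pc Padd Psm cl' module_hom_add[OF D'(4)] module_hom_add[OF g(1)]
          module_hom_smult[OF D'(4)] module_hom_smult[OF g(1)] D')
    then have \<psi>: "\<psi> \<in> module_hom R P M'"
      by (simp add: \<psi>_def case_prod_unfold)
    have \<psi>0: "\<psi> c = \<zero>\<^bsub>M'\<^esub>" if "c \<in> S" for c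
      using that by (auto simp: S_def \<psi>_def module_hom_minus[OF g(1) D(2) D'(2)] cl' g(2) M'.M.r_neg)
    define h where "h = (\<lambda>C. the_elem (\<psi> ` C))"
    have hh: "h \<in> module_hom R (quotient_module P S) M'"
      unfolding h_def by (rule quotient_module_desc(2)[OF P S D'(2) \<psi> \<psi>0])
    have hv: "h (S +>\<^bsub>P\<^esub> (y, m)) = \<alpha>' y \<oplus>\<^bsub>M'\<^esub> g m" if "y \<in> carrier Y" "m \<in> carrier M" for y m
      using quotient_module_desc(1)[OF P S D'(2) \<psi> \<psi>0, of "(y, m)"] that
      by (simp add: Pc h_def \<psi>_def)
    show ?thesis
      unfolding po unfolding E'
    proof (rule seq_mapI[OF hh])
      fix y assume "y \<in> carrier Y"
      then show "h (S +>\<^bsub>P\<^esub> (y, \<zero>\<^bsub>M\<^esub>)) = \<alpha>' y"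
        using cl' by (simp add: hv module_hom_zero[OF g(1) D(2) D'(2)])
    next
      fix C assume "C \<in> carrier (quotient_module P S)"
      then obtain y m where "y \<in> carrier Y" "m \<in> carrier M" "C = S +>\<^bsub>P\<^esub> (y, m)"
        by (auto simp: Qs Pc)
      then show "\<beta>' (h C) = f (q C)"
        using cl'(5)[of "g m"] cl' by (simp add: hv qv module_hom_add[OF D'(5)] D'(7) flip: g(3))
    qed
  qed
qed

text \<open>The dual recognition principle: any sequence receiving a morphism from \<open>E\<close>
  that is \<open>s\<close> on the left and the identity on the right is the push-out along
  \<open>s\<close>.\<close>

lemma seq_equiv_pushoutI:
  assumes "short_exact R A E X" "left_module R Y" "s \<in> module_hom R A Y"
    and "short_exact R Y E' X" "seq_map R A E E' s (\<lambda>x. x)"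
  shows "seq_equiv R Y (pushout_seq A s Y E) E'"
  by (rule seq_map_imp_seq_equiv[OF short_exact_pushout[OF assms(1-3)] assms(4)])
    (rule seq_map_from_pushout[OF assms])

lemma short_exact_prod:
  assumes "short_exact R Y E X" "short_exact R Y' E' X'"
  shows "short_exact R (prod_module Y Y') (prod_seq E E') (prod_module X X')"
proof -
  obtain \<alpha> M \<beta> where E: "E = (\<alpha>, M, \<beta>)" by (cases E)
  obtain \<alpha>' M' \<beta>' where E': "E' = (\<alpha>', M', \<beta>')" by (cases E')
  note D = short_exactD[OF assms(1)[unfolded E]]
  note D' = short_exactD[OF assms(2)[unfolded E']]
  interpret Y: left_module R Y by (rule D(1))
  interpret Y': left_module R Y' by (rule D'(1))
  note zi = module_hom_zero[OF D(4,1,2)] module_hom_zero[OF D'(4,1,2)]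
  show ?thesis
    unfolding E E' prod_seq_def prod.case
  proof (rule short_exactI)
    fix y assume "y \<in> carrier (prod_module Y Y')" "map_prod \<alpha> \<alpha>' y = \<zero>\<^bsub>prod_module M M'\<^esub>"
    then show "y = \<zero>\<^bsub>prod_module Y Y'\<^esub>"
      using inj_onD[OF D(6), of "fst y" "\<zero>\<^bsub>Y\<^esub>"] inj_onD[OF D'(6), of "snd y" "\<zero>\<^bsub>Y'\<^esub>"] zi
      by (cases y) auto
  next
    fix m assume "m \<in> carrier (prod_module M M')" "map_prod \<beta> \<beta>' m = \<zero>\<^bsub>prod_module X X'\<^esub>"
    then show "\<exists>y\<in>carrier (prod_module Y Y'). m = map_prod \<alpha> \<alpha>' y"
      using D(8)[of "fst m"] D'(8)[of "snd m"] by (cases m) auto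
  next
    fix x assume "x \<in> carrier (prod_module X X')"
    then show "\<exists>m\<in>carrier (prod_module M M'). map_prod \<beta> \<beta>' m = x"
      using D(9)[of "fst x"] D'(9)[of "snd x"] by (cases x) auto
  qed (auto intro!: left_module_prod module_homI D(1-5) D'(1-5)
      simp: D(7) D'(7) module_hom_closed[OF D(4)] module_hom_closed[OF D(5)]
       module_hom_closed[OF D'(4)] module_hom_closed[OF D'(5)]
       module_hom_add[OF D(4)] module_hom_add[OF D(5)] module_hom_add[OF D'(4)] module_hom_add[OF D'(5)]
       module_hom_smult[OF D(4)] module_hom_smult[OF D(5)] module_hom_smult[OF D'(4)] module_hom_smult[OF D'(5)])
qed

subsection \<open>Extension classes and the Baer sum\<close>

text \<open>Moves a module to another type: the operations are conjugated by the injection, and the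
  new carrier is its image.\<close>

lemma left_module_transport:
  assumes "left_module R M" "inj_on \<rho> (carrier M)"
  obtains N where "left_module R N" "\<rho> \<in> module_iso R M N"
proof -
  interpret M: left_module R M by fact
  let ?\<tau> = "inv_into (carrier M) \<rho>"
  define N where "N = mk_module (\<rho> ` carrier M) (\<rho> \<zero>\<^bsub>M\<^esub>)
    (\<lambda>p q. \<rho> (?\<tau> p \<oplus>\<^bsub>M\<^esub> ?\<tau> q)) (\<lambda>r p. \<rho> (r \<odot>\<^bsub>M\<^esub> ?\<tau> p))"
  have \<tau>: "?\<tau> (\<rho> m) = m" if "m \<in> carrier M" for m
    using assms(2) that by simp
  have "left_module R N"
  proof (rule left_moduleI)
    fix x assume "x \<in> carrier N"
    then obtain m where "m \<in> carrier M" "x = \<rho> m" by (auto simp: N_def)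
    then show "\<exists>y\<in>carrier N. y \<oplus>\<^bsub>N\<^esub> x = \<zero>\<^bsub>N\<^esub>"
      by (intro bexI[of _ "\<rho> (\<ominus>\<^bsub>M\<^esub> m)"]) (auto simp: N_def \<tau> M.M.l_neg)
  qed (auto simp: N_def \<tau> M.R.ring_axioms M.M.a_ac M.smult_l_distr M.smult_r_distr M.smult_assoc)
  moreover have "\<rho> \<in> module_iso R M N"
    using assms(2) by (auto simp: module_iso_def bij_betw_def N_def \<tau> intro!: module_homI)
  ultimately show ?thesis by (rule that)
qed

lemma short_exact_transport:
  assumes "short_exact R Y (\<alpha>, M, \<beta>) X" "left_module R N" "\<phi> \<in> module_iso R M N"
  shows "short_exact R Y (\<lambda>y. \<phi> (\<alpha> y), N, \<lambda>n. \<beta> (inv_into (carrier M) \<phi> n)) X"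
    and "seq_equiv R Y (\<alpha>, M, \<beta>) (\<lambda>y. \<phi> (\<alpha> y), N, \<lambda>n. \<beta> (inv_into (carrier M) \<phi> n))"
proof -
  note D = short_exactD[OF assms(1)]
  interpret Y: left_module R Y by (rule D(1))
  interpret M: left_module R M by (rule D(2))
  have hom: "\<phi> \<in> module_hom R M N" and bij: "bij_betw \<phi> (carrier M) (carrier N)"
    using assms(3) by (auto simp: module_iso_def)
  let ?\<psi> = "inv_into (carrier M) \<phi>"
  have 1: "?\<psi> n \<in> carrier M" "\<phi> (?\<psi> n) = n" if "n \<in> carrier N" for n
    using that bij by (auto simp: bij_betw_def inv_into_into f_inv_into_f)
  have 2: "?\<psi> (\<phi> m) = m" if "m \<in> carrier M" for m
    using that bij by (auto simp: bij_betw_def)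
  note cl = module_hom_closed[OF D(4)] module_hom_closed[OF D(5)] module_hom_closed[OF hom]
  show "short_exact R Y (\<lambda>y. \<phi> (\<alpha> y), N, \<lambda>n. \<beta> (?\<psi> n)) X"
  proof (rule short_exactI)
    show "(\<lambda>y. \<phi> (\<alpha> y)) \<in> module_hom R Y N"
      by (rule module_hom_compose[OF D(4) hom])
    show "(\<lambda>n. \<beta> (?\<psi> n)) \<in> module_hom R N X"
      by (rule module_hom_compose[OF module_iso_inverse[OF assms(3) D(2)] D(5)])
  next
    fix y assume y: "y \<in> carrier Y" "\<phi> (\<alpha> y) = \<zero>\<^bsub>N\<^esub>"
    then have "\<phi> (\<alpha> y) = \<phi> (\<alpha> \<zero>\<^bsub>Y\<^esub>)"
      using module_hom_zero[OF D(4,1,2)] module_hom_zero[OF hom D(2) assms(2)] by simp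
    then have "\<alpha> y = \<alpha> \<zero>\<^bsub>Y\<^esub>"
      using 2 cl y(1) by (metis Y.M.zero_closed)
    then show "y = \<zero>\<^bsub>Y\<^esub>" using inj_onD[OF D(6)] y(1) by simp
  next
    fix n assume n: "n \<in> carrier N" "\<beta> (?\<psi> n) = \<zero>\<^bsub>X\<^esub>"
    then obtain y where "y \<in> carrier Y" "?\<psi> n = \<alpha> y"
      using D(8)[of "?\<psi> n"] 1 by blast
    then show "\<exists>y\<in>carrier Y. n = \<phi> (\<alpha> y)"
      using 1[OF n(1)] by (intro bexI[of _ y]) auto
  next
    fix x assume "x \<in> carrier X"
    then obtain m where "m \<in> carrier M" "\<beta> m = x" using D(9) by blast
    then show "\<exists>n\<in>carrier N. \<beta> (?\<psi> n) = x"
      using 2 cl by (intro bexI[of _ "\<phi> m"]) auto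
  qed (use D assms(2) 2 cl in auto)
  show "seq_equiv R Y (\<alpha>, M, \<beta>) (\<lambda>y. \<phi> (\<alpha> y), N, \<lambda>n. \<beta> (?\<psi> n))"
    using assms(3) 2 by (auto simp: seq_equiv_def)
qed

text \<open>With a set-theoretic section \<sigma> of \<beta>, the element \<open>m\<close> is
  determined by \<beta> m and by the element of \<open>Y\<close> whose image is
  \<open>m - \<sigma> (\<beta> m)\<close>. This gives an injection, in general not linear, of the
  middle term into the type of pairs, and the module structure is transported along it.\<close>

lemma ext_class_nonempty:
  assumes "short_exact R Y E X"
  shows "ext_class R X Y E \<noteq> {}"
proof -
  obtain \<alpha> M \<beta> where E: "E = (\<alpha>, M, \<beta>)" by (cases E)
  note D = short_exactD[OF assms[unfolded E]]
  interpret M: left_module R M by (rule D(2))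
  interpret X: left_module R X by (rule D(3))
  define \<sigma> where "\<sigma> = inv_into (carrier M) \<beta>"
  have \<sigma>: "\<sigma> x \<in> carrier M" "\<beta> (\<sigma> x) = x" if "x \<in> carrier X" for x
    using that assms by (auto simp: E short_exact_iff \<sigma>_def inv_into_into f_inv_into_f)
  define \<rho> where "\<rho> m = (inv_into (carrier Y) \<alpha> (m \<ominus>\<^bsub>M\<^esub> \<sigma> (\<beta> m)), \<beta> m)" for m
  have \<alpha>\<rho>: "\<alpha> (fst (\<rho> m)) \<oplus>\<^bsub>M\<^esub> \<sigma> (\<beta> m) = m" if m: "m \<in> carrier M" for m
  proof -
    have \<beta>m: "\<beta> m \<in> carrier X" using module_hom_closed[OF D(5) m] .
    have "\<beta> (m \<ominus>\<^bsub>M\<^esub> \<sigma> (\<beta> m)) = \<zero>\<^bsub>X\<^esub>"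
      using m \<sigma>[OF \<beta>m] \<beta>m by (simp add: module_hom_diff[OF D(5,2,3)] diff_eq_zero_iff[OF D(3)])
    then obtain y where "y \<in> carrier Y" "m \<ominus>\<^bsub>M\<^esub> \<sigma> (\<beta> m) = \<alpha> y"
      using D(8)[of "m \<ominus>\<^bsub>M\<^esub> \<sigma> (\<beta> m)"] m \<sigma>[OF \<beta>m] by auto
    then have "\<alpha> (fst (\<rho> m)) = m \<ominus>\<^bsub>M\<^esub> \<sigma> (\<beta> m)"
      using D(6) by (simp add: \<rho>_def)
    then show ?thesis
      using m \<sigma>(1)[OF \<beta>m] by (simp add: a_minus_def M.M.a_assoc M.M.l_neg)
  qed
  have "inj_on \<rho> (carrier M)"
  proof (rule inj_onI)
    fix m n assume mn: "m \<in> carrier M" "n \<in> carrier M" and eq: "\<rho> m = \<rho> n"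
    have "\<beta> m = \<beta> n" using eq by (simp add: \<rho>_def)
    then show "m = n" using \<alpha>\<rho>[OF mn(1)] \<alpha>\<rho>[OF mn(2)] eq by metis
  qed
  then obtain N where "left_module R N" "\<rho> \<in> module_iso R M N"
    by (rule left_module_transport[OF D(2)])
  then show ?thesis
    using short_exact_transport[OF assms[unfolded E], of N \<rho>] unfolding E ext_class_def by blast
qed

text \<open>The middle terms of \<open>E\<close> and \<open>E'\<close> may lie on different types,
  yet both classes are sets over the same type, so equivalence across types becomes an
  equality.\<close>

lemma ext_class_eqI:
  assumes "short_exact R Y E X" "short_exact R Y E' X" "seq_equiv R Y E E'"
  shows "ext_class R X Y E = ext_class R X Y E'"
  using assms seq_equiv_sym[OF assms(1,3)] by (auto simp: ext_class_def intro: seq_equiv_trans)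

lemma ext_class_memD:
  assumes "short_exact R Y E X" "E' \<in> ext_class R X Y E"
  shows "short_exact R Y E' X" "seq_equiv R Y E E'" "ext_class R X Y E' = ext_class R X Y E"
  using assms ext_class_eqI[of R Y E X E'] by (auto simp: ext_class_def)

text \<open>The carrier of \<open>Ext\<close> lists only classes of sequences on the type of pairs.
  A sequence on another type gets in through a member of its class, which is nonempty and has the
  same class.\<close>

lemma ext_class_in_Ext:
  assumes "short_exact R Y E X"
  shows "ext_class R X Y E \<in> carrier (Ext R X Y)"
proof -
  obtain E' where E': "E' \<in> ext_class R X Y E"
    using ext_class_nonempty[OF assms] by blast
  show ?thesis
    unfolding Ext_def mk_module_simps using ext_class_memD[OF assms E'] by blast
qed

lemma Ext_carrierE:
  assumes "C \<in> carrier (Ext R X Y)"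
  obtains E :: "('a, 'y, 'x) ext_seq" where "short_exact R Y E X" "C = ext_class R X Y E"
  using assms unfolding Ext_def mk_module_simps by blast

section \<open>Fibre products of extensions and the Baer sum\<close>

text \<open>The pull-back of the product sequence along the diagonal of \<open>X\<close>. Its middle
  term is the fibre product over \<open>X\<close> together with a redundant base coordinate. With
  this name the Baer sum is a single push-out along addition.\<close>

definition fibre_seq ::
  "('a, 'x) module \<Rightarrow> ('a, 'y, 'm, 'x) seq \<Rightarrow> ('a, 'z, 'n, 'x) seq
    \<Rightarrow> ('a, 'y \<times> 'z, ('m \<times> 'n) \<times> 'x, 'x) seq"
  where "fibre_seq X E E' = pullback_seq (prod_seq E E') X (\<lambda>x. (x, x))"

lemma short_exact_right: "short_exact R Y E X \<Longrightarrow> left_module R X"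
  and short_exact_left: "short_exact R Y E X \<Longrightarrow> left_module R Y"
  by (cases E; simp add: short_exact_iff)+

lemma short_exact_fibre:
  assumes "short_exact R Y E X" "short_exact R Y' E' X"
  shows "short_exact R (prod_module Y Y') (fibre_seq X E E') X"
  unfolding fibre_seq_def
  by (rule short_exact_pullback[OF short_exact_prod[OF assms] short_exact_right[OF assms(1)]])
    (rule module_homI; simp)

lemma seq_map_prod:
  assumes "seq_map R Y E F s f" "seq_map R Y' E' F' s' f'"
  shows "seq_map R (prod_module Y Y') (prod_seq E E') (prod_seq F F') (map_prod s s') (map_prod f f')"
proof -
  obtain \<alpha> M \<beta> where E: "E = (\<alpha>, M, \<beta>)" by (cases E)
  obtain \<alpha>' M' \<beta>' where E': "E' = (\<alpha>', M', \<beta>')" by (cases E')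
  obtain \<gamma> N \<delta> where F: "F = (\<gamma>, N, \<delta>)" by (cases F)
  obtain \<gamma>' N' \<delta>' where F': "F' = (\<gamma>', N', \<delta>')" by (cases F')
  obtain g where g: "g \<in> module_hom R M N" "\<forall>a\<in>carrier Y. g (\<alpha> a) = \<gamma> (s a)"
    "\<forall>m\<in>carrier M. \<delta> (g m) = f (\<beta> m)"
    using assms(1) unfolding E F by (rule seq_mapE)
  obtain h where h: "h \<in> module_hom R M' N'" "\<forall>a\<in>carrier Y'. h (\<alpha>' a) = \<gamma>' (s' a)"
    "\<forall>m\<in>carrier M'. \<delta>' (h m) = f' (\<beta>' m)"
    using assms(2) unfolding E' F' by (rule seq_mapE)
  show ?thesis
    unfolding E F E' F' prod_seq_def prod.case
    by (rule seq_mapI[where g = "map_prod g h"])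
      (use g(2,3) h(2,3) in \<open>auto intro!: module_homI simp: module_hom_closed[OF g(1)]
        module_hom_closed[OF h(1)] module_hom_add[OF g(1)] module_hom_add[OF h(1)]
        module_hom_smult[OF g(1)] module_hom_smult[OF h(1)]\<close>)
qed

text \<open>Functoriality in both arguments. The kernels \<open>Y\<close> and \<open>Y'\<close> may
  differ, which permits fibre products of fibre products.\<close>

lemma seq_map_fibre:
  assumes "short_exact R Y E X" "short_exact R Y' E' X"
    and "seq_map R Y E F s (\<lambda>x. x)" "seq_map R Y' E' F' s' (\<lambda>x. x)"
  shows "seq_map R (prod_module Y Y') (fibre_seq X E E') (fibre_seq X F F') (map_prod s s') (\<lambda>x. x)"
proof -
  note se = short_exact_fibre[OF assms(1,2)]
  have "seq_map R (prod_module Y Y') (fibre_seq X E E') (prod_seq F F')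
      (\<lambda>y. map_prod s s' y) (\<lambda>x. map_prod (\<lambda>x. x) (\<lambda>x. x) (x, x))"
    unfolding fibre_seq_def by (rule seq_map_comp[OF seq_map_pullback seq_map_prod[OF assms(3,4)]])
  then have "seq_map R (prod_module Y Y') (fibre_seq X E E') (prod_seq F F') (map_prod s s') (\<lambda>x. (x, x))"
    by simp
  then show ?thesis
    using seq_map_to_pullback[OF se] by (simp add: fibre_seq_def)
qed

lemma module_hom_plus:
  assumes "left_module R Y"
  shows "(\<lambda>(y, y'). y \<oplus>\<^bsub>Y\<^esub> y') \<in> module_hom R (prod_module Y Y) Y"
proof -
  interpret Y: left_module R Y by fact
  have "(\<lambda>p. fst p \<oplus>\<^bsub>Y\<^esub> snd p) \<in> module_hom R (prod_module Y Y) Y"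
    by (rule module_hom_pointwise_add) (auto intro!: module_homI assms)
  then show ?thesis by (simp add: case_prod_unfold)
qed

lemma baer_sum_fibre:
  "baer_sum X Y E E' = pushout_seq (prod_module Y Y) (\<lambda>(y, y'). y \<oplus>\<^bsub>Y\<^esub> y') Y (fibre_seq X E E')"
  by (simp add: baer_sum_def fibre_seq_def)

lemma short_exact_baer_sum:
  assumes "short_exact R Y E X" "short_exact R Y E' X"
  shows "short_exact R Y (baer_sum X Y E E') X"
  unfolding baer_sum_fibre
  by (rule short_exact_pushout[OF short_exact_fibre[OF assms]])
    (rule short_exact_left[OF assms(1)] module_hom_plus)+

lemma seq_map_baer_sum:
  assumes "short_exact R Y E X" "short_exact R Y E' X"
  shows "seq_map R (prod_module Y Y) (fibre_seq X E E') (baer_sum X Y E E')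
    (\<lambda>(y, y'). y \<oplus>\<^bsub>Y\<^esub> y') (\<lambda>x. x)"
  unfolding baer_sum_fibre
  by (rule seq_map_pushout[OF short_exact_fibre[OF assms]])
    (rule short_exact_left[OF assms(1)] module_hom_plus)+

text \<open>To identify a Baer sum with \<open>F\<close>, it suffices to map the fibre product to
  \<open>F\<close> by addition on the kernels and the identity on \<open>X\<close>: this makes
  \<open>F\<close> the push-out that defines the sum.\<close>

lemma ext_class_baer_sumI:
  assumes "short_exact R Y E X" "short_exact R Y E' X" "short_exact R Y F X"
    and "seq_map R (prod_module Y Y) (fibre_seq X E E') F (\<lambda>(y, y'). y \<oplus>\<^bsub>Y\<^esub> y') (\<lambda>x. x)"
  shows "ext_class R X Y (baer_sum X Y E E') = ext_class R X Y F"
proof (rule ext_class_eqI[OF short_exact_baer_sum[OF assms(1,2)] assms(3)])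
  show "seq_equiv R Y (baer_sum X Y E E') F"
    unfolding baer_sum_fibre
    by (rule seq_equiv_pushoutI[OF short_exact_fibre[OF assms(1,2)]])
      (rule short_exact_left[OF assms(1)] module_hom_plus assms)+
qed

lemma ext_class_baer_sum_cong:
  assumes "short_exact R Y E X" "short_exact R Y E' X" "short_exact R Y F X" "short_exact R Y F' X"
    and "seq_equiv R Y E F" "seq_equiv R Y E' F'"
  shows "ext_class R X Y (baer_sum X Y E E') = ext_class R X Y (baer_sum X Y F F')"
proof (rule ext_class_baer_sumI[OF assms(1,2) short_exact_baer_sum[OF assms(3,4)]])
  show "seq_map R (prod_module Y Y) (fibre_seq X E E') (baer_sum X Y F F')
      (\<lambda>(y, y'). y \<oplus>\<^bsub>Y\<^esub> y') (\<lambda>x. x)"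
    using seq_map_comp[OF seq_map_fibre[OF assms(1,2) assms(5,6)[THEN seq_equiv_imp_seq_map]]
      seq_map_baer_sum[OF assms(3,4)]]
    by (auto simp: map_prod_def split_def)
qed

section \<open>Operations on \<open>Ext\<close> computed on representatives\<close>

text \<open>The union that defines the sum runs over nonempty classes, and its members all agree by
  \<open>ext_class_baer_sum_cong\<close>, so it collapses to any one of them. \<open>E\<close> and
  \<open>E'\<close> may have middle terms of any type.\<close>

lemma Ext_add:
  assumes "short_exact R Y E X" "short_exact R Y E' X"
  shows "ext_class R X Y E \<oplus>\<^bsub>Ext R X Y\<^esub> ext_class R X Y E' = ext_class R X Y (baer_sum X Y E E')"
proof -
  have "ext_class R X Y (baer_sum X Y F F') = ext_class R X Y (baer_sum X Y E E')"
    if "F \<in> ext_class R X Y E" "F' \<in> ext_class R X Y E'" for F F'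
    using ext_class_memD[OF assms(1) that(1)] ext_class_memD[OF assms(2) that(2)] assms
    by (intro ext_class_baer_sum_cong[symmetric])
  then show ?thesis
    unfolding Ext_def mk_module_simps
    by (intro SUP_eq_const ext_class_nonempty assms)
qed

text \<open>Again the union is constant: an equivalence from \<open>F\<close> to \<open>E\<close>
  turns the pull-back of \<open>F\<close> along \<open>h\<close> into a sequence over
  \<open>E\<close> and \<open>h\<close>, which is then the pull-back of \<open>E\<close>.\<close>

lemma Ext_smult:
  assumes "short_exact R Y E X" "h \<in> module_hom R X X"
  shows "h \<odot>\<^bsub>Ext R X Y\<^esub> ext_class R X Y E = ext_class R X Y (pullback_seq E X h)"
proof -
  have "ext_class R X Y (pullback_seq F X h) = ext_class R X Y (pullback_seq E X h)"
    if F: "F \<in> ext_class R X Y E" for F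
  proof (rule ext_class_eqI)
    note F' = ext_class_memD[OF assms(1) F]
    have X: "left_module R X" using assms(1) by (rule short_exact_right)
    show 1: "short_exact R Y (pullback_seq F X h) X"
      by (rule short_exact_pullback[OF F'(1) X assms(2)])
    show "short_exact R Y (pullback_seq E X h) X"
      by (rule short_exact_pullback[OF assms(1) X assms(2)])
    show "seq_equiv R Y (pullback_seq F X h) (pullback_seq E X h)"
    proof (rule seq_equiv_pullbackI[OF assms(1,2) 1])
      have "seq_map R Y F E (\<lambda>y. y) (\<lambda>x. x)"
        using seq_equiv_sym[OF assms(1) F'(2)] by (rule seq_equiv_imp_seq_map)
      then show "seq_map R Y (pullback_seq F X h) E (\<lambda>y. y) h"
        using seq_map_comp[OF seq_map_pullback] by blast
    qed
  qed
  then show ?thesis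
    unfolding Ext_def mk_module_simps
    by (intro SUP_eq_const ext_class_nonempty assms)
qed

lemma Ext_zero:
  "\<zero>\<^bsub>Ext R X Y\<^esub> = ext_class R X Y (\<lambda>y. (y, \<zero>\<^bsub>X\<^esub>), prod_module Y X, snd)"
  by (simp add: Ext_def)

lemma short_exact_split:
  assumes "left_module R X" "left_module R Y"
  shows "short_exact R Y (\<lambda>y. (y, \<zero>\<^bsub>X\<^esub>), prod_module Y X, snd) X"
proof -
  interpret X: left_module R X by fact
  interpret Y: left_module R Y by fact
  show ?thesis
    by (rule short_exactI)
      (auto intro!: left_module_prod module_homI assms simp: left_module_smult_r_zero[OF assms(1)])
qed

lemma Ext_l_zero:
  assumes "short_exact R Y E X"
  shows "\<zero>\<^bsub>Ext R X Y\<^esub> \<oplus>\<^bsub>Ext R X Y\<^esub> ext_class R X Y E = ext_class R X Y E"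
proof -
  obtain \<alpha> M \<beta> where E: "E = (\<alpha>, M, \<beta>)" by (cases E)
  note D = short_exactD[OF assms[unfolded E]]
  interpret M: left_module R M by (rule D(2))
  interpret X: left_module R X by (rule D(3))
  interpret Y: left_module R Y by (rule D(1))
  note split = short_exact_split[OF D(3,1)]
  have P: "left_module R (submodule_of (prod_module (prod_module (prod_module Y X) M) X)
      {(m, x). m \<in> carrier (prod_module (prod_module Y X) M) \<and> x \<in> carrier X \<and>
        map_prod snd \<beta> m = (x, x)})"
    using short_exact_fibre[OF split assms]
    by (simp add: fibre_seq_def pullback_seq_def prod_seq_def E short_exact_iff)
  show ?thesis
    unfolding Ext_zero Ext_add[OF split assms]
  proof (rule ext_class_baer_sumI[OF split assms assms])
    show "seq_map R (prod_module Y Y) (fibre_seq X (\<lambda>y. (y, \<zero>\<^bsub>X\<^esub>), prod_module Y X, snd) E) E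
      (\<lambda>(y, y'). y \<oplus>\<^bsub>Y\<^esub> y') (\<lambda>x. x)"
      unfolding fibre_seq_def pullback_seq_def prod_seq_def E prod.case
    \<comment> \<open>The map takes \<open>((y, x), m)\<close> over \<open>x\<close> to
      \<open>\<alpha> y + m\<close>. On the kernels it is addition, and \<beta> does not see the
      summand \<alpha> y.\<close>
    proof (rule seq_mapI[where g = "\<lambda>p. \<alpha> (fst (fst (fst p))) \<oplus>\<^bsub>M\<^esub> snd (fst p)"])
      show "(\<lambda>p. \<alpha> (fst (fst (fst p))) \<oplus>\<^bsub>M\<^esub> snd (fst p)) \<in> module_hom R
         (submodule_of (prod_module (prod_module (prod_module Y X) M) X)
      {(m, x). m \<in> carrier (prod_module (prod_module Y X) M) \<and> x \<in> carrier X \<and>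
        map_prod snd \<beta> m = (x, x)}) M"
        by (rule module_hom_pointwise_add)
          (auto intro!: module_homI D(2) simp: module_hom_closed[OF D(4)]
            module_hom_add[OF D(4)] module_hom_smult[OF D(4)])
    qed (auto simp: module_hom_add[OF D(4)] module_hom_closed[OF D(4)] module_hom_closed[OF D(5)] 
        module_hom_add[OF D(5)] D(7))
  qed
qed

text \<open>Exchanging the two factors identifies the fibre products, and since addition in
  \<open>Y\<close> is commutative the map on kernels is still addition.\<close>

lemma Ext_comm:
  assumes "short_exact R Y E X" "short_exact R Y E' X"
  shows "ext_class R X Y E \<oplus>\<^bsub>Ext R X Y\<^esub> ext_class R X Y E'
    = ext_class R X Y E' \<oplus>\<^bsub>Ext R X Y\<^esub> ext_class R X Y E"
proof -
  obtain \<alpha> M \<beta> where E: "E = (\<alpha>, M, \<beta>)" by (cases E)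
  obtain \<alpha>' M' \<beta>' where E': "E' = (\<alpha>', M', \<beta>')" by (cases E')
  interpret Y: left_module R Y using assms(1) by (rule short_exact_left)
  have swap: "seq_map R (prod_module Y Y) (fibre_seq X E E') (fibre_seq X E' E)
      (\<lambda>(y, y'). (y', y)) (\<lambda>x. x)"
    unfolding fibre_seq_def pullback_seq_def prod_seq_def E E' prod.case
    by (rule seq_mapI[where g = "\<lambda>((m, m'), x). ((m', m), x)"]) (auto intro!: module_homI)
  have "seq_map R (prod_module Y Y) (fibre_seq X E E') (baer_sum X Y E' E)
      (\<lambda>p. (\<lambda>(y, y'). y \<oplus>\<^bsub>Y\<^esub> y') ((\<lambda>(y, y'). (y', y)) p)) (\<lambda>x. x)"
    by (rule seq_map_comp[OF swap seq_map_baer_sum[OF assms(2,1)]]) auto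
  then have "seq_map R (prod_module Y Y) (fibre_seq X E E') (baer_sum X Y E' E)
      (\<lambda>(y, y'). y \<oplus>\<^bsub>Y\<^esub> y') (\<lambda>x. x)"
    by (rule seq_map_cong[OF short_exact_fibre[OF assms]]) (auto simp: Y.M.a_comm)
  then show ?thesis
    unfolding Ext_add[OF assms] Ext_add[OF assms(2,1)]
    by (rule ext_class_baer_sumI[OF assms short_exact_baer_sum[OF assms(2,1)]])
qed

text \<open>Both iterated Baer sums receive a map from the threefold fibre product that is addition
  on the kernels, so both are equivalent to the push-out of that fibre product.\<close>

lemma Ext_assoc:
  assumes "short_exact R Y E1 X" "short_exact R Y E2 X" "short_exact R Y E3 X"
  shows "ext_class R X Y E1 \<oplus>\<^bsub>Ext R X Y\<^esub> ext_class R X Y E2 \<oplus>\<^bsub>Ext R X Y\<^esub> ext_class R X Y E3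
    = ext_class R X Y E1 \<oplus>\<^bsub>Ext R X Y\<^esub> (ext_class R X Y E2 \<oplus>\<^bsub>Ext R X Y\<^esub> ext_class R X Y E3)"
proof -
  obtain \<alpha>1 M1 \<beta>1 where E1: "E1 = (\<alpha>1, M1, \<beta>1)" by (cases E1)
  obtain \<alpha>2 M2 \<beta>2 where E2: "E2 = (\<alpha>2, M2, \<beta>2)" by (cases E2)
  obtain \<alpha>3 M3 \<beta>3 where E3: "E3 = (\<alpha>3, M3, \<beta>3)" by (cases E3)
  have Y: "left_module R Y" using assms(1) by (rule short_exact_left)
  interpret Y: left_module R Y by (rule Y)
  let ?YYY = "prod_module (prod_module Y Y) Y"
  let ?plus = "\<lambda>(y, y'). y \<oplus>\<^bsub>Y\<^esub> y'"
  define P where "P = fibre_seq X (fibre_seq X E1 E2) E3"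
  define s where "s = (\<lambda>((a, b), c). a \<oplus>\<^bsub>Y\<^esub> b \<oplus>\<^bsub>Y\<^esub> c)"
  have P: "short_exact R ?YYY P X"
    unfolding P_def by (intro short_exact_fibre assms)
  have "(\<lambda>p. (\<lambda>q. fst q \<oplus>\<^bsub>Y\<^esub> snd q) (fst p) \<oplus>\<^bsub>Y\<^esub> snd p) \<in> module_hom R ?YYY Y"
    by (intro module_hom_pointwise_add Y) (auto intro!: module_homI)
  then have s: "s \<in> module_hom R ?YYY Y"
    by (simp add: s_def case_prod_unfold)
  note b12 = short_exact_baer_sum[OF assms(1,2)] and b23 = short_exact_baer_sum[OF assms(2,3)]
  have "seq_map R ?YYY P (fibre_seq X (baer_sum X Y E1 E2) E3) (map_prod ?plus (\<lambda>y. y)) (\<lambda>x. x)"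
    unfolding P_def
    by (rule seq_map_fibre[OF short_exact_fibre[OF assms(1,2)] assms(3)
      seq_map_baer_sum[OF assms(1,2)] seq_map_ident])
  then have "seq_map R ?YYY P (baer_sum X Y (baer_sum X Y E1 E2) E3)
      (\<lambda>p. ?plus (map_prod ?plus (\<lambda>y. y) p)) (\<lambda>x. x)"
    by (rule seq_map_comp[OF _ seq_map_baer_sum[OF b12 assms(3)]]) auto
  then have m1: "seq_map R ?YYY P (baer_sum X Y (baer_sum X Y E1 E2) E3) s (\<lambda>x. x)"
    by (rule seq_map_cong[OF P]) (auto simp: s_def)
  \<comment> \<open>Reassociation also moves the inner base coordinate \<open>x\<close> from the
    first bracket to the second. This is legitimate because all base coordinates of an element of
    \<open>P\<close> coincide.\<close>
  have "seq_map R ?YYY P (fibre_seq X E1 (fibre_seq X E2 E3)) (\<lambda>((a, b), c). (a, (b, c))) (\<lambda>x. x)"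
    unfolding P_def fibre_seq_def pullback_seq_def prod_seq_def E1 E2 E3 prod.case
    by (rule seq_mapI[where g = "\<lambda>((((m1, m2), x), m3), x'). ((m1, ((m2, m3), x)), x')"])
      (auto intro!: module_homI)
  then have "seq_map R ?YYY P (fibre_seq X E1 (baer_sum X Y E2 E3))
      (\<lambda>p. map_prod (\<lambda>y. y) ?plus ((\<lambda>((a, b), c). (a, (b, c))) p)) (\<lambda>x. x)"
    by (rule seq_map_comp[OF _ seq_map_fibre[OF assms(1) short_exact_fibre[OF assms(2,3)]
        seq_map_ident seq_map_baer_sum[OF assms(2,3)]]]) auto
  then have "seq_map R ?YYY P (baer_sum X Y E1 (baer_sum X Y E2 E3))
      (\<lambda>p. ?plus (map_prod (\<lambda>y. y) ?plus ((\<lambda>((a, b), c). (a, (b, c))) p))) (\<lambda>x. x)"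
    by (rule seq_map_comp[OF _ seq_map_baer_sum[OF assms(1) b23]]) auto
  then have m2: "seq_map R ?YYY P (baer_sum X Y E1 (baer_sum X Y E2 E3)) s (\<lambda>x. x)"
    by (rule seq_map_cong[OF P]) (auto simp: s_def Y.M.a_assoc)
  show ?thesis
    unfolding Ext_add[OF assms(1,2)] Ext_add[OF assms(2,3)] Ext_add[OF b12 assms(3)] Ext_add[OF assms(1) b23]
    using ext_class_eqI[OF short_exact_pushout[OF P Y s] short_exact_baer_sum[OF b12 assms(3)]
        seq_equiv_pushoutI[OF P Y s short_exact_baer_sum[OF b12 assms(3)] m1]]
      ext_class_eqI[OF short_exact_pushout[OF P Y s] short_exact_baer_sum[OF assms(1) b23]
        seq_equiv_pushoutI[OF P Y s short_exact_baer_sum[OF assms(1) b23] m2]]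
    by simp
qed

text \<open>Supplies the structure in which the finite sums of \<open>is_basis\<close> are
  evaluated. Differences are later formed among homomorphisms, before \<delta> is applied.\<close>

lemma abelian_monoid_Ext:
  fixes X :: "('a, 'x) module" and Y :: "('a, 'y) module"
  assumes "left_module R X" "left_module R Y"
  shows "abelian_monoid (Ext R X Y)"
proof (rule abelian_monoidI)
  fix C D assume "C \<in> carrier (Ext R X Y)" "D \<in> carrier (Ext R X Y)"
  then obtain E E' :: "('a, 'y, 'x) ext_seq" where *: "short_exact R Y E X" "C = ext_class R X Y E"
      "short_exact R Y E' X" "D = ext_class R X Y E'"
    by (elim Ext_carrierE)
  show "C \<oplus>\<^bsub>Ext R X Y\<^esub> D \<in> carrier (Ext R X Y)"
    unfolding *(2,4) Ext_add[OF *(1,3)] by (rule ext_class_in_Ext[OF short_exact_baer_sum[OF *(1,3)]])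
  show "C \<oplus>\<^bsub>Ext R X Y\<^esub> D = D \<oplus>\<^bsub>Ext R X Y\<^esub> C"
    unfolding *(2,4) by (rule Ext_comm[OF *(1,3)])
next
  show "\<zero>\<^bsub>Ext R X Y\<^esub> \<in> carrier (Ext R X Y)"
    unfolding Ext_zero by (rule ext_class_in_Ext[OF short_exact_split[OF assms]])
next
  fix C D F
  assume "C \<in> carrier (Ext R X Y)" "D \<in> carrier (Ext R X Y)" "F \<in> carrier (Ext R X Y)"
  then obtain E1 E2 E3 :: "('a, 'y, 'x) ext_seq" where *: "short_exact R Y E1 X" "C = ext_class R X Y E1"
      "short_exact R Y E2 X" "D = ext_class R X Y E2" "short_exact R Y E3 X" "F = ext_class R X Y E3"
    by (elim Ext_carrierE)
  show "C \<oplus>\<^bsub>Ext R X Y\<^esub> D \<oplus>\<^bsub>Ext R X Y\<^esub> F = C \<oplus>\<^bsub>Ext R X Y\<^esub> (D \<oplus>\<^bsub>Ext R X Y\<^esub> F)"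
    unfolding *(2,4,6) by (rule Ext_assoc[OF *(1,3,5)])
next
  fix C assume "C \<in> carrier (Ext R X Y)"
  then obtain E :: "('a, 'y, 'x) ext_seq" where *: "short_exact R Y E X" "C = ext_class R X Y E" by (rule Ext_carrierE)
  show "\<zero>\<^bsub>Ext R X Y\<^esub> \<oplus>\<^bsub>Ext R X Y\<^esub> C = C"
    unfolding *(2) by (rule Ext_l_zero[OF *(1)])
qed

subsection \<open>The connecting homomorphism\<close>

lemma connecting_hom_apply:
  "connecting_hom R Y E X f = ext_class R X Y (pullback_seq E X f)"
  by (simp add: connecting_hom_def)

text \<open>The way to compute \<delta>: its value at \<open>f\<close> is the class of any sequence
  that lies over \<open>E\<close> with the identity on \<open>Y\<close> and \<open>f\<close> on the
  right. Additivity, linearity and the values at the inclusions all reduce to exhibiting such a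
  sequence.\<close>

lemma connecting_hom_eqI:
  assumes "short_exact R Y E N" "f \<in> module_hom R X N" "short_exact R Y E' X"
    and "seq_map R Y E' E (\<lambda>y. y) f"
  shows "connecting_hom R Y E X f = ext_class R X Y E'"
  unfolding connecting_hom_def
  using seq_equiv_pullbackI[OF assms]
    short_exact_pullback[OF assms(1) short_exact_right[OF assms(3)] assms(2)] assms(3)
  by (intro ext_class_eqI[symmetric])

lemma connecting_hom_in_Ext:
  assumes "short_exact R Y E N" "left_module R X" "f \<in> module_hom R X N"
  shows "connecting_hom R Y E X f \<in> carrier (Ext R X Y)"
  unfolding connecting_hom_def by (rule ext_class_in_Ext[OF short_exact_pullback[OF assms]])

text \<open>Adding the two components in \<open>M\<close> maps the fibre product of the pull-backs
  along \<open>f\<close> and \<open>g\<close> to \<open>E\<close>, over \<open>f + g\<close> and by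
  addition on the kernels. It therefore factors through the Baer sum, which thus lies over
  \<open>E\<close> and \<open>h\<close>. The sum \<open>h\<close> is prescribed only on the carrier,
  so that the extensional sum in \<open>Hom\<close> is covered too.\<close>

lemma connecting_hom_add:
  assumes "short_exact R Y E N" "left_module R X" "f \<in> module_hom R X N" "g \<in> module_hom R X N"
    and "\<And>x. x \<in> carrier X \<Longrightarrow> h x = f x \<oplus>\<^bsub>N\<^esub> g x"
  shows "connecting_hom R Y E X h
    = connecting_hom R Y E X f \<oplus>\<^bsub>Ext R X Y\<^esub> connecting_hom R Y E X g"
proof -
  obtain \<alpha> M \<beta> where E: "E = (\<alpha>, M, \<beta>)" by (cases E)
  note D = short_exactD[OF assms(1)[unfolded E]]
  interpret M: left_module R M by (rule D(2))
  interpret Y: left_module R Y by (rule D(1))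
  note pf = short_exact_pullback[OF assms(1,2,3)] and pg = short_exact_pullback[OF assms(1,2,4)]
  have h: "h \<in> module_hom R X N"
    by (rule module_hom_cong[OF module_hom_pointwise_add[OF assms(3,4) D(3)] assms(2)]) (rule assms(5))
  show ?thesis
    unfolding connecting_hom_apply[of R Y E X f] connecting_hom_apply[of R Y E X g] Ext_add[OF pf pg]
  proof (rule connecting_hom_eqI[OF assms(1) h short_exact_baer_sum[OF pf pg]])
    have "seq_map R (prod_module Y Y) (fibre_seq X (pullback_seq E X f) (pullback_seq E X g)) E
        (\<lambda>(y, y'). y \<oplus>\<^bsub>Y\<^esub> y') h"
      unfolding E fibre_seq_def prod_seq_def pullback_seq_def prod.case
    proof (rule seq_mapI[where g = "\<lambda>p. fst (fst (fst p)) \<oplus>\<^bsub>M\<^esub> fst (snd (fst p))"])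
      show "(\<lambda>p. fst (fst (fst p)) \<oplus>\<^bsub>M\<^esub> fst (snd (fst p))) \<in> module_hom R
        (submodule_of (prod_module (prod_module
          (submodule_of (prod_module M X) {(m, x). m \<in> carrier M \<and> x \<in> carrier X \<and> \<beta> m = f x})
          (submodule_of (prod_module M X) {(m, x). m \<in> carrier M \<and> x \<in> carrier X \<and> \<beta> m = g x})) X)
          {(m, x). m \<in> carrier (prod_module
          (submodule_of (prod_module M X) {(m, x). m \<in> carrier M \<and> x \<in> carrier X \<and> \<beta> m = f x})
          (submodule_of (prod_module M X) {(m, x). m \<in> carrier M \<and> x \<in> carrier X \<and> \<beta> m = g x}))
            \<and> x \<in> carrier X \<and> map_prod snd snd m = (x, x)}) M"
        by (rule module_hom_pointwise_add) (auto intro!: module_homI D(2))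
    qed (auto simp: module_hom_add[OF D(4)] module_hom_add[OF D(5)] assms(5))
    then show "seq_map R Y (baer_sum X Y (pullback_seq E X f) (pullback_seq E X g)) E (\<lambda>y. y) h"
      unfolding baer_sum_fibre
      by (rule seq_map_from_pushout[OF short_exact_fibre[OF pf pg] D(1) module_hom_plus[OF D(1)] assms(1)])
  qed
qed

text \<open>The split sequence lies over \<open>E\<close> and the zero map: project to
  \<open>Y\<close>, then apply \<alpha>.\<close>

lemma connecting_hom_zero:
  assumes "short_exact R Y E N" "left_module R X" "\<And>x. x \<in> carrier X \<Longrightarrow> f x = \<zero>\<^bsub>N\<^esub>"
  shows "connecting_hom R Y E X f = \<zero>\<^bsub>Ext R X Y\<^esub>"
proof -
  obtain \<alpha> M \<beta> where E: "E = (\<alpha>, M, \<beta>)" by (cases E)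
  note D = short_exactD[OF assms(1)[unfolded E]]
  have f: "f \<in> module_hom R X N"
    by (rule module_hom_cong[OF module_hom_const_zero[OF D(3)] assms(2,3)])
  show ?thesis
    unfolding Ext_zero
  proof (rule connecting_hom_eqI[OF assms(1) f short_exact_split[OF assms(2) D(1)]])
    show "seq_map R Y (\<lambda>y. (y, \<zero>\<^bsub>X\<^esub>), prod_module Y X, snd) E (\<lambda>y. y) f"
      unfolding E
      by (rule seq_mapI[where g = "\<lambda>p. \<alpha> (fst p)"])
        (auto intro!: module_homI simp: module_hom_closed[OF D(4)] module_hom_add[OF D(4)]
          module_hom_smult[OF D(4)] D(7) assms(3))
  qed
qed

text \<open>Pulling back along \<open>f\<close> and then along \<open>a\<close> gives a sequence
  over \<open>E\<close> and the map that applies \<open>a\<close> first and \<open>f\<close> second.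
  This is linearity for the left action on both sides.\<close>

lemma connecting_hom_smult:
  assumes "short_exact R Y E N" "left_module R X" "f \<in> module_hom R X N" "a \<in> module_hom R X X"
    and "\<And>x. x \<in> carrier X \<Longrightarrow> h x = f (a x)"
  shows "connecting_hom R Y E X h = a \<odot>\<^bsub>Ext R X Y\<^esub> connecting_hom R Y E X f"
proof -
  note pf = short_exact_pullback[OF assms(1-3)]
  note paf = short_exact_pullback[OF pf assms(2,4)]
  have h: "h \<in> module_hom R X N"
    by (rule module_hom_cong[OF module_hom_compose[OF assms(4,3)] assms(2,5)])
  show ?thesis
    unfolding connecting_hom_apply[of R Y E X f] Ext_smult[OF pf assms(4)]
  proof (rule connecting_hom_eqI[OF assms(1) h paf])
    have "seq_map R Y (pullback_seq (pullback_seq E X f) X a) E (\<lambda>y. y) (\<lambda>x. f (a x))"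
      by (rule seq_map_comp[OF seq_map_pullback seq_map_pullback])
    then show "seq_map R Y (pullback_seq (pullback_seq E X f) X a) E (\<lambda>y. y) h"
      by (rule seq_map_cong[OF paf]) (simp_all add: assms(5))
  qed
qed

subsection \<open>Direct sums\<close>

lemma direct_sum_simps:
  "carrier (direct_sum K N) = {f \<in> (\<Pi>\<^sub>E k\<in>K. carrier (N k)). finite {k \<in> K. f k \<noteq> \<zero>\<^bsub>N k\<^esub>}}"
  "\<zero>\<^bsub>direct_sum K N\<^esub> = (\<lambda>k\<in>K. \<zero>\<^bsub>N k\<^esub>)"
  "f \<oplus>\<^bsub>direct_sum K N\<^esub> g = (\<lambda>k\<in>K. f k \<oplus>\<^bsub>N k\<^esub> g k)"
  "r \<odot>\<^bsub>direct_sum K N\<^esub> f = (\<lambda>k\<in>K. r \<odot>\<^bsub>N k\<^esub> f k)"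
  by (simp_all add: direct_sum_def)

lemma left_module_direct_sum:
  assumes "ring R" "\<And>k. k \<in> K \<Longrightarrow> left_module R (N k)"
  shows "left_module R (direct_sum K N)"
proof -
  have ag: "abelian_group (N k)" if "k \<in> K" for k
    using assms(2)[OF that] by (rule left_module_abelian_group)
  have am: "abelian_monoid (N k)" if "k \<in> K" for k
    using ag[OF that] by (simp add: abelian_group_def)
  have mem: "f k \<in> carrier (N k)" if "f \<in> carrier (direct_sum K N)" "k \<in> K" for f k
    using that by (auto simp: direct_sum_simps)
  note simps = direct_sum_simps(2-4)
  show ?thesis
  proof (rule left_moduleI)
    show "ring R" by fact
  next
    show "\<zero>\<^bsub>direct_sum K N\<^esub> \<in> carrier (direct_sum K N)"
      using am by (auto simp: direct_sum_simps abelian_monoid.zero_closed)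
  next
    fix f g assume fg: "f \<in> carrier (direct_sum K N)" "g \<in> carrier (direct_sum K N)"
    have "finite ({k \<in> K. f k \<noteq> \<zero>\<^bsub>N k\<^esub>} \<union> {k \<in> K. g k \<noteq> \<zero>\<^bsub>N k\<^esub>})"
      using fg by (auto simp: direct_sum_simps)
    then have "finite {k \<in> K. f k \<oplus>\<^bsub>N k\<^esub> g k \<noteq> \<zero>\<^bsub>N k\<^esub>}"
      by (rule rev_finite_subset)
        (auto simp: am abelian_monoid.r_zero abelian_monoid.zero_closed)
    then show "f \<oplus>\<^bsub>direct_sum K N\<^esub> g \<in> carrier (direct_sum K N)"
      using mem[OF fg(1)] mem[OF fg(2)] am
      by (auto simp: direct_sum_simps abelian_monoid.a_closed cong: conj_cong)
    show "f \<oplus>\<^bsub>direct_sum K N\<^esub> g = g \<oplus>\<^bsub>direct_sum K N\<^esub> f"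
      using mem[OF fg(1)] mem[OF fg(2)] am
      by (auto simp: simps abelian_monoid.a_comm intro!: restrict_ext)
  next
    fix f g h
    assume fgh: "f \<in> carrier (direct_sum K N)" "g \<in> carrier (direct_sum K N)" "h \<in> carrier (direct_sum K N)"
    show "f \<oplus>\<^bsub>direct_sum K N\<^esub> g \<oplus>\<^bsub>direct_sum K N\<^esub> h = f \<oplus>\<^bsub>direct_sum K N\<^esub> (g \<oplus>\<^bsub>direct_sum K N\<^esub> h)"
      using mem[OF fgh(1)] mem[OF fgh(2)] mem[OF fgh(3)] am
      by (auto simp: simps abelian_monoid.a_assoc intro!: restrict_ext)
  next
    fix f assume f: "f \<in> carrier (direct_sum K N)"
    then have ext: "f \<in> extensional K" by (auto simp: direct_sum_simps PiE_def)
    show "\<zero>\<^bsub>direct_sum K N\<^esub> \<oplus>\<^bsub>direct_sum K N\<^esub> f = f"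
      by (rule extensionalityI[of _ K]) (use mem[OF f] am ext in \<open>auto simp: simps abelian_monoid.l_zero\<close>)
    show "\<one>\<^bsub>R\<^esub> \<odot>\<^bsub>direct_sum K N\<^esub> f = f"
      by (rule extensionalityI[of _ K])
        (use mem[OF f] assms(2) ext in \<open>auto simp: simps left_module.smult_one[OF assms(2)]\<close>)
    let ?g = "\<lambda>k\<in>K. \<ominus>\<^bsub>N k\<^esub> f k"
    have fin: "finite {k \<in> K. f k \<noteq> \<zero>\<^bsub>N k\<^esub>}" using f by (simp add: direct_sum_simps)
    have "finite {k \<in> K. ?g k \<noteq> \<zero>\<^bsub>N k\<^esub>}"
      by (rule rev_finite_subset[OF fin]) (auto simp: left_module_minus_zero[OF assms(2)])
    then have "?g \<in> carrier (direct_sum K N)"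
      using mem[OF f] ag by (auto simp: direct_sum_simps abelian_group.a_inv_closed)
    moreover have "?g \<oplus>\<^bsub>direct_sum K N\<^esub> f = \<zero>\<^bsub>direct_sum K N\<^esub>"
      using mem[OF f] ag by (auto simp: simps abelian_group.l_neg intro!: restrict_ext)
    ultimately show "\<exists>g\<in>carrier (direct_sum K N). g \<oplus>\<^bsub>direct_sum K N\<^esub> f = \<zero>\<^bsub>direct_sum K N\<^esub>"
      by blast
  next
    fix r f assume r: "r \<in> carrier R" and f: "f \<in> carrier (direct_sum K N)"
    have fin: "finite {k \<in> K. f k \<noteq> \<zero>\<^bsub>N k\<^esub>}" using f by (simp add: direct_sum_simps)
    have "finite {k \<in> K. r \<odot>\<^bsub>N k\<^esub> f k \<noteq> \<zero>\<^bsub>N k\<^esub>}"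
      by (rule rev_finite_subset[OF fin]) (auto simp: left_module_smult_r_zero[OF assms(2) r])
    then show "r \<odot>\<^bsub>direct_sum K N\<^esub> f \<in> carrier (direct_sum K N)"
      using mem[OF f] r assms(2)
      by (auto simp: direct_sum_simps left_module.smult_closed[OF assms(2)] cong: conj_cong)
  next
    fix a b f assume ab: "a \<in> carrier R" "b \<in> carrier R" and f: "f \<in> carrier (direct_sum K N)"
    show "(a \<oplus>\<^bsub>R\<^esub> b) \<odot>\<^bsub>direct_sum K N\<^esub> f
        = a \<odot>\<^bsub>direct_sum K N\<^esub> f \<oplus>\<^bsub>direct_sum K N\<^esub> b \<odot>\<^bsub>direct_sum K N\<^esub> f"
      using mem[OF f] assms(2) ab
      by (auto simp: simps left_module.smult_l_distr[OF assms(2)] intro!: restrict_ext)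
    show "(a \<otimes>\<^bsub>R\<^esub> b) \<odot>\<^bsub>direct_sum K N\<^esub> f = a \<odot>\<^bsub>direct_sum K N\<^esub> (b \<odot>\<^bsub>direct_sum K N\<^esub> f)"
      using mem[OF f] assms(2) ab
      by (auto simp: simps left_module.smult_assoc[OF assms(2)] intro!: restrict_ext)
  next
    fix a f g assume a: "a \<in> carrier R"
      and fg: "f \<in> carrier (direct_sum K N)" "g \<in> carrier (direct_sum K N)"
    show "a \<odot>\<^bsub>direct_sum K N\<^esub> (f \<oplus>\<^bsub>direct_sum K N\<^esub> g)
        = a \<odot>\<^bsub>direct_sum K N\<^esub> f \<oplus>\<^bsub>direct_sum K N\<^esub> a \<odot>\<^bsub>direct_sum K N\<^esub> g"
      using mem[OF fg(1)] mem[OF fg(2)] assms(2) a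
      by (auto simp: simps left_module.smult_r_distr[OF assms(2)] intro!: restrict_ext)
  qed
qed

text \<open>Restricted to \<open>K\<close> because the elements of a direct sum are extensional
  functions.\<close>

definition summand_inj :: "'k set \<Rightarrow> ('k \<Rightarrow> ('a, 'b) module) \<Rightarrow> 'k \<Rightarrow> 'b \<Rightarrow> 'k \<Rightarrow> 'b"
  where "summand_inj K N k n = (\<lambda>j\<in>K. if j = k then n else \<zero>\<^bsub>N j\<^esub>)"

lemma summand_inj_hom:
  assumes "\<And>k. k \<in> K \<Longrightarrow> left_module R (N k)" "k \<in> K"
  shows "summand_inj K N k \<in> module_hom R (N k) (direct_sum K N)"
proof -
  have am: "abelian_monoid (N k)" if "k \<in> K" for k
    using assms(1)[OF that, THEN left_module_abelian_group] by (simp add: abelian_group_def)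
  have fin: "finite {j \<in> K. (if j = k then n else \<zero>\<^bsub>N j\<^esub>) \<noteq> \<zero>\<^bsub>N j\<^esub>}" for n
    by (rule finite_subset[of _ "{k}"]) auto
  have fin': "finite {j \<in> K. (\<lambda>j\<in>K. if j = k then n else \<zero>\<^bsub>N j\<^esub>) j \<noteq> \<zero>\<^bsub>N j\<^esub>}" for n
    by (rule rev_finite_subset[OF fin[of n]]) auto
  show ?thesis
  proof (rule module_homI)
    fix n assume "n \<in> carrier (N k)"
    then show "summand_inj K N k n \<in> carrier (direct_sum K N)"
      using fin' am by (auto simp: summand_inj_def direct_sum_simps abelian_monoid.zero_closed)
  qed (use am assms in \<open>auto simp: summand_inj_def direct_sum_simps abelian_monoid.l_zero
      abelian_monoid.zero_closed left_module_smult_r_zero[OF assms(1)] intro!: restrict_ext\<close>)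
qed

text \<open>Induction on the finite support: an element is a sum of images of summands.\<close>

lemma direct_sum_induct:
  assumes m: "m \<in> carrier (direct_sum K N)" and N: "\<And>k. k \<in> K \<Longrightarrow> left_module R (N k)"
    and zero: "P \<zero>\<^bsub>direct_sum K N\<^esub>"
    and inj: "\<And>k n. \<lbrakk>k \<in> K; n \<in> carrier (N k)\<rbrakk> \<Longrightarrow> P (summand_inj K N k n)"
    and add: "\<And>a b. \<lbrakk>a \<in> carrier (direct_sum K N); b \<in> carrier (direct_sum K N); P a; P b\<rbrakk>
      \<Longrightarrow> P (a \<oplus>\<^bsub>direct_sum K N\<^esub> b)"
  shows "P m"
proof -
  have am: "abelian_monoid (N k)" if "k \<in> K" for k
    using N[OF that, THEN left_module_abelian_group] by (simp add: abelian_group_def)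
  define S where "S = {k \<in> K. m k \<noteq> \<zero>\<^bsub>N k\<^esub>}"
  have "finite S" using m by (simp add: S_def direct_sum_simps)
  then show ?thesis using m S_def
  proof (induction S arbitrary: m rule: finite_induct)
    case empty
    have "m = \<zero>\<^bsub>direct_sum K N\<^esub>"
      by (rule extensionalityI[of _ K]) (use empty in \<open>auto simp: direct_sum_simps PiE_def\<close>)
    then show ?case using zero by simp
  next
    case (insert k S)
    have kK: "k \<in> K" using insert.prems by blast
    \<comment> \<open>Erases the coordinate \<open>k\<close>, so that the support shrinks to
      \<open>S\<close>; the erased part is restored by adding the image of
      \<open>m k\<close>.\<close>
    define m' where "m' = (\<lambda>j\<in>K. if j = k then \<zero>\<^bsub>N j\<^esub> else m j)"
    have mem: "m j \<in> carrier (N j)" if "j \<in> K" for j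
      using insert.prems that by (auto simp: direct_sum_simps)
    have S: "S = {j \<in> K. m' j \<noteq> \<zero>\<^bsub>N j\<^esub>}"
      using insert by (auto simp: m'_def)
    have m': "m' \<in> carrier (direct_sum K N)"
      using insert.hyps(1) mem am S by (auto simp: direct_sum_simps m'_def abelian_monoid.zero_closed)
    have "P m'" by (rule insert.IH[OF m' S])
    moreover have "P (summand_inj K N k (m k))" using inj[OF kK mem[OF kK]] .
    moreover have "summand_inj K N k (m k) \<in> carrier (direct_sum K N)"
      by (rule module_hom_closed[OF summand_inj_hom[where N = N, OF N kK] mem[OF kK]])
    ultimately have "P (summand_inj K N k (m k) \<oplus>\<^bsub>direct_sum K N\<^esub> m')"
      using add m' by blast
    moreover have "summand_inj K N k (m k) \<oplus>\<^bsub>direct_sum K N\<^esub> m' = m"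
      by (rule extensionalityI[of _ K])
        (use insert.prems mem am in \<open>auto simp: direct_sum_simps PiE_def summand_inj_def m'_def
          abelian_monoid.l_zero abelian_monoid.r_zero\<close>)
    ultimately show ?case by simp
  qed
qed

text \<open>The uniqueness half of the universal property; it reduces commutativity of squares out
  of a direct sum to single summands.\<close>

lemma module_hom_direct_sum_eqI:
  assumes "ring R" "\<And>k. k \<in> K \<Longrightarrow> left_module R (N k)" "left_module R M"
    and "f \<in> module_hom R (direct_sum K N) M" "g \<in> module_hom R (direct_sum K N) M"
    and "\<And>k n. \<lbrakk>k \<in> K; n \<in> carrier (N k)\<rbrakk> \<Longrightarrow> f (summand_inj K N k n) = g (summand_inj K N k n)"
    and "m \<in> carrier (direct_sum K N)"
  shows "f m = g m"
proof -
  have ds: "left_module R (direct_sum K N)"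
    by (rule left_module_direct_sum[OF assms(1,2)])
  show ?thesis
    by (rule direct_sum_induct[where P = "\<lambda>m. f m = g m", OF assms(7) assms(2)])
      (simp_all add: assms(6) module_hom_add[OF assms(4)] module_hom_add[OF assms(5)]
        module_hom_zero[OF assms(4) ds assms(3)] module_hom_zero[OF assms(5) ds assms(3)])
qed

text \<open>The copairing of the maps \<open>g k\<close>. The sum runs over the support, since the
  sum over an infinite \<open>K\<close> would have no meaning.\<close>

definition sum_map ::
  "'k set \<Rightarrow> ('k \<Rightarrow> ('a, 'b) module) \<Rightarrow> ('a, 'm) module \<Rightarrow> ('k \<Rightarrow> 'b \<Rightarrow> 'm) \<Rightarrow> ('k \<Rightarrow> 'b) \<Rightarrow> 'm"
  where "sum_map K N M g m = (\<Oplus>\<^bsub>M\<^esub>k\<in>{k \<in> K. m k \<noteq> \<zero>\<^bsub>N k\<^esub>}. g k (m k))"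

text \<open>The index set of the sum varies with \<open>m\<close>, which obstructs additivity.
  Indices off the support contribute \<open>g k 0 = 0\<close>, so by \<open>eq\<close> the support
  may be replaced by any finite superset in \<open>K\<close>, and two elements are compared over the
  union of their supports.\<close>

lemma sum_map_hom:
  assumes N: "\<And>k. k \<in> K \<Longrightarrow> left_module R (N k)" and M: "left_module R M"
    and g: "\<And>k. k \<in> K \<Longrightarrow> g k \<in> module_hom R (N k) M"
  shows "sum_map K N M g \<in> module_hom R (direct_sum K N) M"
    and "\<lbrakk>k \<in> K; n \<in> carrier (N k)\<rbrakk> \<Longrightarrow> sum_map K N M g (summand_inj K N k n) = g k n"
proof -
  interpret M: left_module R M by fact
  have am: "abelian_monoid (N k)" if "k \<in> K" for k
    using N[OF that, THEN left_module_abelian_group] by (simp add: abelian_group_def)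
  have g0: "g k \<zero>\<^bsub>N k\<^esub> = \<zero>\<^bsub>M\<^esub>" if "k \<in> K" for k
    by (rule module_hom_zero[OF g[OF that] N[OF that] M])
  have eq: "sum_map K N M g m = (\<Oplus>\<^bsub>M\<^esub>k\<in>F. g k (m k))"
    if "finite F" "F \<subseteq> K" "{k \<in> K. m k \<noteq> \<zero>\<^bsub>N k\<^esub>} \<subseteq> F" "\<And>k. k \<in> K \<Longrightarrow> m k \<in> carrier (N k)" for m F
    unfolding sum_map_def
    by (rule M.M.add.finprod_mono_neutral_cong_left)
      (use that g0 module_hom_closed[OF g] in auto)
  have mem: "f k \<in> carrier (N k)" if "f \<in> carrier (direct_sum K N)" "k \<in> K" for f k
    using that by (auto simp: direct_sum_simps)
  have fin: "finite {k \<in> K. f k \<noteq> \<zero>\<^bsub>N k\<^esub>}" if "f \<in> carrier (direct_sum K N)" for f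
    using that by (simp add: direct_sum_simps)
  have ds: "left_module R (direct_sum K N)"
    by (rule left_module_direct_sum[where N = N, OF left_module_ring[OF M] N])
  interpret S: left_module R "direct_sum K N" by (rule ds)
  show "sum_map K N M g \<in> module_hom R (direct_sum K N) M"
  proof (rule module_homI)
    fix x assume "x \<in> carrier (direct_sum K N)"
    then show "sum_map K N M g x \<in> carrier M"
      unfolding sum_map_def
      by (intro M.M.finsum_closed) (auto simp: mem module_hom_closed[OF g])
  next
    fix x y assume x: "x \<in> carrier (direct_sum K N)" and y: "y \<in> carrier (direct_sum K N)"
    define F where "F = {k \<in> K. x k \<noteq> \<zero>\<^bsub>N k\<^esub>} \<union> {k \<in> K. y k \<noteq> \<zero>\<^bsub>N k\<^esub>}"
    have F: "finite F" "F \<subseteq> K" using fin[OF x] fin[OF y] by (auto simp: F_def)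
    let ?z = "x \<oplus>\<^bsub>direct_sum K N\<^esub> y"
    have z: "?z \<in> carrier (direct_sum K N)" using x y by (rule S.M.a_closed)
    have "sum_map K N M g ?z = (\<Oplus>\<^bsub>M\<^esub>k\<in>F. g k (?z k))"
      by (rule eq[OF F])
        (use mem[OF z] am in \<open>auto simp: F_def direct_sum_simps abelian_monoid.l_zero abelian_monoid.zero_closed\<close>)
    also have "\<dots> = (\<Oplus>\<^bsub>M\<^esub>k\<in>F. g k (x k) \<oplus>\<^bsub>M\<^esub> g k (y k))"
      by (rule M.M.finsum_cong') (use F(2) in \<open>auto simp: direct_sum_simps(3) mem[OF x] mem[OF y]
        module_hom_closed[OF g] module_hom_add[OF g] subset_iff\<close>)
    also have "\<dots> = (\<Oplus>\<^bsub>M\<^esub>k\<in>F. g k (x k)) \<oplus>\<^bsub>M\<^esub> (\<Oplus>\<^bsub>M\<^esub>k\<in>F. g k (y k))"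
      by (rule M.M.finsum_addf) (use F(2) in \<open>auto simp: mem[OF x] mem[OF y] module_hom_closed[OF g] subset_iff\<close>)
    also have "(\<Oplus>\<^bsub>M\<^esub>k\<in>F. g k (x k)) = sum_map K N M g x"
      by (rule eq[OF F, symmetric]) (auto simp: F_def mem[OF x])
    also have "(\<Oplus>\<^bsub>M\<^esub>k\<in>F. g k (y k)) = sum_map K N M g y"
      by (rule eq[OF F, symmetric]) (auto simp: F_def mem[OF y])
    finally show "sum_map K N M g ?z = sum_map K N M g x \<oplus>\<^bsub>M\<^esub> sum_map K N M g y" .
  next
    fix r x assume r: "r \<in> carrier R" and x: "x \<in> carrier (direct_sum K N)"
    define F where "F = {k \<in> K. x k \<noteq> \<zero>\<^bsub>N k\<^esub>}"
    have F: "finite F" "F \<subseteq> K" using fin[OF x] by (auto simp: F_def)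
    let ?z = "r \<odot>\<^bsub>direct_sum K N\<^esub> x"
    have z: "?z \<in> carrier (direct_sum K N)" using r x by (rule S.smult_closed)
    have sum: "(\<Oplus>\<^bsub>M\<^esub>k\<in>G. r \<odot>\<^bsub>M\<^esub> h k) = r \<odot>\<^bsub>M\<^esub> (\<Oplus>\<^bsub>M\<^esub>k\<in>G. h k)"
      if "finite G" "h \<in> G \<rightarrow> carrier M" for G :: "'k set" and h
      using that by (induction G rule: finite_induct)
        (auto simp: left_module_smult_r_zero[OF M r] M.smult_r_distr r Pi_iff)
    have "sum_map K N M g ?z = (\<Oplus>\<^bsub>M\<^esub>k\<in>F. g k (?z k))"
      by (rule eq[OF F])
        (use mem[OF z] in \<open>auto simp: F_def direct_sum_simps left_module_smult_r_zero[OF N r]\<close>)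
    also have "\<dots> = (\<Oplus>\<^bsub>M\<^esub>k\<in>F. r \<odot>\<^bsub>M\<^esub> g k (x k))"
      by (rule M.M.finsum_cong') (use F(2) r in \<open>auto simp: direct_sum_simps(4) mem[OF x]
        module_hom_closed[OF g] module_hom_smult[OF g] subset_iff\<close>)
    also have "\<dots> = r \<odot>\<^bsub>M\<^esub> (\<Oplus>\<^bsub>M\<^esub>k\<in>F. g k (x k))"
      by (rule sum[OF F(1)]) (use F(2) in \<open>auto simp: mem[OF x] module_hom_closed[OF g] subset_iff\<close>)
    also have "(\<Oplus>\<^bsub>M\<^esub>k\<in>F. g k (x k)) = sum_map K N M g x"
      by (simp add: F_def sum_map_def)
    finally show "sum_map K N M g ?z = r \<odot>\<^bsub>M\<^esub> sum_map K N M g x" .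
  qed
  show "sum_map K N M g (summand_inj K N k n) = g k n" if "k \<in> K" "n \<in> carrier (N k)"
  proof -
    have "sum_map K N M g (summand_inj K N k n) = (\<Oplus>\<^bsub>M\<^esub>j\<in>{k}. g j (summand_inj K N k n j))"
      by (rule eq) (use that am in \<open>auto simp: summand_inj_def abelian_monoid.zero_closed split: if_splits\<close>)
    also have "\<dots> = g k n"
      using that module_hom_closed[OF g] by (simp add: summand_inj_def)
    finally show ?thesis .
  qed
qed

lemma summation_map_eq: "summation_map K Y = sum_map K (\<lambda>_. Y) Y (\<lambda>_ y. y)"
  by (auto simp: summation_map_def sum_map_def)

lemma direct_sum_map_hom:
  assumes "\<And>k. k \<in> K \<Longrightarrow> left_module R (N k)" "\<And>k. k \<in> K \<Longrightarrow> left_module R (N' k)"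
    and h: "\<And>k. k \<in> K \<Longrightarrow> h k \<in> module_hom R (N k) (N' k)"
  shows "(\<lambda>f. \<lambda>k\<in>K. h k (f k)) \<in> module_hom R (direct_sum K N) (direct_sum K N')"
proof -
  have mem: "f k \<in> carrier (N k)" if "f \<in> carrier (direct_sum K N)" "k \<in> K" for f k
    using that by (auto simp: direct_sum_simps)
  have h0: "h k \<zero>\<^bsub>N k\<^esub> = \<zero>\<^bsub>N' k\<^esub>" if "k \<in> K" for k
    using that by (intro module_hom_zero[OF h] assms)
  show ?thesis
  proof (rule module_homI)
    fix f assume f: "f \<in> carrier (direct_sum K N)"
    have "finite {k \<in> K. f k \<noteq> \<zero>\<^bsub>N k\<^esub>}" using f by (simp add: direct_sum_simps)
    then have "finite {k \<in> K. (\<lambda>k\<in>K. h k (f k)) k \<noteq> \<zero>\<^bsub>N' k\<^esub>}"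
      by (rule rev_finite_subset) (auto simp: h0)
    then show "(\<lambda>k\<in>K. h k (f k)) \<in> carrier (direct_sum K N')"
      using mem[OF f] by (auto simp: direct_sum_simps module_hom_closed[OF h])
  next
    fix f g assume fg: "f \<in> carrier (direct_sum K N)" "g \<in> carrier (direct_sum K N)"
    show "(\<lambda>k\<in>K. h k ((f \<oplus>\<^bsub>direct_sum K N\<^esub> g) k))
        = (\<lambda>k\<in>K. h k (f k)) \<oplus>\<^bsub>direct_sum K N'\<^esub> (\<lambda>k\<in>K. h k (g k))"
      using mem[OF fg(1)] mem[OF fg(2)]
      by (auto simp: direct_sum_simps module_hom_add[OF h] intro!: restrict_ext)
  next
    fix r f assume r: "r \<in> carrier R" and f: "f \<in> carrier (direct_sum K N)"
    show "(\<lambda>k\<in>K. h k ((r \<odot>\<^bsub>direct_sum K N\<^esub> f) k))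
        = r \<odot>\<^bsub>direct_sum K N'\<^esub> (\<lambda>k\<in>K. h k (f k))"
      using mem[OF f] r
      by (auto simp: direct_sum_simps module_hom_smult[OF h] intro!: restrict_ext)
  qed
qed

text \<open>Exactness is coordinatewise; the point that needs care is that preimages chosen
  coordinate by coordinate have finite support again.\<close>

lemma short_exact_direct_sum_seq:
  assumes "ring R" and se: "\<And>k. k \<in> K \<Longrightarrow> short_exact R (A k) (E k) (X k)"
  shows "short_exact R (direct_sum K A) (direct_sum_seq K E) (direct_sum K X)"
proof -
  define a where "a k = fst (E k)" for k
  define N where "N = (\<lambda>k. fst (snd (E k)))"
  define b where "b k = snd (snd (E k))" for k
  have seq: "direct_sum_seq K E = (\<lambda>f. \<lambda>k\<in>K. a k (f k), direct_sum K N, \<lambda>g. \<lambda>k\<in>K. b k (g k))"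
    by (simp add: direct_sum_seq_def a_def N_def b_def)
  have se': "short_exact R (A k) (a k, N k, b k) (X k)" if "k \<in> K" for k
    using se[OF that] by (simp add: a_def N_def b_def)
  note D = short_exactD[OF se']
  have am: "abelian_monoid (A k)" "abelian_monoid (N k)" if "k \<in> K" for k
    using D(1,2)[OF that, THEN left_module_abelian_group] by (simp_all add: abelian_group_def)
  have a0: "a k \<zero>\<^bsub>A k\<^esub> = \<zero>\<^bsub>N k\<^esub>" if "k \<in> K" for k
    by (rule module_hom_zero[OF D(4,1,2)[OF that]])
  have b0: "b k \<zero>\<^bsub>N k\<^esub> = \<zero>\<^bsub>X k\<^esub>" if "k \<in> K" for k
    by (rule module_hom_zero[OF D(5,2,3)[OF that]])
  show ?thesis
    unfolding seq
  proof (rule short_exactI)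
    show "left_module R (direct_sum K A)" "left_module R (direct_sum K N)" "left_module R (direct_sum K X)"
      by (rule left_module_direct_sum[OF assms(1)], erule D)+
    show "(\<lambda>f. \<lambda>k\<in>K. a k (f k)) \<in> module_hom R (direct_sum K A) (direct_sum K N)"
      by (rule direct_sum_map_hom; erule D)
    show "(\<lambda>g. \<lambda>k\<in>K. b k (g k)) \<in> module_hom R (direct_sum K N) (direct_sum K X)"
      by (rule direct_sum_map_hom; erule D)
  next
    fix y assume y: "y \<in> carrier (direct_sum K A)" "(\<lambda>k\<in>K. a k (y k)) = \<zero>\<^bsub>direct_sum K N\<^esub>"
    have "y k = \<zero>\<^bsub>A k\<^esub>" if k: "k \<in> K" for k
    proof (rule inj_onD[OF D(6)[OF k]])
      show "a k (y k) = a k \<zero>\<^bsub>A k\<^esub>"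
        using fun_cong[OF y(2), of k] k a0 by (simp add: direct_sum_simps)
    qed (use y(1) k am(1) in \<open>auto simp: direct_sum_simps abelian_monoid.zero_closed\<close>)
    then show "y = \<zero>\<^bsub>direct_sum K A\<^esub>"
      using y(1) by (intro extensionalityI[of _ K]) (auto simp: direct_sum_simps PiE_def)
  next
    fix y assume y: "y \<in> carrier (direct_sum K A)"
    then show "(\<lambda>k\<in>K. b k ((\<lambda>k\<in>K. a k (y k)) k)) = \<zero>\<^bsub>direct_sum K X\<^esub>"
      using D(7) by (auto simp: direct_sum_simps PiE_def Pi_iff intro!: restrict_ext)
  next
    fix g assume g: "g \<in> carrier (direct_sum K N)" "(\<lambda>k\<in>K. b k (g k)) = \<zero>\<^bsub>direct_sum K X\<^esub>"
    define y where "y = (\<lambda>k\<in>K. inv_into (carrier (A k)) (a k) (g k))"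
    have *: "y k \<in> carrier (A k) \<and> a k (y k) = g k" if k: "k \<in> K" for k
    proof -
      have "b k (g k) = \<zero>\<^bsub>X k\<^esub>" using fun_cong[OF g(2), of k] k by (simp add: direct_sum_simps)
      then obtain z where "z \<in> carrier (A k)" "g k = a k z"
        using D(8)[OF k, of "g k"] g(1) k by (auto simp: direct_sum_simps)
      then show ?thesis
        using D(6)[OF k] k by (simp add: y_def)
    qed
    \<comment> \<open>Where \<open>g\<close> vanishes, injectivity of \<open>a k\<close> makes the
      preimage vanish, so the support of \<open>y\<close> lies in that of \<open>g\<close>.\<close>
    have y0: "y k = \<zero>\<^bsub>A k\<^esub>" if k: "k \<in> K" "g k = \<zero>\<^bsub>N k\<^esub>" for k
      by (rule inj_onD[OF D(6)[OF k(1)]])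
        (use * k a0 am(1) in \<open>auto simp: abelian_monoid.zero_closed\<close>)
    have "finite {k \<in> K. g k \<noteq> \<zero>\<^bsub>N k\<^esub>}" using g(1) by (simp add: direct_sum_simps)
    then have "finite {k \<in> K. y k \<noteq> \<zero>\<^bsub>A k\<^esub>}"
      by (rule rev_finite_subset) (auto simp: y0)
    moreover have "y \<in> extensional K" by (simp add: y_def)
    ultimately have "y \<in> carrier (direct_sum K A)"
      using * by (auto simp: direct_sum_simps PiE_def)
    moreover have "g = (\<lambda>k\<in>K. a k (y k))"
      using g(1) * by (intro extensionalityI[of _ K]) (auto simp: direct_sum_simps PiE_def)
    ultimately show "\<exists>y\<in>carrier (direct_sum K A). g = (\<lambda>k\<in>K. a k (y k))" by blast
  next
    fix x assume x: "x \<in> carrier (direct_sum K X)"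
    \<comment> \<open>The lift of zero is required to be zero; arbitrary lifts could have infinite
      support.\<close>
    have "\<exists>m. m \<in> carrier (N k) \<and> b k m = x k \<and> (x k = \<zero>\<^bsub>X k\<^esub> \<longrightarrow> m = \<zero>\<^bsub>N k\<^esub>)" if k: "k \<in> K" for k
    proof (cases "x k = \<zero>\<^bsub>X k\<^esub>")
      case True
      then show ?thesis using k b0 am(2) by (auto simp: abelian_monoid.zero_closed)
    next
      case False
      then show ?thesis using D(9)[OF k, of "x k"] x k by (auto simp: direct_sum_simps)
    qed
    then obtain m where m: "\<forall>k\<in>K. m k \<in> carrier (N k) \<and> b k (m k) = x k \<and> (x k = \<zero>\<^bsub>X k\<^esub> \<longrightarrow> m k = \<zero>\<^bsub>N k\<^esub>)"
      by metis
    have "finite {k \<in> K. x k \<noteq> \<zero>\<^bsub>X k\<^esub>}" using x by (simp add: direct_sum_simps)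
    then have "finite {k \<in> K. restrict m K k \<noteq> \<zero>\<^bsub>N k\<^esub>}"
      by (rule rev_finite_subset) (use m in auto)
    then have "restrict m K \<in> carrier (direct_sum K N)"
      using m by (auto simp: direct_sum_simps)
    moreover have "(\<lambda>k\<in>K. b k (restrict m K k)) = x"
      using m x by (intro extensionalityI[of _ K]) (auto simp: direct_sum_simps PiE_def)
    ultimately show "\<exists>g\<in>carrier (direct_sum K N). (\<lambda>k\<in>K. b k (g k)) = x" by blast
  qed
qed

text \<open>\<open>U\<close> is the universal sequence ending in the direct sum that receives all
  the \<open>B k\<close> over the inclusions. The map from \<open>B k\<close> is the identity on
  \<open>Y\<close> because summation undoes the inclusion of the summand \<open>k\<close>. The third
  fact is what makes a sequence ending in the direct sum determined by its pull-backs along the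
  inclusions.\<close>

lemma pushout_direct_sum_facts:
  assumes "left_module R Y" and B: "\<And>k. k \<in> K \<Longrightarrow> short_exact R Y (B k) (X k)"
  defines "U \<equiv> pushout_seq (direct_sum K (\<lambda>_. Y)) (summation_map K Y) Y (direct_sum_seq K B)"
  shows short_exact_pushout_direct_sum: "short_exact R Y U (direct_sum K X)"
    and seq_map_pushout_direct_sum:
      "k \<in> K \<Longrightarrow> seq_map R Y (B k) U (\<lambda>y. y) (summand_inj K X k)"
    and seq_map_from_pushout_direct_sum:
      "\<lbrakk>short_exact R Y E (direct_sum K X);
        \<And>k. k \<in> K \<Longrightarrow> seq_map R Y (B k) E (\<lambda>y. y) (summand_inj K X k)\<rbrakk>
      \<Longrightarrow> seq_map R Y U E (\<lambda>y. y) (\<lambda>x. x)"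
proof -
  have ring: "ring R" using assms(1) by (rule left_module_ring)
  define a where "a k = fst (B k)" for k
  define N where "N = (\<lambda>k. fst (snd (B k)))"
  define b where "b k = snd (snd (B k))" for k
  have Bk: "B k = (a k, N k, b k)" for k by (simp add: a_def N_def b_def)
  have seq: "direct_sum_seq K B = (\<lambda>f. \<lambda>k\<in>K. a k (f k), direct_sum K N, \<lambda>g. \<lambda>k\<in>K. b k (g k))"
    by (simp add: direct_sum_seq_def a_def N_def b_def)
  have se': "short_exact R Y (a k, N k, b k) (X k)" if "k \<in> K" for k
    using B[OF that] by (simp add: Bk)
  note D = short_exactD[OF se']
  have ds: "short_exact R (direct_sum K (\<lambda>_. Y)) (direct_sum_seq K B) (direct_sum K X)"
    using ring B by (rule short_exact_direct_sum_seq)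
  have sm: "summation_map K Y \<in> module_hom R (direct_sum K (\<lambda>_. Y)) Y"
    unfolding summation_map_eq by (rule sum_map_hom) (simp_all add: assms(1) module_hom_ident)
  have sm_inj: "summation_map K Y (summand_inj K (\<lambda>_. Y) k y) = y" if "k \<in> K" "y \<in> carrier Y" for k y
    unfolding summation_map_eq
    by (rule sum_map_hom(2)[where R = R]) (simp_all add: assms(1) module_hom_ident that)
  have a0: "a k \<zero>\<^bsub>Y\<^esub> = \<zero>\<^bsub>N k\<^esub>" if "k \<in> K" for k
    by (rule module_hom_zero[OF D(4,1,2)[OF that]])
  have b0: "b k \<zero>\<^bsub>N k\<^esub> = \<zero>\<^bsub>X k\<^esub>" if "k \<in> K" for k
    by (rule module_hom_zero[OF D(5,2,3)[OF that]])
  have inj_a: "(\<lambda>j\<in>K. a j (summand_inj K (\<lambda>_. Y) k y j)) = summand_inj K N k (a k y)" if "k \<in> K" for k y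
    using a0 that by (auto simp: summand_inj_def intro!: restrict_ext)
  have inj_b: "(\<lambda>j\<in>K. b j (summand_inj K N k n j)) = summand_inj K X k (b k n)" if "k \<in> K" for k n
    using b0 that by (auto simp: summand_inj_def intro!: restrict_ext)
  show "short_exact R Y U (direct_sum K X)"
    unfolding U_def by (rule short_exact_pushout[OF ds assms(1) sm])
  show "seq_map R Y (B k) U (\<lambda>y. y) (summand_inj K X k)" if k: "k \<in> K"
  proof -
    have inj_N: "summand_inj K N k \<in> module_hom R (N k) (direct_sum K N)"
      using D(2) k by (rule summand_inj_hom)
    have inj_Y: "summand_inj K (\<lambda>_. Y) k \<in> module_hom R Y (direct_sum K (\<lambda>_. Y))"
      using summand_inj_hom[of K R "\<lambda>_. Y" k] assms(1) k by simp
    have "seq_map R Y (B k) (direct_sum_seq K B) (summand_inj K (\<lambda>_. Y) k) (summand_inj K X k)"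
      unfolding seq unfolding Bk
      by (rule seq_mapI[OF inj_N]) (simp_all add: inj_a inj_b k)
    then have "seq_map R Y (B k) U (\<lambda>y. summation_map K Y (summand_inj K (\<lambda>_. Y) k y)) (summand_inj K X k)"
      unfolding U_def
      by (rule seq_map_comp[OF _ seq_map_pushout[OF ds assms(1) sm]]) (rule module_hom_closed[OF inj_Y])
    then show ?thesis
      by (rule seq_map_cong[OF B[OF k]]) (simp_all add: sm_inj k)
  qed
  show "seq_map R Y U E (\<lambda>y. y) (\<lambda>x. x)"
    if E': "short_exact R Y E (direct_sum K X)"
      and maps: "\<And>k. k \<in> K \<Longrightarrow> seq_map R Y (B k) E (\<lambda>y. y) (summand_inj K X k)"
  proof -
    obtain \<alpha> M \<beta> where E: "E = (\<alpha>, M, \<beta>)" by (cases E)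
    note DE = short_exactD[OF E'[unfolded E]]
    have "\<exists>g. g \<in> module_hom R (N k) M \<and> (\<forall>y\<in>carrier Y. g (a k y) = \<alpha> y) \<and>
        (\<forall>n\<in>carrier (N k). \<beta> (g n) = summand_inj K X k (b k n))" if "k \<in> K" for k
      using maps[OF that] unfolding E Bk seq_map_def prod.case by blast
    then obtain g where g: "\<forall>k\<in>K. g k \<in> module_hom R (N k) M \<and> (\<forall>y\<in>carrier Y. g k (a k y) = \<alpha> y) \<and>
        (\<forall>n\<in>carrier (N k). \<beta> (g k n) = summand_inj K X k (b k n))"
      by metis
    have g1: "g k \<in> module_hom R (N k) M" if "k \<in> K" for k using g that by blast
    note S = sum_map_hom[of K R N M g, OF D(2) DE(2) g1]
    \<comment> \<open>The copairing of the chosen middle maps. Both squares are compared on single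
      summands, where they are the properties of \<open>g k\<close>.\<close>
    have "seq_map R (direct_sum K (\<lambda>_. Y)) (direct_sum_seq K B) E (summation_map K Y) (\<lambda>x. x)"
      unfolding seq unfolding E
    proof (rule seq_mapI[OF S(1)])
      fix y assume "y \<in> carrier (direct_sum K (\<lambda>_. Y))"
      then show "sum_map K N M g (\<lambda>k\<in>K. a k (y k)) = \<alpha> (summation_map K Y y)"
      proof (rule module_hom_direct_sum_eqI[OF ring, rotated -1])
        show "(\<lambda>y. sum_map K N M g (\<lambda>k\<in>K. a k (y k))) \<in> module_hom R (direct_sum K (\<lambda>_. Y)) M"
          by (rule module_hom_compose[OF direct_sum_map_hom S(1)]) (simp_all add: D assms(1))
        show "(\<lambda>y. \<alpha> (summation_map K Y y)) \<in> module_hom R (direct_sum K (\<lambda>_. Y)) M"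
          by (rule module_hom_compose[OF sm DE(4)])
      qed (use g in \<open>simp_all add: assms(1) DE(2) inj_a sm_inj S(2) module_hom_closed[OF D(4)]\<close>)
    next
      fix m assume "m \<in> carrier (direct_sum K N)"
      then show "\<beta> (sum_map K N M g m) = (\<lambda>k\<in>K. b k (m k))"
      proof (rule module_hom_direct_sum_eqI[OF ring, rotated -1])
        show "(\<lambda>m. \<beta> (sum_map K N M g m)) \<in> module_hom R (direct_sum K N) (direct_sum K X)"
          by (rule module_hom_compose[OF S(1) DE(5)])
        show "(\<lambda>m. \<lambda>k\<in>K. b k (m k)) \<in> module_hom R (direct_sum K N) (direct_sum K X)"
          by (rule direct_sum_map_hom; erule D)
      qed (use g in \<open>simp_all add: D(2) DE(3) inj_b S(2)\<close>)
    qed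
    then show ?thesis
      unfolding U_def by (rule seq_map_from_pushout[OF ds assms(1) sm E'])
  qed
qed

subsection \<open>Homomorphisms from a brick into the direct sum\<close>

lemma left_module_regular:
  assumes "ring R"
  shows "left_module R (regular_module R)"
proof -
  interpret R: ring R by fact
  show ?thesis
    by (rule left_moduleI)
      (auto simp: regular_module_def assms R.a_ac R.l_distr R.r_distr R.m_assoc intro: R.l_neg)
qed

text \<open>Each of the finitely many generators has an image of finite support, and the union of
  these supports works for all of \<open>X\<close>: a coordinate that vanishes on the generators
  vanishes everywhere.\<close>

lemma finitely_presented_hom_finite_support:
  assumes X: "left_module R X" "finitely_presented R X" and N: "\<And>k. k \<in> K \<Longrightarrow> left_module R (N k)"
    and f: "f \<in> module_hom R X (direct_sum K N)"
  obtains F where "finite F" "F \<subseteq> K" "\<forall>x\<in>carrier X. \<forall>k\<in>K - F. f x k = \<zero>\<^bsub>N k\<^esub>"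
proof -
  have ring: "ring R" using X(1) by (rule left_module_ring)
  interpret R: ring R by (rule ring)
  note reg = left_module_regular[OF ring]
  obtain n :: nat and g where
    g: "g \<in> module_hom R (direct_sum {..<n} (\<lambda>_. regular_module R)) X"
    and surj: "g ` carrier (direct_sum {..<n} (\<lambda>_. regular_module R)) = carrier X"
    using X(2) unfolding finitely_presented_def by blast
  let ?P = "direct_sum {..<n} (\<lambda>_. regular_module R)"
  \<comment> \<open>The standard basis vectors of the free module of rank \<open>n\<close>; their
    images under \<open>g\<close> generate \<open>X\<close>.\<close>
  define e where "e j = summand_inj {..<n} (\<lambda>_. regular_module R) j \<one>\<^bsub>R\<^esub>" for j
  have inj: "summand_inj {..<n} (\<lambda>_. regular_module R) j \<in> module_hom R (regular_module R) ?P" if "j < n" for j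
    using summand_inj_hom[of "{..<n}" R "\<lambda>_. regular_module R" j] reg that by simp
  have e: "e j \<in> carrier ?P" if "j < n" for j
    unfolding e_def by (rule module_hom_closed[OF inj[OF that]]) (simp add: regular_module_def)
  have fg: "(\<lambda>v. f (g v)) \<in> module_hom R ?P (direct_sum K N)"
    by (rule module_hom_compose[OF g f])
  define F where "F = (\<Union>j<n. {k \<in> K. f (g (e j)) k \<noteq> \<zero>\<^bsub>N k\<^esub>})"
  have "finite {k \<in> K. f (g (e j)) k \<noteq> \<zero>\<^bsub>N k\<^esub>}" if "j < n" for j
    using module_hom_closed[OF fg e[OF that]] by (simp add: direct_sum_simps)
  then have "finite F" by (auto simp: F_def)
  moreover have "F \<subseteq> K" by (auto simp: F_def)
  moreover have "f x k = \<zero>\<^bsub>N k\<^esub>" if x: "x \<in> carrier X" and k: "k \<in> K - F" for x k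
  proof -
    obtain v where v: "v \<in> carrier ?P" "x = g v" using x surj by blast
    have "(\<lambda>m. m k) \<in> module_hom R (direct_sum K N) (N k)"
      using k by (intro module_homI) (auto simp: direct_sum_simps)
    then have \<phi>: "(\<lambda>v. f (g v) k) \<in> module_hom R ?P (N k)"
      by (rule module_hom_compose[OF fg])
    have Nk: "left_module R (N k)" using N k by blast
    have "f (g v) k = \<zero>\<^bsub>N k\<^esub>"
    proof (rule module_hom_direct_sum_eqI[OF ring reg Nk \<phi> module_hom_const_zero[OF Nk] _ v(1)])
      fix j r assume j: "j \<in> {..<n}" and r: "r \<in> carrier (regular_module R)"
      have "summand_inj {..<n} (\<lambda>_. regular_module R) j r = r \<odot>\<^bsub>?P\<^esub> e j"
        using module_hom_smult[OF inj, of j r "\<one>\<^bsub>R\<^esub>"] j r by (simp add: e_def regular_module_def)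
      moreover have "f (g (e j)) k = \<zero>\<^bsub>N k\<^esub>" using j k by (auto simp: F_def)
      ultimately show "f (g (summand_inj {..<n} (\<lambda>_. regular_module R) j r)) k = \<zero>\<^bsub>N k\<^esub>"
        using module_hom_smult[OF \<phi>, of r "e j"] j r e left_module_smult_r_zero[OF Nk]
        by (simp add: regular_module_def)
    qed
    then show ?thesis by (simp add: v(2))
  qed
  ultimately show ?thesis by (intro that) blast+
qed

text \<open>The pull-back consults \<open>f\<close> only on the carrier of \<open>X\<close>, so the
  two sequences are equal and not merely equivalent.\<close>

lemma connecting_hom_cong:
  assumes "\<And>x. x \<in> carrier X \<Longrightarrow> f x = g x"
  shows "connecting_hom R Y E X f = connecting_hom R Y E X g"
proof -
  have "pullback_seq E X f = pullback_seq E X g"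
    using assms by (auto simp: pullback_seq_def intro!: arg_cong[of _ _ "submodule_of _"] split: prod.splits)
  then show ?thesis by (simp add: connecting_hom_apply)
qed

text \<open>The sum over \<open>i\<close> in \<open>F\<close> of \<open>a i\<close> followed by the
  inclusion of the summand \<open>(X, i)\<close>, written in coordinates. The closed form allows the
  coefficients to be read off directly.\<close>

definition combination ::
  "('a, 'x) module set \<Rightarrow> (('a, 'x) module \<Rightarrow> 'i set) \<Rightarrow> ('a, 'x) module \<Rightarrow> 'i set
    \<Rightarrow> ('i \<Rightarrow> 'x \<Rightarrow> 'x) \<Rightarrow> 'x \<Rightarrow> ('a, 'x) module \<times> 'i \<Rightarrow> 'x"
  where "combination \<X> I X F a x =
    (\<lambda>k\<in>Sigma \<X> I. if fst k = X \<and> snd k \<in> F then a (snd k) x else \<zero>\<^bsub>fst k\<^esub>)"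

lemma copower_sum_eq: "copower_sum \<X> I = direct_sum (Sigma \<X> I) fst"
  by (simp add: copower_sum_def case_prod_unfold)

lemma End_carrier: "a \<in> carrier (End_ring R X) \<longleftrightarrow> a \<in> module_hom R X X \<and> a \<in> extensional (carrier X)"
  by (simp add: End_ring_def)

text \<open>Both claims go into one induction on \<open>F\<close>, because additivity of \<delta>
  can be applied only to maps already known to be homomorphisms. The values \<open>c i\<close> are
  given separately so that they can later be classes of chosen extensions.\<close>

lemma combination_hom:
  assumes mods: "\<And>X. X \<in> \<X> \<Longrightarrow> left_module R X" and X: "X \<in> \<X>"
    and E: "short_exact R Y E (copower_sum \<X> I)"
    and F: "finite F" "F \<subseteq> I X" "a \<in> F \<rightarrow> carrier (End_ring R X)"
    and c: "\<And>i. i \<in> I X \<Longrightarrow> c i = connecting_hom R Y E X (summand_inj (Sigma \<X> I) fst (X, i))"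
  shows "combination \<X> I X F a \<in> module_hom R X (copower_sum \<X> I) \<and>
    connecting_hom R Y E X (combination \<X> I X F a) = (\<Oplus>\<^bsub>Ext R X Y\<^esub>i\<in>F. a i \<odot>\<^bsub>Ext R X Y\<^esub> c i)"
  using F
proof (induction F rule: finite_induct)
  case empty
  have N: "left_module R (copower_sum \<X> I)" using E by (rule short_exact_right)
  interpret EX: abelian_monoid "Ext R X Y"
    using mods[OF X] short_exact_left[OF E] by (rule abelian_monoid_Ext)
  have 0: "combination \<X> I X {} a x = \<zero>\<^bsub>copower_sum \<X> I\<^esub>" for x
    by (auto simp: combination_def copower_sum_eq direct_sum_simps)
  have "combination \<X> I X {} a \<in> module_hom R X (copower_sum \<X> I)"
    by (rule module_hom_cong[OF module_hom_const_zero[OF N] mods[OF X] 0])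
  then show ?case
    using connecting_hom_zero[OF E mods[OF X] 0] by simp
next
  case (insert i F)
  interpret EX: abelian_monoid "Ext R X Y"
    using mods[OF X] short_exact_left[OF E] by (rule abelian_monoid_Ext)
  have N: "left_module R (copower_sum \<X> I)" using E by (rule short_exact_right)
  have fst_mod: "left_module R (fst k)" if "k \<in> Sigma \<X> I" for k
    using mods that by auto
  have iI: "i \<in> I X" using insert.prems by simp
  have inj: "summand_inj (Sigma \<X> I) fst (X, j) \<in> module_hom R X (copower_sum \<X> I)" if "j \<in> I X" for j
    using summand_inj_hom[of "Sigma \<X> I" R fst "(X, j)"] fst_mod X that by (simp add: copower_sum_eq)
  have a: "a j \<in> module_hom R X X" if "j \<in> insert i F" for j
    using insert.prems(2) that by (auto simp: End_carrier)
  have IH: "combination \<X> I X F a \<in> module_hom R X (copower_sum \<X> I)"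
    "connecting_hom R Y E X (combination \<X> I X F a) = (\<Oplus>\<^bsub>Ext R X Y\<^esub>i\<in>F. a i \<odot>\<^bsub>Ext R X Y\<^esub> c i)"
    using insert.IH insert.prems by auto
  have ai: "(\<lambda>x. summand_inj (Sigma \<X> I) fst (X, i) (a i x)) \<in> module_hom R X (copower_sum \<X> I)"
    using a by (intro module_hom_compose[OF _ inj[OF iI]]) simp
  have scal: "a j \<odot>\<^bsub>Ext R X Y\<^esub> c j
      = connecting_hom R Y E X (\<lambda>x. summand_inj (Sigma \<X> I) fst (X, j) (a j x))" if "j \<in> insert i F" for j
    using connecting_hom_smult[OF E mods[OF X] inj a[OF that], of j] that insert.prems(1) c by auto
  have cl: "a j \<odot>\<^bsub>Ext R X Y\<^esub> c j \<in> carrier (Ext R X Y)" if "j \<in> insert i F" for j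
    unfolding scal[OF that]
    using insert.prems(1) that
    by (intro connecting_hom_in_Ext[OF E mods[OF X] module_hom_compose[OF a[OF that] inj]]) auto
  \<comment> \<open>Since \<open>i\<close> is not in \<open>F\<close>, at every coordinate at most
    one of the two terms can be nonzero.\<close>
  have split: "combination \<X> I X (insert i F) a x
      = summand_inj (Sigma \<X> I) fst (X, i) (a i x) \<oplus>\<^bsub>copower_sum \<X> I\<^esub> combination \<X> I X F a x"
    if x: "x \<in> carrier X" for x
  proof -
    have "a j x \<in> carrier X" if "j \<in> insert i F" for j
      using module_hom_closed[OF a[OF that] x] .
    moreover have "abelian_group Z" if "Z \<in> \<X>" for Z
      using mods[OF that] by (rule left_module_abelian_group)
    then have "abelian_monoid Z" if "Z \<in> \<X>" for Z
      using that by (simp add: abelian_group_def)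
    ultimately show ?thesis
      using insert.hyps(2)
      by (auto simp: combination_def copower_sum_eq direct_sum_simps summand_inj_def
          abelian_monoid.l_zero abelian_monoid.r_zero abelian_monoid.zero_closed intro!: restrict_ext)
  qed
  have "combination \<X> I X (insert i F) a \<in> module_hom R X (copower_sum \<X> I)"
    by (rule module_hom_cong[OF module_hom_pointwise_add[OF ai IH(1) N] mods[OF X] split])
  moreover have "connecting_hom R Y E X (combination \<X> I X (insert i F) a)
      = (\<Oplus>\<^bsub>Ext R X Y\<^esub>i\<in>insert i F. a i \<odot>\<^bsub>Ext R X Y\<^esub> c i)"
    using connecting_hom_add[OF E mods[OF X] ai IH(1) split] insert.hyps cl scal IH(2)
    by (subst EX.finsum_insert) auto
  ultimately show ?case ..
qed

text \<open>A coordinate of \<open>f\<close> vanishes for one of two reasons: its index is outside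
  the finite support bound, or it is a map from \<open>X\<close> to another member of the semibrick.
  The coordinates that remain are endomorphisms of \<open>X\<close> and serve as
  coefficients.\<close>

lemma semibrick_hom_combination:
  assumes sb: "semibrick R \<X>" and X: "X \<in> \<X>" and f: "f \<in> module_hom R X (copower_sum \<X> I)"
  obtains F a where "finite F" "F \<subseteq> I X" "a \<in> F \<rightarrow> carrier (End_ring R X)"
    "\<forall>x\<in>carrier X. f x = combination \<X> I X F a x"
proof -
  have mods: "left_module R Z" if "Z \<in> \<X>" for Z
    using sb that by (auto simp: semibrick_def brick_def)
  have fp: "finitely_presented R X"
    using sb X by (auto simp: semibrick_def brick_def)
  let ?K = "Sigma \<X> I"
  have f': "f \<in> module_hom R X (direct_sum ?K fst)" using f by (simp add: copower_sum_eq)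
  have fst_mod: "left_module R (fst k)" if "k \<in> ?K" for k
    using mods that by auto
  obtain F where F: "finite F" "F \<subseteq> ?K" "\<forall>x\<in>carrier X. \<forall>k\<in>?K - F. f x k = \<zero>\<^bsub>fst k\<^esub>"
    by (rule finitely_presented_hom_finite_support[OF mods[OF X] fp fst_mod f'])
  have comp: "(\<lambda>x. f x k) \<in> module_hom R X (fst k)" if "k \<in> ?K" for k
  proof -
    have "(\<lambda>m. m k) \<in> module_hom R (direct_sum ?K fst) (fst k)"
      using that by (intro module_homI) (auto simp: direct_sum_simps)
    then show ?thesis by (rule module_hom_compose[OF f'])
  qed
  have off: "f x k = \<zero>\<^bsub>fst k\<^esub>" if k: "k \<in> ?K" and x: "x \<in> carrier X" and ne: "fst k \<noteq> X" for x k
  proof -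
    \<comment> \<open>The vanishing in \<open>semibrick\<close> concerns extensional homomorphisms,
      so it is applied to the restriction.\<close>
    have "restrict (\<lambda>x. f x k) (carrier X) \<in> carrier (Hom R X (fst k))"
      using module_hom_cong[OF comp[OF k] mods[OF X]] by (simp add: Hom_def)
    moreover have "carrier (Hom R X (fst k)) = {\<zero>\<^bsub>Hom R X (fst k)\<^esub>}"
      using sb X k ne unfolding semibrick_def by (metis SigmaE fst_conv)
    ultimately have "restrict (\<lambda>x. f x k) (carrier X) = \<zero>\<^bsub>Hom R X (fst k)\<^esub>"
      by blast
    then have "restrict (\<lambda>x. f x k) (carrier X) = (\<lambda>x\<in>carrier X. \<zero>\<^bsub>fst k\<^esub>)"
      by (simp add: Hom_def)
    from fun_cong[OF this, of x] show ?thesis using x by simp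
  qed
  define F' where "F' = {i \<in> I X. (X, i) \<in> F}"
  define a where "a i = restrict (\<lambda>x. f x (X, i)) (carrier X)" for i
  have "finite F'"
    by (rule finite_subset[OF _ finite_imageI[OF F(1), of snd]]) (force simp: F'_def)
  moreover have "F' \<subseteq> I X" by (auto simp: F'_def)
  moreover have "a \<in> F' \<rightarrow> carrier (End_ring R X)"
  proof
    fix i assume "i \<in> F'"
    then have "(X, i) \<in> ?K" using X by (auto simp: F'_def)
    then show "a i \<in> carrier (End_ring R X)"
      using module_hom_cong[OF comp[of "(X, i)"], of "a i"] mods[OF X] by (simp add: a_def End_carrier)
  qed
  moreover have "f x = combination \<X> I X F' a x" if x: "x \<in> carrier X" for x
  proof (rule extensionalityI[of _ ?K])
    show "f x \<in> extensional ?K"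
      using module_hom_closed[OF f' x] by (auto simp: direct_sum_simps PiE_def)
    show "combination \<X> I X F' a x \<in> extensional ?K" by (simp add: combination_def)
    fix k assume k: "k \<in> ?K"
    show "f x k = combination \<X> I X F' a x k"
    proof (cases "fst k = X \<and> snd k \<in> F'")
      case True
      then show ?thesis using k x by (cases k) (simp add: combination_def a_def)
    next
      case False
      then have "f x k = \<zero>\<^bsub>fst k\<^esub>"
        using k x off[OF k x] F(3) by (cases "fst k = X"; cases k) (auto simp: F'_def)
      then show ?thesis using False k by (auto simp: combination_def)
    qed
  qed
  ultimately show ?thesis by (intro that) blast+
qed

section \<open>Bijectivity of the connecting map in terms of bases\<close>

text \<open>By \<open>comb\<close>, \<delta> turns a combination of inclusions into the combination
  of the \<open>c i\<close> with the same coefficients, and every map from \<open>X\<close> is such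
  a combination. Independence is then triviality of the kernel, and spanning is
  surjectivity.\<close>

lemma connecting_hom_iso_iff_basis:
  assumes sb: "semibrick R \<X>" and X: "X \<in> \<X>"
    and E: "short_exact R Y E (copower_sum \<X> I)"
    and c: "\<And>i. i \<in> I X \<Longrightarrow> c i = connecting_hom R Y E X (summand_inj (Sigma \<X> I) fst (X, i))"
  shows "is_basis (End_ring R X) (Ext R X Y) (I X) c \<longleftrightarrow>
    connecting_hom R Y E X \<in> iso (add_monoid (Hom R X (copower_sum \<X> I))) (add_monoid (Ext R X Y))"
    (is "?basis \<longleftrightarrow> ?iso")
proof -
  let ?N = "copower_sum \<X> I"
  let ?\<delta> = "connecting_hom R Y E X"
  have mods: "left_module R Z" if "Z \<in> \<X>" for Z
    using sb that by (auto simp: semibrick_def brick_def)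
  note XR = mods[OF X]
  have N: "left_module R ?N" using E by (rule short_exact_right)
  interpret N: left_module R ?N by (rule N)
  have Hc: "f \<in> carrier (Hom R X ?N) \<longleftrightarrow> f \<in> module_hom R X ?N \<and> f \<in> extensional (carrier X)" for f
    by (simp add: Hom_def)
  \<comment> \<open>Combinations are not extensional in general, whereas \<open>Hom\<close> consists
    of extensional maps; restriction passes between the two without changing the value of
    \<delta>.\<close>
  have restr: "restrict f (carrier X) \<in> carrier (Hom R X ?N)" if "f \<in> module_hom R X ?N" for f
    using module_hom_cong[OF that XR, of "restrict f (carrier X)"] by (simp add: Hc)
  have \<delta>_restr: "?\<delta> (restrict f (carrier X)) = ?\<delta> f" for f
    by (rule connecting_hom_cong) simp
  note comb = combination_hom[OF mods X E _ _ _ c]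
  have hom: "?\<delta> \<in> hom (add_monoid (Hom R X ?N)) (add_monoid (Ext R X Y))"
  proof (rule homI)
    fix f assume "f \<in> carrier (add_monoid (Hom R X ?N))"
    then show "?\<delta> f \<in> carrier (add_monoid (Ext R X Y))"
      using connecting_hom_in_Ext[OF E XR] by (simp add: Hc)
  next
    fix f g assume "f \<in> carrier (add_monoid (Hom R X ?N))" "g \<in> carrier (add_monoid (Hom R X ?N))"
    then show "?\<delta> (f \<otimes>\<^bsub>add_monoid (Hom R X ?N)\<^esub> g) = ?\<delta> f \<otimes>\<^bsub>add_monoid (Ext R X Y)\<^esub> ?\<delta> g"
      using connecting_hom_add[OF E XR, of f g] by (simp add: Hc) (simp add: Hom_def)
  qed
  \<comment> \<open>A trivial kernel gives injectivity without cancellation in \<open>Ext\<close>: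
    \<delta>(f - g) = \<delta>(f) + \<delta>(-g) = \<delta>(g) + \<delta>(-g) = \<delta>(0) = 0,
    where the negatives are formed among homomorphisms.\<close>
  have ker: "f = g" if fg: "f \<in> carrier (Hom R X ?N)" "g \<in> carrier (Hom R X ?N)" "?\<delta> f = ?\<delta> g"
    and trivial: "\<And>d. \<lbrakk>d \<in> module_hom R X ?N; ?\<delta> d = \<zero>\<^bsub>Ext R X Y\<^esub>\<rbrakk> \<Longrightarrow> \<forall>x\<in>carrier X. d x = \<zero>\<^bsub>?N\<^esub>" for f g
  proof -
    have f: "f \<in> module_hom R X ?N" and g: "g \<in> module_hom R X ?N" using fg by (auto simp: Hc)
    have "(\<lambda>n. \<ominus>\<^bsub>?N\<^esub> n) \<in> module_hom R ?N ?N"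
      by (rule module_homI) (auto simp: N.M.minus_add left_module_smult_r_minus[OF N])
    then have mg: "(\<lambda>x. \<ominus>\<^bsub>?N\<^esub> g x) \<in> module_hom R X ?N"
      by (rule module_hom_compose[OF g])
    define d where "d x = f x \<ominus>\<^bsub>?N\<^esub> g x" for x
    have d: "d \<in> module_hom R X ?N"
      unfolding d_def a_minus_def by (rule module_hom_pointwise_add[OF f mg N])
    have "?\<delta> d = ?\<delta> f \<oplus>\<^bsub>Ext R X Y\<^esub> ?\<delta> (\<lambda>x. \<ominus>\<^bsub>?N\<^esub> g x)"
      by (rule connecting_hom_add[OF E XR f mg]) (simp add: d_def a_minus_def)
    also have "\<dots> = ?\<delta> g \<oplus>\<^bsub>Ext R X Y\<^esub> ?\<delta> (\<lambda>x. \<ominus>\<^bsub>?N\<^esub> g x)" using fg(3) by simp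
    also have "\<dots> = ?\<delta> (\<lambda>x. \<zero>\<^bsub>?N\<^esub>)"
      by (rule connecting_hom_add[OF E XR g mg, symmetric])
        (simp add: module_hom_closed[OF g] N.M.r_neg)
    also have "\<dots> = \<zero>\<^bsub>Ext R X Y\<^esub>"
      by (rule connecting_hom_zero[OF E XR]) simp
    finally have "\<forall>x\<in>carrier X. d x = \<zero>\<^bsub>?N\<^esub>" by (rule trivial[OF d])
    then have "f x = g x" if "x \<in> carrier X" for x
      using that diff_eq_zero_iff[OF N] module_hom_closed[OF f] module_hom_closed[OF g] by (simp add: d_def)
    then show ?thesis using fg by (intro extensionalityI[of _ "carrier X"]) (auto simp: Hc)
  qed
  \<comment> \<open>The coordinate at \<open>(X, i)\<close> of a combination is exactly
    \<open>a i\<close>, which is why the inclusions are independent over the endomorphism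
    ring.\<close>
  have comb_zero: "(\<forall>x\<in>carrier X. combination \<X> I X F a x = \<zero>\<^bsub>?N\<^esub>) \<longleftrightarrow>
      (\<forall>i\<in>F. a i = \<zero>\<^bsub>End_ring R X\<^esub>)"
    if F: "F \<subseteq> I X" "a \<in> F \<rightarrow> carrier (End_ring R X)" for F a
  proof
    assume *: "\<forall>x\<in>carrier X. combination \<X> I X F a x = \<zero>\<^bsub>?N\<^esub>"
    show "\<forall>i\<in>F. a i = \<zero>\<^bsub>End_ring R X\<^esub>"
    proof
      fix i assume i: "i \<in> F"
      have "a i x = \<zero>\<^bsub>X\<^esub>" if x: "x \<in> carrier X" for x
        using fun_cong[OF bspec[OF * x], of "(X, i)"] X i F(1)
        by (auto simp: combination_def copower_sum_eq direct_sum_simps)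
      moreover have "a i \<in> extensional (carrier X)" using F(2) i by (auto simp: End_carrier)
      ultimately show "a i = \<zero>\<^bsub>End_ring R X\<^esub>"
        by (intro extensionalityI[of _ "carrier X"]) (auto simp: End_ring_def)
    qed
  next
    assume "\<forall>i\<in>F. a i = \<zero>\<^bsub>End_ring R X\<^esub>"
    then show "\<forall>x\<in>carrier X. combination \<X> I X F a x = \<zero>\<^bsub>?N\<^esub>"
      by (auto simp: combination_def copower_sum_eq direct_sum_simps End_ring_def intro!: restrict_ext)
  qed
  show ?thesis
  proof
    assume basis: ?basis
    have "inj_on ?\<delta> (carrier (Hom R X ?N))"
    proof (rule inj_onI, rule ker)
      fix d assume d: "d \<in> module_hom R X ?N" "?\<delta> d = \<zero>\<^bsub>Ext R X Y\<^esub>"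
      obtain F a where Fa: "finite F" "F \<subseteq> I X" "a \<in> F \<rightarrow> carrier (End_ring R X)"
        "\<forall>x\<in>carrier X. d x = combination \<X> I X F a x"
        by (rule semibrick_hom_combination[OF sb X d(1)])
      have "?\<delta> d = ?\<delta> (combination \<X> I X F a)"
        using Fa(4) by (intro connecting_hom_cong) simp
      then have "(\<Oplus>\<^bsub>Ext R X Y\<^esub>i\<in>F. a i \<odot>\<^bsub>Ext R X Y\<^esub> c i) = \<zero>\<^bsub>Ext R X Y\<^esub>"
        using comb[OF _ Fa(1-3)] d(2) by simp
      then have "\<forall>i\<in>F. a i = \<zero>\<^bsub>End_ring R X\<^esub>"
        using basis Fa(1-3) unfolding is_basis_def by blast
      then show "\<forall>x\<in>carrier X. d x = \<zero>\<^bsub>?N\<^esub>"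
        using comb_zero[OF Fa(2,3)] Fa(4) by simp
    qed
    moreover have "v \<in> ?\<delta> ` carrier (Hom R X ?N)" if v: "v \<in> carrier (Ext R X Y)" for v
    proof -
      obtain F a where Fa: "finite F" "F \<subseteq> I X" "a \<in> F \<rightarrow> carrier (End_ring R X)"
        "v = (\<Oplus>\<^bsub>Ext R X Y\<^esub>i\<in>F. a i \<odot>\<^bsub>Ext R X Y\<^esub> c i)"
        using bspec[OF conjunct2[OF conjunct2[OF basis[unfolded is_basis_def]]] v] by blast
      then have "combination \<X> I X F a \<in> module_hom R X ?N" "v = ?\<delta> (combination \<X> I X F a)"
        using comb[OF _ Fa(1-3)] by simp_all
      then show ?thesis
        using restr \<delta>_restr by (metis imageI)
    qed
    ultimately show ?iso
      using hom by (auto simp: iso_def bij_betw_def hom_def)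
  next
    assume iso: ?iso
    then have inj: "inj_on ?\<delta> (carrier (Hom R X ?N))"
      and surj: "?\<delta> ` carrier (Hom R X ?N) = carrier (Ext R X Y)"
      by (auto simp: iso_def bij_betw_def)
    have inj_hom: "summand_inj (Sigma \<X> I) fst (X, j) \<in> module_hom R X ?N" if "j \<in> I X" for j
      using summand_inj_hom[of "Sigma \<X> I" R fst "(X, j)"] mods X that by (auto simp: copower_sum_eq)
    have "c \<in> I X \<rightarrow> carrier (Ext R X Y)"
      using c connecting_hom_in_Ext[OF E XR inj_hom] by auto
    moreover have "\<forall>i\<in>F. a i = \<zero>\<^bsub>End_ring R X\<^esub>"
      if Fa: "finite F" "F \<subseteq> I X" "a \<in> F \<rightarrow> carrier (End_ring R X)"
        and z: "(\<Oplus>\<^bsub>Ext R X Y\<^esub>i\<in>F. a i \<odot>\<^bsub>Ext R X Y\<^esub> c i) = \<zero>\<^bsub>Ext R X Y\<^esub>" for F a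
    proof -
      have h: "combination \<X> I X F a \<in> module_hom R X ?N" "?\<delta> (combination \<X> I X F a) = \<zero>\<^bsub>Ext R X Y\<^esub>"
        using comb[OF _ Fa] z by simp_all
      have "?\<delta> (\<lambda>x. \<zero>\<^bsub>?N\<^esub>) = \<zero>\<^bsub>Ext R X Y\<^esub>"
        by (rule connecting_hom_zero[OF E XR]) simp
      \<comment> \<open>Injectivity is available on \<open>Hom\<close> only, so the combination is
        compared with the zero map after restriction.\<close>
      then have eq: "restrict (combination \<X> I X F a) (carrier X) = (\<lambda>x\<in>carrier X. \<zero>\<^bsub>?N\<^esub>)"
        using h restr[OF h(1)] restr[OF module_hom_const_zero[OF N]]
        by (intro inj_onD[OF inj]) (simp_all add: \<delta>_restr)
      have "combination \<X> I X F a x = \<zero>\<^bsub>?N\<^esub>" if "x \<in> carrier X" for x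
        using that fun_cong[OF eq, of x] by simp
      then show ?thesis using comb_zero[OF Fa(2,3)] by blast
    qed
    moreover have "\<exists>F a. finite F \<and> F \<subseteq> I X \<and> a \<in> F \<rightarrow> carrier (End_ring R X) \<and>
        v = (\<Oplus>\<^bsub>Ext R X Y\<^esub>i\<in>F. a i \<odot>\<^bsub>Ext R X Y\<^esub> c i)" if v: "v \<in> carrier (Ext R X Y)" for v
    proof -
      obtain f where f: "f \<in> module_hom R X ?N" "v = ?\<delta> f"
        using v unfolding surj[symmetric] by (auto simp: Hc)
      obtain F a where Fa: "finite F" "F \<subseteq> I X" "a \<in> F \<rightarrow> carrier (End_ring R X)"
        "\<forall>x\<in>carrier X. f x = combination \<X> I X F a x"
        by (rule semibrick_hom_combination[OF sb X f(1)])
      have "v = ?\<delta> (combination \<X> I X F a)"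
        unfolding f(2) using Fa(4) by (intro connecting_hom_cong) simp
      then have "v = (\<Oplus>\<^bsub>Ext R X Y\<^esub>i\<in>F. a i \<odot>\<^bsub>Ext R X Y\<^esub> c i)"
        using comb[OF _ Fa(1-3)] by simp
      then show ?thesis using Fa(1-3) by blast
    qed
    ultimately show ?basis
      unfolding is_basis_def by blast
  qed
qed

theorem lemma4p2:
  fixes R :: "('a, 'c) ring_scheme"
    and \<X> :: "('a, 'x) module set"
    and Y :: "('a, 'y) module"
    and I :: "('a, 'x) module \<Rightarrow> 'i set"
    and M :: "('a, 'm) module"
    and \<alpha> :: "'y \<Rightarrow> 'm"
    and \<beta> :: "'m \<Rightarrow> (('a, 'x) module \<times> 'i \<Rightarrow> 'x)"
  assumes "ring R"
    and "semibrick R \<X>"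
    and "left_module R Y"
    and "short_exact R Y (\<alpha>, M, \<beta>) (copower_sum \<X> I)"
  shows "universal_seq R \<X> I Y (\<alpha>, M, \<beta>) \<longleftrightarrow>
    (\<forall>X'\<in>\<X>. connecting_hom R Y (\<alpha>, M, \<beta>) X'
       \<in> iso (add_monoid (Hom R X' (copower_sum \<X> I))) (add_monoid (Ext R X' Y)))"
proof -
  let ?E = "(\<alpha>, M, \<beta>)" and ?K = "Sigma \<X> I"
  note E = assms(4)
  have E': "short_exact R Y ?E (direct_sum ?K fst)" using E by (simp add: copower_sum_eq)
  have mods: "left_module R X" if "X \<in> \<X>" for X
    using assms(2) that by (auto simp: semibrick_def brick_def)
  have inj: "summand_inj ?K fst (X, i) \<in> module_hom R X (copower_sum \<X> I)" if "X \<in> \<X>" "i \<in> I X" for X i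
    using summand_inj_hom[of ?K R fst "(X, i)"] mods that by (auto simp: copower_sum_eq)
  have U: "universal_seq_of \<X> I Y B = pushout_seq (direct_sum ?K (\<lambda>_. Y)) (summation_map ?K Y) Y
      (direct_sum_seq ?K (case_prod B))" for B :: "('a, 'x) module \<Rightarrow> 'i \<Rightarrow> ('a, 'y, 'x) ext_seq"
    by (simp add: universal_seq_of_def Let_def)
  have Bk: "short_exact R Y (case_prod B k) (fst k)"
    if "\<And>X i. \<lbrakk>X \<in> \<X>; i \<in> I X\<rbrakk> \<Longrightarrow> short_exact R Y (B X i) X" "k \<in> ?K"
    for B :: "('a, 'x) module \<Rightarrow> 'i \<Rightarrow> ('a, 'y, 'x) ext_seq" and k
    using that by (cases k) auto
  show ?thesis
  proof
    assume "universal_seq R \<X> I Y ?E"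
    then obtain B :: "('a, 'x) module \<Rightarrow> 'i \<Rightarrow> ('a, 'y, 'x) ext_seq" where
      B: "\<forall>X\<in>\<X>. (\<forall>i\<in>I X. short_exact R Y (B X i) X) \<and>
        is_basis (End_ring R X) (Ext R X Y) (I X) (\<lambda>i. ext_class R X Y (B X i))"
      and eq: "seq_equiv R Y ?E (universal_seq_of \<X> I Y B)"
      unfolding universal_seq_def by blast
    have Bk: "short_exact R Y (case_prod B k) (fst k)" if "k \<in> ?K" for k
      using Bk[of B k] B that by blast
    \<comment> \<open>The equivalence is reversed so that each \<open>B X i\<close> maps into the
      universal sequence and on into \<open>E\<close>, over the inclusion. This identifies its class
      with the value of \<delta> there.\<close>
    have UE: "seq_map R Y (universal_seq_of \<X> I Y B) ?E (\<lambda>y. y) (\<lambda>x. x)"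
      using seq_equiv_sym[OF E eq] by (rule seq_equiv_imp_seq_map)
    show "\<forall>X\<in>\<X>. connecting_hom R Y ?E X
       \<in> iso (add_monoid (Hom R X (copower_sum \<X> I))) (add_monoid (Ext R X Y))"
    proof
      fix X assume X: "X \<in> \<X>"
      have "ext_class R X Y (B X i) = connecting_hom R Y ?E X (summand_inj ?K fst (X, i))"
        if i: "i \<in> I X" for i
      proof (rule connecting_hom_eqI[OF E inj[OF X i], symmetric])
        show "short_exact R Y (B X i) X" using B X i by blast
        have "seq_map R Y (case_prod B (X, i)) (universal_seq_of \<X> I Y B) (\<lambda>y. y) (summand_inj ?K fst (X, i))"
          unfolding U by (rule seq_map_pushout_direct_sum[OF assms(3) Bk]) (use X i in auto)
        then have "seq_map R Y (B X i) (universal_seq_of \<X> I Y B) (\<lambda>y. y) (summand_inj ?K fst (X, i))"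
          by simp
        then show "seq_map R Y (B X i) ?E (\<lambda>y. y) (summand_inj ?K fst (X, i))"
          using seq_map_comp[OF _ UE] by blast
      qed
      then show "connecting_hom R Y ?E X
          \<in> iso (add_monoid (Hom R X (copower_sum \<X> I))) (add_monoid (Ext R X Y))"
        using connecting_hom_iso_iff_basis[OF assms(2) X E, of "\<lambda>i. ext_class R X Y (B X i)"] B X by blast
    qed
  next
    assume iso: "\<forall>X\<in>\<X>. connecting_hom R Y ?E X
       \<in> iso (add_monoid (Hom R X (copower_sum \<X> I))) (add_monoid (Ext R X Y))"
    \<comment> \<open>The pull-backs themselves have a middle term on another type, so members of
      their classes are chosen to serve as the basis extensions.\<close>
    define B :: "('a, 'x) module \<Rightarrow> 'i \<Rightarrow> ('a, 'y, 'x) ext_seq" where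
      "B X i = (SOME F. F \<in> ext_class R X Y (pullback_seq ?E X (summand_inj ?K fst (X, i))))" for X i
    have pb: "short_exact R Y (pullback_seq ?E X (summand_inj ?K fst (X, i))) X"
      if "X \<in> \<X>" "i \<in> I X" for X i
      by (rule short_exact_pullback[OF E mods[OF that(1)] inj[OF that]])
    have mem: "B X i \<in> ext_class R X Y (pullback_seq ?E X (summand_inj ?K fst (X, i)))"
      if "X \<in> \<X>" "i \<in> I X" for X i
      unfolding B_def using ext_class_nonempty[OF pb[OF that]] by (simp add: some_in_eq)
    note memD = ext_class_memD[OF pb mem]
    have Bk: "short_exact R Y (case_prod B k) (fst k)" if "k \<in> ?K" for k
      using Bk[of B k] memD(1) that by blast
    have maps: "seq_map R Y (case_prod B k) ?E (\<lambda>y. y) (summand_inj ?K fst k)" if kK: "k \<in> ?K" for k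
    proof -
      obtain X i where k: "k = (X, i)" "X \<in> \<X>" "i \<in> I X" using kK by auto
      have "seq_map R Y (B X i) (pullback_seq ?E X (summand_inj ?K fst (X, i))) (\<lambda>y. y) (\<lambda>x. x)"
        using seq_equiv_sym[OF pb memD(2)] k by (blast intro: seq_equiv_imp_seq_map)
      then show ?thesis
        using seq_map_comp[OF _ seq_map_pullback] unfolding k(1) prod.case by blast
    qed
    \<comment> \<open>The chosen extensions all lie over \<open>E\<close> along the inclusions, so
      the universal property yields a morphism with identities at both ends, hence an
      equivalence.\<close>
    have "seq_map R Y (universal_seq_of \<X> I Y B) ?E (\<lambda>y. y) (\<lambda>x. x)"
      unfolding U by (rule seq_map_from_pushout_direct_sum[OF assms(3) Bk E' maps])
    moreover have Ux: "short_exact R Y (universal_seq_of \<X> I Y B) (copower_sum \<X> I)"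
      unfolding U copower_sum_eq by (rule short_exact_pushout_direct_sum[OF assms(3) Bk])
    ultimately have "seq_equiv R Y ?E (universal_seq_of \<X> I Y B)"
      by (intro seq_equiv_sym[OF Ux] seq_map_imp_seq_equiv[OF Ux E])
    \<comment> \<open>Choosing another member leaves the class unchanged, so the classes of the
      \<open>B X i\<close> are still the values of \<delta> at the inclusions.\<close>
    moreover have "is_basis (End_ring R X) (Ext R X Y) (I X) (\<lambda>i. ext_class R X Y (B X i))"
      if X: "X \<in> \<X>" for X
      using connecting_hom_iso_iff_basis[OF assms(2) X E, of "\<lambda>i. ext_class R X Y (B X i)"] iso X
        memD(3)[OF X _ X] by (simp add: connecting_hom_apply)
    ultimately show "universal_seq R \<X> I Y ?E"
      unfolding universal_seq_def using memD(1) by blast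
  qed
qed

end
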